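(* Let $A\subset X$ and let $x\in X\setminus A$ be such that $A$ is $1$-thin at $x$. Then there exist a number $R>0$, open sets $G\subset V\subset X$, and a function $\eta\in N^{1,1}_0(V)$ such that $A\cap B(x,R)\subset G$, $V$ is $1$-thin at $x$, $0\le \eta\le 1$ on $X$, $\eta=1$ on $G$, and \[ \lim_{r\to 0}\frac{r}{\mu(B(x,r))}\,\|\eta\|_{N^{1,1}(B(x,r))}=0. \]
   Context: Standing assumptions: $(X,d,\mu)$ is a complete metric space with at least two points, $\mu$ is a Borel regular outer measure that is doubling ($0<\mu(B(y,2r))\le C_d\mu(B(y,r))<\infty$ for all balls), and $X$ supports a $(1,1)$-Poincaré inequality: there are $C_P>0$, $\lambda\ge1$ such that for every ball $B(y,r)$, every $u\in L^1_{\mathrm{loc}}(X)$ and every upper gradient $g$ of $u$, the mean of $|u-u_{B(y,r)}|$ over $B(y,r)$ is at most $C_P r$ times the mean of $g$ over $B(y,\lambda r)$. A nonnegative Borel $g$ is an upper gradient of $u$ if $|u(a)-u(b)|\le\int_\gamma g\,ds$ for every nonconstant rectifiable curve $\gamma$ with endpoints $a,b$; $g$ is a $1$-weak upper gradient if this holds for all curves outside a family of zero $1$-modulus (a family has zero $1$-modulus if some nonnegative Borel $\rho\in L^1(X)$ has $\int_\gamma\rho\,ds=\infty$ on each of its curves). For $\mu$-measurable $D$, $N^{1,1}(D)$ is the space of everywhere defined functions $u$ on $D$ with $\|u\|_{N^{1,1}(D)}:=\|u\|_{L^1(D)}+\inf_g\|g\|_{L^1(D)}<\infty$, infimum over $1$-weak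 upper gradients of $u$ in $D$; $g_u$ is the minimal $1$-weak upper gradient. $N_0^{1,1}(D)$ consists of restrictions to $D$ of $u\in N^{1,1}(X)$ with $u=0$ on $X\setminus D$. The variational capacity is $\mathrm{cap}_1(A,D):=\inf\int_X g_u\,d\mu$ over $u\in N^{1,1}_0(D)$ with $u\ge1$ on $A$. A set $A$ is $1$-thin at $x$ if $\lim_{r\to0} r\,\mathrm{cap}_1(A\cap B(x,r),B(x,2r))/\mu(B(x,r))=0$. *)

theory Defs
  imports "HOL-Analysis.Analysis"
begin

text \<open>A curve is a continuous map on the parameter interval [0,1] (every compact
parameter interval can be affinely reparametrised to [0,1]).\<close>

definition curve :: "(real \<Rightarrow> 'a::metric_space) \<Rightarrow> bool" where
  "curve \<gamma> \<longleftrightarrow> continuous_on {0..1} \<gamma>"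

definition curve_length :: "(real \<Rightarrow> 'a::metric_space) \<Rightarrow> real \<Rightarrow> real \<Rightarrow> ennreal" where
  "curve_length \<gamma> a b =
     (SUP p \<in> {(n, t). (t::nat \<Rightarrow> real) 0 = a \<and> t n = b \<and> (\<forall>i<n. t i \<le> t (Suc i))}.
        ennreal (\<Sum>i<fst p. dist (\<gamma> (snd p (Suc i))) (\<gamma> (snd p i))))"

definition rectifiable_curve :: "(real \<Rightarrow> 'a::metric_space) \<Rightarrow> bool" where
  "rectifiable_curve \<gamma> \<longleftrightarrow> curve \<gamma> \<and> curve_length \<gamma> 0 1 < \<infinity>"

definition nonconstant_curve :: "(real \<Rightarrow> 'a::metric_space) \<Rightarrow> bool" where
  "nonconstant_curve \<gamma> \<longleftrightarrow> (\<exists>s\<in>{0..1}. \<gamma> s \<noteq> \<gamma> 0)"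

definition arc_fun :: "(real \<Rightarrow> 'a::metric_space) \<Rightarrow> real \<Rightarrow> real" where
  "arc_fun \<gamma> t = enn2real (curve_length \<gamma> 0 (max 0 (min 1 t)))"

definition line_integral :: "('a::metric_space \<Rightarrow> ennreal) \<Rightarrow> (real \<Rightarrow> 'a) \<Rightarrow> ennreal" where
  "line_integral g \<gamma> = (\<integral>\<^sup>+ t. g (\<gamma> t) * indicator {0..1} t \<partial>interval_measure (arc_fun \<gamma>))"

definition adm_curve :: "'a::metric_space set \<Rightarrow> (real \<Rightarrow> 'a) \<Rightarrow> bool" where
  "adm_curve D \<gamma> \<longleftrightarrow> rectifiable_curve \<gamma> \<and> nonconstant_curve \<gamma> \<and> \<gamma> ` {0..1} \<subseteq> D"

definition upper_gradient :: "'a::metric_space set \<Rightarrow> ('a \<Rightarrow> real) \<Rightarrow> ('a \<Rightarrow> ennreal) \<Rightarrow> bool" where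
  "upper_gradient D u g \<longleftrightarrow> g \<in> borel_measurable borel \<and>
     (\<forall>\<gamma>. adm_curve D \<gamma> \<longrightarrow> ennreal \<bar>u (\<gamma> 0) - u (\<gamma> 1)\<bar> \<le> line_integral g \<gamma>)"

definition zero_mod1 :: "'a::metric_space measure \<Rightarrow> ((real \<Rightarrow> 'a) set) \<Rightarrow> bool" where
  "zero_mod1 M \<Gamma> \<longleftrightarrow> (\<exists>\<rho>. \<rho> \<in> borel_measurable borel \<and> (\<integral>\<^sup>+ z. \<rho> z \<partial>M) < \<infinity> \<and>
       (\<forall>\<gamma>\<in>\<Gamma>. line_integral \<rho> \<gamma> = \<infinity>))"

definition weak_upper_gradient ::
  "'a::metric_space measure \<Rightarrow> 'a set \<Rightarrow> ('a \<Rightarrow> real) \<Rightarrow> ('a \<Rightarrow> ennreal) \<Rightarrow> bool" where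
  "weak_upper_gradient M D u g \<longleftrightarrow> g \<in> borel_measurable borel \<and>
     (\<exists>\<Gamma>. zero_mod1 M \<Gamma> \<and>
        (\<forall>\<gamma>. adm_curve D \<gamma> \<and> \<gamma> \<notin> \<Gamma> \<longrightarrow> ennreal \<bar>u (\<gamma> 0) - u (\<gamma> 1)\<bar> \<le> line_integral g \<gamma>))"

definition N11_norm :: "'a::metric_space measure \<Rightarrow> 'a set \<Rightarrow> ('a \<Rightarrow> real) \<Rightarrow> ennreal" where
  "N11_norm M D u = (\<integral>\<^sup>+ z\<in>D. ennreal \<bar>u z\<bar> \<partial>M) +
      (INF g \<in> {g. weak_upper_gradient M D u g}. \<integral>\<^sup>+ z\<in>D. g z \<partial>M)"

text \<open>Functions on X whose restriction to D lies in N^{1,1}(D).\<close>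
definition N11 :: "'a::metric_space measure \<Rightarrow> 'a set \<Rightarrow> ('a \<Rightarrow> real) set" where
  "N11 M D = {u. (\<lambda>z. u z * indicator D z) \<in> borel_measurable M \<and> N11_norm M D u < \<infinity>}"

text \<open>N_0^{1,1}(D), represented by the functions on X that vanish off D.\<close>
definition N011 :: "'a::metric_space measure \<Rightarrow> 'a set \<Rightarrow> ('a \<Rightarrow> real) set" where
  "N011 M D = {u. u \<in> N11 M UNIV \<and> (\<forall>y. y \<notin> D \<longrightarrow> u y = 0)}"

text \<open>Variational 1-capacity. The integral of the minimal 1-weak upper gradient g_u
 equals the infimum of the integrals over all 1-weak upper gradients of u in X.\<close>
definition cap1 :: "'a::metric_space measure \<Rightarrow> 'a set \<Rightarrow> 'a set \<Rightarrow> ennreal" where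
  "cap1 M A D = (INF p \<in> {(u, g). u \<in> N011 M D \<and> (\<forall>y\<in>A. 1 \<le> u y) \<and>
                          weak_upper_gradient M UNIV u g}.
                   \<integral>\<^sup>+ z. snd p z \<partial>M)"

definition thin1 :: "'a::metric_space measure \<Rightarrow> 'a set \<Rightarrow> 'a \<Rightarrow> bool" where
  "thin1 M A x \<longleftrightarrow>
     ((\<lambda>r. ennreal r * cap1 M (A \<inter> ball x r) (ball x (2 * r)) / emeasure M (ball x r))
        \<longlongrightarrow> 0) (at_right 0)"

definition doubling :: "'a::metric_space measure \<Rightarrow> bool" where
  "doubling M \<longleftrightarrow> (\<exists>Cd::real. \<forall>y r. r > 0 \<longrightarrow>
      0 < emeasure M (ball y r) \<and>
      emeasure M (ball y (2 * r)) \<le> ennreal Cd * emeasure M (ball y r) \<and>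
      emeasure M (ball y (2 * r)) < \<infinity>)"

definition borel_regular :: "'a::metric_space measure \<Rightarrow> bool" where
  "borel_regular M \<longleftrightarrow> space M = UNIV \<and> sets borel \<subseteq> sets M \<and> complete_measure M \<and>
      (\<forall>A\<in>sets M. \<exists>B\<in>sets borel. A \<subseteq> B \<and> emeasure M (B - A) = 0)"

definition L1_loc :: "'a::metric_space measure \<Rightarrow> ('a \<Rightarrow> real) \<Rightarrow> bool" where
  "L1_loc M u \<longleftrightarrow> u \<in> borel_measurable M \<and>
      (\<forall>y. \<exists>r>0. (\<integral>\<^sup>+ z\<in>ball y r. ennreal \<bar>u z\<bar> \<partial>M) < \<infinity>)"

definition poincare_11 :: "'a::metric_space measure \<Rightarrow> bool" where
  "poincare_11 M \<longleftrightarrow> (\<exists>CP>0. \<exists>lam\<ge>1::real. \<forall>y r u g. r > 0 \<longrightarrow> L1_loc M u \<longrightarrow>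
      upper_gradient UNIV u g \<longrightarrow>
      (let uB = (LINT z:ball y r|M. u z) / measure M (ball y r) in
        (\<integral>\<^sup>+ z\<in>ball y r. ennreal \<bar>u z - uB\<bar> \<partial>M) / emeasure M (ball y r)
          \<le> ennreal (CP * r) * ((\<integral>\<^sup>+ z\<in>ball y (lam * r). g z \<partial>M) / emeasure M (ball y (lam * r)))))"

definition PI_space :: "'a::complete_space measure \<Rightarrow> bool" where
  "PI_space M \<longleftrightarrow> (\<exists>a b::'a. a \<noteq> b) \<and> borel_regular M \<and> doubling M \<and> poincare_11 M"

end

theory Submission
  imports Defs "HOL-Library.Diagonal_Subsequence"
begin

text \<open>
  Let \<open>u\<close> be a capacity test function for \<open>A \<inter> B(x, r)\<close> in \<open>B(x, 2r)\<close> with upper gradient \<open>g\<close>, made a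
  limit of an increasing sequence of continuous functions. The truncated infimum of the integrals of
  \<open>g\<close> over curves leading out of \<open>B(x, 2r)\<close> dominates \<open>min 1 u\<close>, has upper gradient \<open>g\<close>, and is itself
  an increasing limit of continuous functions, the infima over discrete chains. Hence its superlevel sets
  are open and their capacities are controlled, without recourse to quasicontinuity.

  To combine the scales, cut the dyadic radii into blocks at the first scale where \<open>\<mu>(B(x, r)) / r\<close> has
  halved. Inside a block the test function of the largest scale serves all scales, and between blocks the
  energies decay geometrically. Cutting a test function off near \<open>x\<close> at the end of its block is affordable
  because its averages over the concentric balls of the block stay small, no matter how many scales the
  block has: by the Poincare inequality a rise of the average costs energy at the levels passed, and each
  level is passed only once. If there is a last, infinite block, no cutoff is needed, since the energy in
  \<open>B(x, r)\<close> tends to zero while \<open>\<mu>(B(x, r)) / r\<close> stays bounded below.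
\<close>

section \<open>Length and line integrals of curves\<close>

text \<open>The superlevel sets of a capacity test function need not be open, so everything is
  carried by increasing sequences of continuous functions, and \<open>G\<close>, \<open>V\<close>
  are superlevel sets of a supremum at the levels 2/3 and 1/3. The yardstick is the density
  \<open>qq l\<close>, that is \<mu>(B)/r at scale \<open>rr l\<close>: thinness supplies at each
  scale a test function of energy \<epsilon> * \<open>qq l\<close> with \<epsilon> tending to 0. The
  sum of these over all scales may diverge where the density does not decay, as on a line, where
  \<mu>(B)/r is constant; this forces the blocks. Cutting off a function at radius r costs its
  integral over B(x, r) divided by r, so this integral must be of the order r * energy. The Poincare
  inequality gives exactly that for the deviation from a constant m. Once m \<le> 1/6 is known,
  replacing w by \<open>clip (6 * w - 1)\<close> removes m and still gives 1 wherever w \<ge> 1/3.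
  So all that is needed about averages is m \<le> 1/6, under a smallness condition on the energy
  that does not depend on the length of the block.\<close>

definition partition_sum :: "(real \<Rightarrow> 'a::metric_space) \<Rightarrow> nat \<Rightarrow> (nat \<Rightarrow> real) \<Rightarrow> real" where
  "partition_sum \<gamma> n t = (\<Sum>i<n. dist (\<gamma> (t (Suc i))) (\<gamma> (t i)))"

lemma partition_sum_nonneg: "0 \<le> partition_sum \<gamma> n t"
  unfolding partition_sum_def by (intro sum_nonneg) simp

lemma partition_sum_le_curve_length:
  assumes "t 0 = a" "t n = b" "\<And>i. i < n \<Longrightarrow> t i \<le> t (Suc i)"
  shows "ennreal (partition_sum \<gamma> n t) \<le> curve_length \<gamma> a b"
  unfolding curve_length_def partition_sum_def
  by (rule SUP_upper2[where i = "(n, t)"]) (use assms in auto)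

lemma curve_length_leI:
  assumes "\<And>n t. t 0 = a \<Longrightarrow> t n = b \<Longrightarrow> (\<And>i. i < n \<Longrightarrow> t i \<le> t (Suc i)) \<Longrightarrow>
    ennreal (partition_sum \<gamma> n t) \<le> L"
  shows "curve_length \<gamma> a b \<le> L"
  unfolding curve_length_def
  by (rule SUP_least) (use assms in \<open>auto simp: partition_sum_def\<close>)

lemma partition_bounds:
  fixes t :: "nat \<Rightarrow> real"
  assumes "\<And>i. i < n \<Longrightarrow> t i \<le> t (Suc i)" "i \<le> n"
  shows "t 0 \<le> t i" "t i \<le> t n"
proof -
  show "t 0 \<le> t i" using assms(2)
  proof (induction i)
    case (Suc i)
    then show ?case using assms(1)[of i] by simp
  qed simp
  have "t (n - k) \<le> t n" if "k \<le> n" for k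
    using that
  proof (induction k)
    case (Suc k)
    have "t (n - Suc k) \<le> t (Suc (n - Suc k))" using assms(1)[of "n - Suc k"] Suc.prems by simp
    also have "Suc (n - Suc k) = n - k" using Suc.prems by simp
    finally show ?case using Suc by simp
  qed simp
  from this[of "n - i"] show "t i \<le> t n" using assms(2) by simp
qed

lemma dist_le_curve_length:
  assumes "a \<le> b" shows "ennreal (dist (\<gamma> a) (\<gamma> b)) \<le> curve_length \<gamma> a b"
proof -
  have "ennreal (partition_sum \<gamma> 1 (\<lambda>i. if i = 0 then a else b)) \<le> curve_length \<gamma> a b"
    by (rule partition_sum_le_curve_length) (use assms in auto)
  then show ?thesis by (simp add: partition_sum_def dist_commute)
qed

text \<open>A partition of the long interval is clamped from above and from below at the intermediate point,
  which avoids inserting that point into it.\<close>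

lemma curve_length_subadditive:
  assumes "a \<le> b" "b \<le> c"
  shows "curve_length \<gamma> a c \<le> curve_length \<gamma> a b + curve_length \<gamma> b c"
proof (rule curve_length_leI)
  fix n and t :: "nat \<Rightarrow> real"
  assume t: "t 0 = a" "t n = c" "\<And>i. i < n \<Longrightarrow> t i \<le> t (Suc i)"
  have bd: "a \<le> t i" "t i \<le> c" if "i \<le> n" for i
    using partition_bounds[of n t i] t that by auto
  define l where "l = (\<lambda>i. min b (t i))"
  define u where "u = (\<lambda>i. max b (t i))"
  have "partition_sum \<gamma> n t \<le> partition_sum \<gamma> n l + partition_sum \<gamma> n u"
    unfolding partition_sum_def sum.distrib[symmetric]
  proof (rule sum_mono)
    fix i assume "i \<in> {..<n}"
    then have le: "t i \<le> t (Suc i)" using t by auto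
    show "dist (\<gamma> (t (Suc i))) (\<gamma> (t i)) \<le> dist (\<gamma> (l (Suc i))) (\<gamma> (l i)) + dist (\<gamma> (u (Suc i))) (\<gamma> (u i))"
    proof (cases "t (Suc i) \<le> b \<or> b \<le> t i")
      case True then show ?thesis using le by (auto simp: l_def u_def min_def max_def)
    next
      case False
      then have "l (Suc i) = b" "l i = t i" "u (Suc i) = t (Suc i)" "u i = b"
        by (auto simp: l_def u_def)
      then show ?thesis
        using dist_triangle[of "\<gamma> (t (Suc i))" "\<gamma> (t i)" "\<gamma> b"] by simp
    qed
  qed
  then have "ennreal (partition_sum \<gamma> n t) \<le> ennreal (partition_sum \<gamma> n l) + ennreal (partition_sum \<gamma> n u)"
    by (metis ennreal_leI ennreal_plus partition_sum_nonneg)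
  also have "ennreal (partition_sum \<gamma> n l) \<le> curve_length \<gamma> a b"
    by (rule partition_sum_le_curve_length) (use assms t in \<open>auto simp: l_def min_def, force\<close>)
  also have "ennreal (partition_sum \<gamma> n u) \<le> curve_length \<gamma> b c"
    by (rule partition_sum_le_curve_length) (use assms t in \<open>auto simp: u_def max_def, force\<close>)
  finally show "ennreal (partition_sum \<gamma> n t) \<le> curve_length \<gamma> a b + curve_length \<gamma> b c"
    by (simp add: add_mono)
qed

lemma partition_sum_append:
  fixes t s :: "nat \<Rightarrow> real"
  assumes "t n = s 0"
  shows "partition_sum \<gamma> (n + m) (\<lambda>i. if i \<le> n then t i else s (i - n)) = partition_sum \<gamma> n t + partition_sum \<gamma> m s"
proof (induction m)
  case 0
  show ?case by (auto simp: partition_sum_def intro!: sum.cong)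
next
  case (Suc m)
  have "partition_sum \<gamma> (n + Suc m) (\<lambda>i. if i \<le> n then t i else s (i - n)) =
    partition_sum \<gamma> (n + m) (\<lambda>i. if i \<le> n then t i else s (i - n)) + dist (\<gamma> (s (Suc m))) (\<gamma> (s m))"
    using assms by (cases "m = 0") (auto simp: partition_sum_def Suc_diff_le)
  then show ?case unfolding Suc.IH by (simp add: partition_sum_def)
qed

lemma curve_length_superadditive:
  assumes "a \<le> b" "b \<le> c"
  shows "curve_length \<gamma> a b + curve_length \<gamma> b c \<le> curve_length \<gamma> a c"
proof -
  define P where "P = (\<lambda>a b. {(n, t). (t::nat \<Rightarrow> real) 0 = a \<and> t n = b \<and> (\<forall>i<n. t i \<le> t (Suc i))})"
  have eq: "curve_length \<gamma> a b = (SUP p\<in>P a b. ennreal (partition_sum \<gamma> (fst p) (snd p)))" for a b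
    by (simp add: curve_length_def P_def partition_sum_def)
  have ne: "P a b \<noteq> {}" if "a \<le> b" for a b
  proof -
    have "(1, \<lambda>i. if i = 0 then a else b) \<in> P a b" using that by (auto simp: P_def)
    then show ?thesis by blast
  qed
  have *: "ennreal (partition_sum \<gamma> (fst p) (snd p)) + ennreal (partition_sum \<gamma> (fst q) (snd q)) \<le> curve_length \<gamma> a c"
    if "p \<in> P a b" "q \<in> P b c" for p q
  proof -
    obtain n t m s where pq: "p = (n, t)" "q = (m, s)" by (cases p, cases q)
    have t: "t 0 = a" "t n = b" "\<And>i. i < n \<Longrightarrow> t i \<le> t (Suc i)"
      and s: "s 0 = b" "s m = c" "\<And>i. i < m \<Longrightarrow> s i \<le> s (Suc i)"
      using that pq by (auto simp: P_def)
    have "ennreal (partition_sum \<gamma> (n + m) (\<lambda>i. if i \<le> n then t i else s (i - n))) \<le> curve_length \<gamma> a c"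
    proof (rule partition_sum_le_curve_length)
      fix i assume "i < n + m"
      then show "(if i \<le> n then t i else s (i - n)) \<le> (if Suc i \<le> n then t (Suc i) else s (Suc i - n))"
        using t(3)[of i] s(3)[of "i - n"] t s by (cases "i < n"; cases "i = n") (auto simp: Suc_diff_le)
    qed (use t s in auto)
    then show ?thesis
      using partition_sum_append[of t n s \<gamma> m] t s pq by (simp add: ennreal_plus[symmetric] partition_sum_nonneg del: ennreal_plus)
  qed
  show ?thesis
    unfolding eq[of a b] eq[of b c]
    by (subst ennreal_SUP_add_left[OF ne[OF assms(1)], symmetric], rule SUP_least,
        subst ennreal_SUP_add_right[OF ne[OF assms(2)]], rule SUP_least, rule *)
qed

lemma curve_length_additive:
  "a \<le> b \<Longrightarrow> b \<le> c \<Longrightarrow> curve_length \<gamma> a c = curve_length \<gamma> a b + curve_length \<gamma> b c"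
  by (intro antisym curve_length_subadditive curve_length_superadditive)

lemma rectifiable_curve_length_finite:
  assumes "rectifiable_curve \<gamma>" "0 \<le> s" "s \<le> t" "t \<le> 1"
  shows "curve_length \<gamma> s t < \<infinity>"
proof -
  have "curve_length \<gamma> 0 1 = curve_length \<gamma> 0 s + (curve_length \<gamma> s t + curve_length \<gamma> t 1)"
    using assms by (simp add: curve_length_additive[symmetric])
  then show ?thesis using assms(1) unfolding rectifiable_curve_def by (auto simp: less_top)
qed

section \<open>The arc length function of a curve\<close>

lemma arc_fun_diff:
  assumes "rectifiable_curve \<gamma>" "0 \<le> s" "s \<le> t" "t \<le> 1"
  shows "ennreal (arc_fun \<gamma> t - arc_fun \<gamma> s) = curve_length \<gamma> s t" "arc_fun \<gamma> s \<le> arc_fun \<gamma> t"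
proof -
  have f: "curve_length \<gamma> 0 s < \<infinity>" "curve_length \<gamma> s t < \<infinity>"
    using rectifiable_curve_length_finite[OF assms(1)] assms by auto
  have "arc_fun \<gamma> t = enn2real (curve_length \<gamma> 0 s + curve_length \<gamma> s t)"
    using assms by (simp add: arc_fun_def min_def max_def curve_length_additive[of 0 s t])
  also have "\<dots> = arc_fun \<gamma> s + enn2real (curve_length \<gamma> s t)"
    using f assms by (simp add: arc_fun_def enn2real_plus)
  finally have *: "arc_fun \<gamma> t = arc_fun \<gamma> s + enn2real (curve_length \<gamma> s t)" .
  then show "ennreal (arc_fun \<gamma> t - arc_fun \<gamma> s) = curve_length \<gamma> s t" using f by simp
  show "arc_fun \<gamma> s \<le> arc_fun \<gamma> t" using * by simp
qed

lemma arc_fun_clamp: "arc_fun \<gamma> t = arc_fun \<gamma> (max 0 (min 1 t))"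
  by (simp add: arc_fun_def)

lemma arc_fun_mono:
  assumes "rectifiable_curve \<gamma>" "s \<le> t"
  shows "arc_fun \<gamma> s \<le> arc_fun \<gamma> t"
proof -
  have "arc_fun \<gamma> (max 0 (min 1 s)) \<le> arc_fun \<gamma> (max 0 (min 1 t))"
    by (rule arc_fun_diff(2)[OF assms(1)]) (use assms(2) in auto)
  then show ?thesis unfolding arc_fun_clamp[symmetric] .
qed

lemma dist_le_arc_fun:
  assumes "rectifiable_curve \<gamma>" "0 \<le> s" "s \<le> t" "t \<le> 1"
  shows "dist (\<gamma> s) (\<gamma> t) \<le> arc_fun \<gamma> t - arc_fun \<gamma> s"
  using dist_le_curve_length[of s t \<gamma>] arc_fun_diff[OF assms] assms(3)
  by (metis diff_ge_0_iff_ge ennreal_le_iff)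

text \<open>\<open>interval_measure\<close> has the expected values on intervals when the function
  is right-continuous. The length over [t, 1] is bounded below by a partition sum whose points are
  pushed up to t; this sum is continuous in t, and subtracting it from the total length bounds
  \<open>arc_fun\<close> from above just to the right of s.\<close>

lemma arc_fun_right_continuous:
  assumes "rectifiable_curve \<gamma>"
  shows "continuous (at_right s) (arc_fun \<gamma>)"
proof -
  consider "s < 0" | "1 \<le> s" | "0 \<le> s" "s < 1" by linarith
  then show ?thesis
  proof cases
    case 1
    have "\<forall>\<^sub>F t in at_right s. arc_fun \<gamma> s = arc_fun \<gamma> t"
      using eventually_at_right_real[OF 1]
      by eventually_elim (use 1 in \<open>simp add: arc_fun_def\<close>)
    then show ?thesis unfolding continuous_within by (simp add: tendsto_eventually eventually_mono)
  next
    case 2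
    have "\<forall>\<^sub>F t in at_right s. arc_fun \<gamma> s = arc_fun \<gamma> t"
      using eventually_at_right_less[of s]
      by eventually_elim (use 2 in \<open>simp add: arc_fun_def\<close>)
    then show ?thesis unfolding continuous_within by (simp add: tendsto_eventually eventually_mono)
  next
    case 3
    have cont: "continuous_on {0..1} \<gamma>" using assms by (simp add: rectifiable_curve_def curve_def)
    have key: "\<forall>\<^sub>F t in at_right s. arc_fun \<gamma> t < arc_fun \<gamma> s + e" if "e > 0" for e
    proof -
      define L where "L = arc_fun \<gamma> 1 - arc_fun \<gamma> s"
      have L: "ennreal L = curve_length \<gamma> s 1" "0 \<le> L"
        using arc_fun_diff[OF assms, of s 1] 3 by (auto simp: L_def)
      \<comment> \<open>\<open>ennreal\<close> sends negative numbers to 0, so the strict inequality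
        fails when L = 0; that case is kept apart.\<close>
      have "ennreal (L - e/2) < curve_length \<gamma> s 1 \<or> L = 0"
        unfolding L(1)[symmetric] using L(2) that by (cases "L = 0") (auto intro!: ennreal_lessI)
      then obtain n \<tau> where \<tau>: "\<tau> 0 = s" "\<tau> n = 1" "\<And>i. i < n \<Longrightarrow> \<tau> i \<le> \<tau> (Suc i)" "L - e/2 < partition_sum \<gamma> n \<tau> \<or> L = 0"
      proof
        assume "ennreal (L - e/2) < curve_length \<gamma> s 1"
        then show ?thesis
          unfolding curve_length_def less_SUP_iff
          by (clarsimp simp: partition_sum_def[symmetric] split: prod.splits)
             (metis that ennreal_leI linorder_not_le)
      next
        assume "L = 0"
        then show ?thesis using that[of "\<lambda>i. if i = 0 then s else 1" 1] 3 by simp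
      qed
      have bd: "s \<le> \<tau> i" "\<tau> i \<le> 1" if "i \<le> n" for i
        using partition_bounds[of n \<tau> i] \<tau> that by auto
      define S where "S = (\<lambda>t. partition_sum \<gamma> n (\<lambda>i. max t (\<tau> i)))"
      have "continuous_on {s..1} (\<lambda>t. \<gamma> (max t (\<tau> i)))" if "i \<le> n" for i
        by (rule continuous_on_compose2[OF cont])
           (use bd[OF that] 3 in \<open>auto intro!: continuous_intros\<close>)
      then have "continuous_on {s..1} S"
        unfolding S_def partition_sum_def by (intro continuous_intros) auto
      then have "(S \<longlongrightarrow> S s) (at s within {s..1})" using 3 by (simp add: continuous_on_def)
      then have "(S \<longlongrightarrow> S s) (at_right s)" using 3 by (simp add: at_within_Icc_at_right)
      moreover have "S s = partition_sum \<gamma> n \<tau>"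
        unfolding S_def partition_sum_def using bd by (intro sum.cong) (auto simp: max_def)
      ultimately have "\<forall>\<^sub>F t in at_right s. S t > partition_sum \<gamma> n \<tau> - e/2"
        using \<open>e > 0\<close> by (intro order_tendstoD) auto
      moreover have "\<forall>\<^sub>F t in at_right s. t \<in> {s<..<1}" using 3 by (intro eventually_at_right_real) auto
      ultimately show ?thesis
      proof eventually_elim
        case (elim t)
        have "ennreal (S t) \<le> curve_length \<gamma> t 1"
          unfolding S_def by (rule partition_sum_le_curve_length)
            (use elim \<tau> in \<open>auto intro: max.coboundedI2\<close>)
        also have "\<dots> = ennreal (arc_fun \<gamma> 1 - arc_fun \<gamma> t)"
          using arc_fun_diff[OF assms, of t 1] elim 3 by auto
        finally have "S t \<le> arc_fun \<gamma> 1 - arc_fun \<gamma> t"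
          using arc_fun_mono[OF assms, of t 1] elim by (simp add: ennreal_le_iff)
        then show ?case using elim \<tau>(4) L_def arc_fun_mono[OF assms, of t 1] \<open>e > 0\<close> by auto
      qed
    qed
    show ?thesis unfolding continuous_within
    proof (rule order_tendstoI)
      fix a assume "a < arc_fun \<gamma> s"
      show "\<forall>\<^sub>F t in at_right s. a < arc_fun \<gamma> t"
        using eventually_at_right_less[of s]
      proof eventually_elim
        case (elim t)
        then show ?case using arc_fun_mono[OF assms, of s t] \<open>a < arc_fun \<gamma> s\<close> by simp
      qed
    next
      fix a assume "arc_fun \<gamma> s < a"
      then show "\<forall>\<^sub>F t in at_right s. arc_fun \<gamma> t < a"
        using key[of "a - arc_fun \<gamma> s"] by simp
    qed
  qed
qed

section \<open>Line integrals compared with step sums on equal parameter cells\<close>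

lemma emeasure_arc_Ioc:
  assumes "rectifiable_curve \<gamma>" "a \<le> b"
  shows "emeasure (interval_measure (arc_fun \<gamma>)) {a<..b} = ennreal (arc_fun \<gamma> b - arc_fun \<gamma> a)"
  by (rule emeasure_interval_measure_Ioc[OF assms(2)])
     (use arc_fun_mono arc_fun_right_continuous assms in auto)

lemma indicator_partition:
  fixes c :: "nat \<Rightarrow> ennreal" and t :: real
  assumes "M > 0" "0 < t" "t \<le> 1"
  obtains i where "i < M" "t \<in> {real i / real M<..real (Suc i) / real M}"
    "(\<Sum>j<M. c j * indicator {real j / real M<..real (Suc j) / real M} t) = c i"
proof -
  \<comment> \<open>Ceiling minus one rather than floor, since the cells are open on the left and
    closed on the right.\<close>
  define i where "i = nat (\<lceil>t * M\<rceil> - 1)"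
  have tM: "0 < t * M" "t * M \<le> M" using assms by auto
  then have c1: "\<lceil>t * M\<rceil> \<ge> 1" "\<lceil>t * M\<rceil> \<le> int M" by (auto simp: ceiling_le_iff)
  then have i: "i < M" "real i = real_of_int \<lceil>t * M\<rceil> - 1"
    unfolding i_def using assms(1) by linarith+
  have "real i < t * M" "t * M \<le> real (Suc i)" using i(2) by (auto; linarith)+
  then have *: "t \<in> {real i / real M<..real (Suc i) / real M}" using assms by (auto simp: field_simps)
  have "(\<Sum>j<M. c j * indicator {real j / real M<..real (Suc j) / real M} t) = (\<Sum>j<M. if j = i then c i else 0)"
  proof (rule sum.cong)
    fix j assume "j \<in> {..<M}"
    show "c j * indicator {real j / real M<..real (Suc j) / real M} t = (if j = i then c i else 0)"
    proof (cases "j = i")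
      case False
      have "t \<notin> {real j / real M<..real (Suc j) / real M}"
      proof
        assume "t \<in> {real j / real M<..real (Suc j) / real M}"
        then have "real j < t * M" "t * M \<le> real j + 1" using assms by (auto simp: field_simps)
        moreover have "real i < t * M" "t * M \<le> real i + 1" using * assms by (auto simp: field_simps)
        ultimately have "real j < real i + 1" "real i < real j + 1" by auto
        then show False using False by linarith
      qed
      then show ?thesis using False by simp
    qed (use * in simp)
  qed simp
  also have "\<dots> = c i" using i(1) by simp
  finally show ?thesis using that i * by blast
qed

lemma arc_step_integral:
  assumes "rectifiable_curve \<gamma>" "M > 0"
  shows "(\<integral>\<^sup>+t. (\<Sum>j<M. c j * indicator {real j / real M<..real (Suc j) / real M} t) \<partial>interval_measure (arc_fun \<gamma>))
    = (\<Sum>j<M. c j * ennreal (arc_fun \<gamma> (real (Suc j) / real M) - arc_fun \<gamma> (real j / real M)))"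
proof -
  have "emeasure (interval_measure (arc_fun \<gamma>)) {real j / real M<..real (Suc j) / real M} =
     ennreal (arc_fun \<gamma> (real (Suc j) / real M) - arc_fun \<gamma> (real j / real M))" for j
    using assms by (intro emeasure_arc_Ioc) (auto simp: field_simps)
  then show ?thesis
    by (subst nn_integral_sum) (simp_all add: nn_integral_cmult_indicator del: of_nat_Suc indicator_simps)
qed

lemma step_sum_le_line_integral:
  assumes "rectifiable_curve \<gamma>" "M > 0"
    and "\<And>j t. j < M \<Longrightarrow> t \<in> {real j / real M<..real (Suc j) / real M} \<Longrightarrow> c j \<le> g (\<gamma> t)"
  shows "(\<Sum>j<M. c j * ennreal (arc_fun \<gamma> (real (Suc j) / real M) - arc_fun \<gamma> (real j / real M)))
    \<le> line_integral g \<gamma>"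
  unfolding arc_step_integral[OF assms(1,2), symmetric] line_integral_def
proof (rule nn_integral_mono)
  fix t :: real
  show "(\<Sum>j<M. c j * indicator {real j / real M<..real (Suc j) / real M} t) \<le> g (\<gamma> t) * indicator {0..1} t"
  proof (cases "0 < t \<and> t \<le> 1")
    case True
    then obtain i where "i < M" "t \<in> {real i / real M<..real (Suc i) / real M}"
    "(\<Sum>j<M. c j * indicator {real j / real M<..real (Suc j) / real M} t) = c i"
      using indicator_partition[OF assms(2), of t c] by blast
    then show ?thesis using True assms(3)[of i t] by simp
  next
    case False
    have "t \<notin> {real j / real M<..real (Suc j) / real M}" if "j < M" for j
    proof
      assume a: "t \<in> {real j / real M<..real (Suc j) / real M}"
      have "0 \<le> real j / real M" "real (Suc j) / real M \<le> 1" using that by (auto simp: field_simps)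
      moreover have "real j / real M < t" "t \<le> real (Suc j) / real M" using a by auto
      ultimately show False using False by linarith
    qed
    then have "(\<Sum>j<M. c j * indicator {real j / real M<..real (Suc j) / real M} t) = 0"
      by (intro sum.neutral) auto
    then show ?thesis by simp
  qed
qed

lemma line_integral_le_step_sum:
  assumes "rectifiable_curve \<gamma>" "M > 0"
    and "\<And>j t. j < M \<Longrightarrow> t \<in> {real j / real M<..real (Suc j) / real M} \<Longrightarrow> g (\<gamma> t) \<le> c j"
  shows "line_integral g \<gamma> \<le>
    (\<Sum>j<M. c j * ennreal (arc_fun \<gamma> (real (Suc j) / real M) - arc_fun \<gamma> (real j / real M)))"
proof -
  let ?S = "\<lambda>t. (\<Sum>j<M. c j * indicator {real j / real M<..real (Suc j) / real M} t)"
  \<comment> \<open>The cells do not cover the parameter 0. As \<open>arc_fun\<close> is constant on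
    [-1, 0], the measure does not charge that point.\<close>
  have "emeasure (interval_measure (arc_fun \<gamma>)) {-1<..0} = 0"
    by (subst emeasure_arc_Ioc[OF assms(1)]) (auto simp: arc_fun_def)
  then have "{-1<..0} \<in> null_sets (interval_measure (arc_fun \<gamma>))" by (auto intro: null_setsI)
  then have "AE t in interval_measure (arc_fun \<gamma>). t \<notin> {-1<..0}" by (rule AE_not_in)
  then have "line_integral g \<gamma> \<le> integral\<^sup>N (interval_measure (arc_fun \<gamma>)) ?S"
    unfolding line_integral_def
  proof (intro nn_integral_mono_AE, eventually_elim)
    case (elim t)
    show ?case
    proof (cases "0 < t \<and> t \<le> 1")
      case True
      then obtain i where "i < M" "t \<in> {real i / real M<..real (Suc i) / real M}" "?S t = c i"
        using indicator_partition[OF assms(2), of t c] by blast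
      then show ?thesis using True assms(3)[of i t] by simp
    qed (use elim in auto)
  qed
  then show ?thesis unfolding arc_step_integral[OF assms(1,2)] .
qed

section \<open>Lipschitz functions with continuous gradient bounds\<close>

text \<open>The bound is required at one endpoint only, so that \<open>h\<close> is a genuine upper gradient, localised
  wherever \<open>w\<close> is locally constant.\<close>

definition lip_pair :: "('a::metric_space \<Rightarrow> real) \<Rightarrow> ('a \<Rightarrow> real) \<Rightarrow> bool" where
  "lip_pair w h \<longleftrightarrow> continuous_on UNIV h \<and> (\<forall>y. 0 \<le> h y) \<and>
     (\<exists>d>0. \<forall>a b. dist a b < d \<longrightarrow> \<bar>w a - w b\<bar> \<le> h a * dist a b)"

lemma lip_pairI:
  assumes "continuous_on UNIV h" "\<And>y. 0 \<le> h y" "d > 0"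
    "\<And>a b. dist a b < d \<Longrightarrow> \<bar>w a - w b\<bar> \<le> h a * dist a b"
  shows "lip_pair w h"
  unfolding lip_pair_def using assms by blast

lemma lip_pairE:
  assumes "lip_pair w h"
  obtains d where "d > 0" "\<And>a b. dist a b < d \<Longrightarrow> \<bar>w a - w b\<bar> \<le> h a * dist a b"
  using assms unfolding lip_pair_def by blast

lemma lip_pair_grad_continuous: "lip_pair w h \<Longrightarrow> continuous_on UNIV h"
  and lip_pair_grad_nonneg: "lip_pair w h \<Longrightarrow> 0 \<le> h y"
  unfolding lip_pair_def by auto

lemma lip_pair_continuous:
  assumes "lip_pair w h" shows "continuous_on UNIV w"
proof -
  obtain d where d: "d > 0" "\<And>a b. dist a b < d \<Longrightarrow> \<bar>w a - w b\<bar> \<le> h a * dist a b"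
    using lip_pairE[OF assms] by blast
  have "(w \<longlongrightarrow> w a) (at a)" for a
  proof -
    have "((\<lambda>b. h a * dist a b) \<longlongrightarrow> h a * dist a a) (at a)" by (intro tendsto_intros)
    moreover have "\<forall>\<^sub>F b in at a. dist b a < d" using d(1) by (auto simp: eventually_at)
    then have "\<forall>\<^sub>F b in at a. norm (w b - w a) \<le> h a * dist a b"
    proof eventually_elim
      case (elim b)
      then show ?case using d(2)[of a b] by (metis abs_minus_commute dist_commute real_norm_def)
    qed
    ultimately have "((\<lambda>b. w b - w a) \<longlongrightarrow> 0) (at a)"
      by (rule_tac Lim_null_comparison[where g = "\<lambda>b. h a * dist a b"]) simp_all
    then show ?thesis by (simp add: LIM_zero_iff)
  qed
  then show ?thesis by (simp add: continuous_on_def)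
qed

text \<open>On a fine uniform partition each increment of w is at most h at the left node times the
  arc length of the cell. Uniform continuity of h along the curve turns this into a lower step sum
  for the line integral, up to a small multiple of the length.\<close>

lemma lip_pair_upper_gradient:
  assumes "lip_pair w h"
  shows "upper_gradient UNIV w (\<lambda>y. ennreal (h y))"
  unfolding upper_gradient_def
proof (intro conjI allI impI)
  have hc: "continuous_on UNIV h" using assms by (rule lip_pair_grad_continuous)
  then show "(\<lambda>y. ennreal (h y)) \<in> borel_measurable borel"
    by (intro measurable_compose[OF _ measurable_ennreal] borel_measurable_continuous_onI)
  obtain d where d: "d > 0" "\<And>a b. dist a b < d \<Longrightarrow> \<bar>w a - w b\<bar> \<le> h a * dist a b"
    using lip_pairE[OF assms] by blast
  fix \<gamma> :: "real \<Rightarrow> 'a" assume "adm_curve UNIV \<gamma>"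
  then have r: "rectifiable_curve \<gamma>" by (simp add: adm_curve_def)
  then have \<gamma>c: "continuous_on {0..1} \<gamma>" by (simp add: rectifiable_curve_def curve_def)
  then have "uniformly_continuous_on {0..1} \<gamma>" by (rule compact_uniformly_continuous) simp
  then obtain d1 where d1: "d1 > 0" "\<And>s t. s \<in> {0..1} \<Longrightarrow> t \<in> {0..1} \<Longrightarrow> dist s t < d1 \<Longrightarrow> dist (\<gamma> s) (\<gamma> t) < d"
    using d(1) unfolding uniformly_continuous_on_def by meson
  have "continuous_on {0..1} (\<lambda>t. h (\<gamma> t))"
    by (rule continuous_on_compose2[OF hc \<gamma>c]) simp
  then have hu: "uniformly_continuous_on {0..1} (\<lambda>t. h (\<gamma> t))" by (rule compact_uniformly_continuous) simp
  define A where "A = arc_fun \<gamma>"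
  show "ennreal \<bar>w (\<gamma> 0) - w (\<gamma> 1)\<bar> \<le> line_integral (\<lambda>y. ennreal (h y)) \<gamma>"
  proof (rule ennreal_le_epsilon)
    fix e :: real assume "e > 0"
    \<comment> \<open>The total error is e' times the arc length; the summand 1 keeps the
      denominator positive.\<close>
    define e' where "e' = e / (A 1 - A 0 + 1)"
    have A01: "0 \<le> A 1 - A 0" using arc_fun_mono[OF r, of 0 1] by (simp add: A_def)
    have e': "e' > 0" "e' * (A 1 - A 0) \<le> e" using \<open>e > 0\<close> A01 by (auto simp: e'_def field_simps)
    obtain d2 where d2: "d2 > 0" "\<And>s t. s \<in> {0..1} \<Longrightarrow> t \<in> {0..1} \<Longrightarrow> dist s t < d2 \<Longrightarrow> dist (h (\<gamma> s)) (h (\<gamma> t)) < e'"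
      using hu e'(1) unfolding uniformly_continuous_on_def by meson
    obtain M' where "inverse (real (Suc M')) < min d1 d2"
      using reals_Archimedean[of "min d1 d2"] d1(1) d2(1) by auto
    then obtain M where M: "M > 0" "1 / real M < min d1 d2"
      using that[of "Suc M'"] by (simp add: inverse_eq_divide)
    define T where "T = (\<lambda>j. real j / real M)"
    have T: "T j \<in> {0..1}" if "j \<le> M" for j using that M by (auto simp: T_def field_simps)
    have T01: "T 0 = 0" "T M = 1" using M by (auto simp: T_def)
    have TS: "T (Suc j) - T j = 1 / real M" for j by (simp add: T_def field_simps add_divide_distrib)
    have Tle: "T j \<le> T (Suc j)" for j using M by (simp add: T_def field_simps)
    \<comment> \<open>A lower bound for h on the whole cell, where h differs from its value at the
      left node by less than e'. The maximum with 0 allows the passage to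
      \<open>ennreal\<close>.\<close>
    define c where "c = (\<lambda>j. max 0 (h (\<gamma> (T j)) - e'))"
    have cle: "c j \<le> h (\<gamma> t)" if "j < M" "t \<in> {T j<..T (Suc j)}" for j t
    proof -
      have "t \<in> {0..1}" using T[of j] T[of "Suc j"] that by auto
      moreover have "dist (T j) t < d2" using that TS[of j] M by (auto simp: dist_real_def)
      ultimately have "dist (h (\<gamma> (T j))) (h (\<gamma> t)) < e'" using d2(2)[of "T j" t] T[of j] that by auto
      then show ?thesis using lip_pair_grad_nonneg[OF assms] by (auto simp: c_def dist_real_def)
    qed
    have "\<bar>w (\<gamma> 0) - w (\<gamma> 1)\<bar> = \<bar>\<Sum>j<M. w (\<gamma> (T (Suc j))) - w (\<gamma> (T j))\<bar>"
      using sum_lessThan_telescope[of "\<lambda>j. w (\<gamma> (T j))" M] T01 by simp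
    also have "\<dots> \<le> (\<Sum>j<M. \<bar>w (\<gamma> (T (Suc j))) - w (\<gamma> (T j))\<bar>)" by (rule sum_abs)
    also have "\<dots> \<le> (\<Sum>j<M. (c j + e') * (A (T (Suc j)) - A (T j)))"
    proof (rule sum_mono)
      fix j assume "j \<in> {..<M}"
      then have j: "T j \<in> {0..1}" "T (Suc j) \<in> {0..1}" using T[of j] T[of "Suc j"] by auto
      have "dist (\<gamma> (T j)) (\<gamma> (T (Suc j))) < d"
      proof (rule d1(2)[OF j])
        have "dist (T j) (T (Suc j)) = 1 / real M" using TS[of j] Tle[of j] by (simp add: dist_real_def)
        then show "dist (T j) (T (Suc j)) < d1" using M by simp
      qed
      then have "\<bar>w (\<gamma> (T (Suc j))) - w (\<gamma> (T j))\<bar> \<le> h (\<gamma> (T j)) * dist (\<gamma> (T j)) (\<gamma> (T (Suc j)))"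
        using d(2) by (metis abs_minus_commute)
      also have "\<dots> \<le> (c j + e') * (A (T (Suc j)) - A (T j))"
        unfolding A_def using j Tle dist_le_arc_fun[OF r, of "T j" "T (Suc j)"] e'(1)
        by (intro mult_mono) (auto simp: c_def)
      finally show "\<bar>w (\<gamma> (T (Suc j))) - w (\<gamma> (T j))\<bar> \<le> (c j + e') * (A (T (Suc j)) - A (T j))" .
    qed
    also have "\<dots> = (\<Sum>j<M. c j * (A (T (Suc j)) - A (T j))) + e' * (A 1 - A 0)"
      using sum_lessThan_telescope[of "\<lambda>j. A (T j)" M] T01
      by (simp add: distrib_right sum.distrib sum_distrib_left[symmetric])
    also have "\<dots> \<le> (\<Sum>j<M. c j * (A (T (Suc j)) - A (T j))) + e" using e' by simp
    finally have "ennreal \<bar>w (\<gamma> 0) - w (\<gamma> 1)\<bar> \<le> ennreal ((\<Sum>j<M. c j * (A (T (Suc j)) - A (T j))) + e)"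
      by (rule ennreal_leI)
    also have "\<dots> = (\<Sum>j<M. ennreal (c j) * ennreal (A (T (Suc j)) - A (T j))) + ennreal e"
    proof -
      have nn: "0 \<le> c j * (A (T (Suc j)) - A (T j))" for j
        using Tle[of j] arc_fun_mono[OF r, of "T j" "T (Suc j)"] by (auto simp: A_def c_def)
      have "ennreal (c j) * ennreal (A (T (Suc j)) - A (T j)) = ennreal (c j * (A (T (Suc j)) - A (T j)))" for j
        using arc_fun_mono[OF r Tle[of j]] by (simp add: ennreal_mult c_def A_def)
      then show ?thesis using nn \<open>e > 0\<close> by (simp add: sum_nonneg)
    qed
    also have "(\<Sum>j<M. ennreal (c j) * ennreal (A (T (Suc j)) - A (T j))) \<le> line_integral (\<lambda>y. ennreal (h y)) \<gamma>"
      unfolding T_def A_def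
      by (rule step_sum_le_line_integral[OF r M(1)]) (use cle in \<open>auto simp: T_def intro!: ennreal_leI\<close>)
    finally show "ennreal \<bar>w (\<gamma> 0) - w (\<gamma> 1)\<bar> \<le> line_integral (\<lambda>y. ennreal (h y)) \<gamma> + ennreal e"
      by (simp add: add_right_mono)
  qed
qed

section \<open>Rescaling, truncating and cutting off Lipschitz pairs\<close>

definition clip :: "real \<Rightarrow> real" where "clip t = max 0 (min 1 t)"

lemma clip_bounds [simp]: "0 \<le> clip t" "clip t \<le> 1"
  by (auto simp: clip_def)

lemma clip_eq_0: "t \<le> 0 \<Longrightarrow> clip t = 0" and clip_eq_1: "1 \<le> t \<Longrightarrow> clip t = 1"
  by (auto simp: clip_def)

lemma clip_mono: "s \<le> t \<Longrightarrow> clip s \<le> clip t"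
  by (auto simp: clip_def)

lemma clip_lipschitz: "\<bar>clip s - clip t\<bar> \<le> \<bar>s - t\<bar>"
  by (auto simp: clip_def)

lemma continuous_on_clip [continuous_intros]:
  "continuous_on S f \<Longrightarrow> continuous_on S (\<lambda>y. clip (f y))"
  unfolding clip_def by (intro continuous_intros)

lemma lip_pair_clip:
  assumes "lip_pair w h" "0 \<le> \<alpha>"
  shows "lip_pair (\<lambda>y. clip (\<alpha> * w y - \<beta>)) (\<lambda>y. \<alpha> * h y)"
proof -
  obtain d where d: "d > 0" "\<And>a b. dist a b < d \<Longrightarrow> \<bar>w a - w b\<bar> \<le> h a * dist a b"
    using lip_pairE[OF assms(1)] by blast
  show ?thesis
  proof (rule lip_pairI[OF _ _ d(1)])
    show "continuous_on UNIV (\<lambda>y. \<alpha> * h y)"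
      using assms by (intro continuous_intros lip_pair_grad_continuous)
    show "0 \<le> \<alpha> * h y" for y
      using assms by (simp add: lip_pair_grad_nonneg)
    fix a b :: 'a assume "dist a b < d"
    have "\<bar>clip (\<alpha> * w a - \<beta>) - clip (\<alpha> * w b - \<beta>)\<bar> \<le> \<bar>\<alpha> * (w a - w b)\<bar>"
      using clip_lipschitz[of "\<alpha> * w a - \<beta>" "\<alpha> * w b - \<beta>"] by (simp add: algebra_simps)
    also have "\<dots> \<le> \<alpha> * (h a * dist a b)"
      using d(2)[OF \<open>dist a b < d\<close>] assms(2) by (simp add: abs_mult mult_left_mono)
    finally show "\<bar>clip (\<alpha> * w a - \<beta>) - clip (\<alpha> * w b - \<beta>)\<bar> \<le> \<alpha> * h a * dist a b" by (simp add: mult.assoc)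
  qed
qed

text \<open>A gradient bound that is both continuous and confined to {s < w < t} has to fade out
  before the levels s and t. The function is therefore truncated at s + 2 * \<eta> and t - 2 *
  \<eta>, while the gradient is full for w in [s + \<eta>, t - \<eta>]: from a point outside that
  range, nearby points still have values where the truncation is constant. The bound C on h makes
  the admissible distance uniform.\<close>

lemma lip_pair_truncate:
  assumes "lip_pair w h" "\<And>y. h y \<le> C" "\<eta> > 0"
  shows "lip_pair (\<lambda>y. max (s + 2 * \<eta>) (min (w y) (t - 2 * \<eta>)))
    (\<lambda>y. h y * clip (min (w y - s) (t - w y) / \<eta>))"
proof -
  obtain d where d: "d > 0" "\<And>a b. dist a b < d \<Longrightarrow> \<bar>w a - w b\<bar> \<le> h a * dist a b"
    using lip_pairE[OF assms(1)] by blast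
  have C: "0 \<le> C" using lip_pair_grad_nonneg[OF assms(1)] assms(2) order_trans by blast
  define W where "W = (\<lambda>y. max (s + 2 * \<eta>) (min (w y) (t - 2 * \<eta>)))"
  have "lip_pair W (\<lambda>y. h y * clip (min (w y - s) (t - w y) / \<eta>))"
  proof (rule lip_pairI[where d = "min d (\<eta> / (C + 1))"])
    show "continuous_on UNIV (\<lambda>y. h y * clip (min (w y - s) (t - w y) / \<eta>))"
      using assms(3) by (intro continuous_intros lip_pair_grad_continuous[OF assms(1)] lip_pair_continuous[OF assms(1)]) auto
    show "0 \<le> h y * clip (min (w y - s) (t - w y) / \<eta>)" for y
      using assms by (simp add: lip_pair_grad_nonneg)
    show "min d (\<eta> / (C + 1)) > 0" using d(1) C assms(3) by simp
    fix a b :: 'a assume ab: "dist a b < min d (\<eta> / (C + 1))"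
    then have 1: "\<bar>w a - w b\<bar> \<le> h a * dist a b" using d(2) by auto
    also have "\<dots> \<le> (C + 1) * dist a b" using assms(2)[of a] by (intro mult_right_mono) auto
    also have "\<dots> < \<eta>" using ab C by (simp add: field_simps)
    finally have 2: "\<bar>w a - w b\<bar> < \<eta>" .
    show "\<bar>W a - W b\<bar> \<le> h a * clip (min (w a - s) (t - w a) / \<eta>) * dist a b"
    proof (cases "s + \<eta> \<le> w a \<and> w a \<le> t - \<eta>")
      case True
      then have "clip (min (w a - s) (t - w a) / \<eta>) = 1"
        using assms(3) by (simp add: clip_def field_simps min_def)
      moreover have "\<bar>W a - W b\<bar> \<le> \<bar>w a - w b\<bar>" unfolding W_def by linarith
      ultimately show ?thesis using 1 by simp
    next
      case False
      then have "W a = W b" using 2 assms(3) unfolding W_def by linarith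
      then show ?thesis using assms by (simp add: lip_pair_grad_nonneg)
    qed
  qed
  then show ?thesis by (simp add: W_def)
qed

text \<open>Leibniz rule, split as \<psi> b (w a - w b) + w a (\<psi> a - \<psi> b), so that h and w
  both appear at the endpoint a where the gradient is evaluated. The continuous weights
  \<open>\<chi>1\<close> and \<open>\<chi>2\<close> localise the two terms near the support of
  \<psi> and near the region where \<psi> varies.\<close>

lemma lip_pair_cutoff:
  assumes "lip_pair w h" and w: "\<And>y. 0 \<le> w y"
    and \<psi>: "\<And>y. 0 \<le> \<psi> y" "\<And>y. \<psi> y \<le> 1" "\<And>a b. \<bar>\<psi> a - \<psi> b\<bar> \<le> L * dist a b" and L: "0 \<le> L"
    and \<chi>: "continuous_on UNIV \<chi>1" "\<And>y. 0 \<le> \<chi>1 y" "continuous_on UNIV \<chi>2" "\<And>y. 0 \<le> \<chi>2 y"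
    and \<delta>: "\<delta> > 0" "\<And>a b. dist a b < \<delta> \<Longrightarrow> \<psi> b \<noteq> 0 \<Longrightarrow> 1 \<le> \<chi>1 a"
      "\<And>a b. dist a b < \<delta> \<Longrightarrow> \<psi> a \<noteq> \<psi> b \<Longrightarrow> 1 \<le> \<chi>2 a"
  shows "lip_pair (\<lambda>y. \<psi> y * w y) (\<lambda>y. h y * \<chi>1 y + L * w y * \<chi>2 y)"
proof -
  obtain d where d: "d > 0" "\<And>a b. dist a b < d \<Longrightarrow> \<bar>w a - w b\<bar> \<le> h a * dist a b"
    using lip_pairE[OF assms(1)] by blast
  show ?thesis
  proof (rule lip_pairI[where d = "min d \<delta>"])
    show "continuous_on UNIV (\<lambda>y. h y * \<chi>1 y + L * w y * \<chi>2 y)"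
      by (intro continuous_intros lip_pair_grad_continuous[OF assms(1)] lip_pair_continuous[OF assms(1)] \<chi>)
    show "0 \<le> h y * \<chi>1 y + L * w y * \<chi>2 y" for y
      using assms by (simp add: lip_pair_grad_nonneg)
    fix a b :: 'a assume ab: "dist a b < min d \<delta>"
    have "\<psi> a * w a - \<psi> b * w b = \<psi> b * (w a - w b) + w a * (\<psi> a - \<psi> b)" by (simp add: algebra_simps)
    then have "\<bar>\<psi> a * w a - \<psi> b * w b\<bar> \<le> \<psi> b * \<bar>w a - w b\<bar> + w a * \<bar>\<psi> a - \<psi> b\<bar>"
      using \<psi> w by (metis abs_mult abs_of_nonneg abs_triangle_ineq)
    also have "\<psi> b * \<bar>w a - w b\<bar> \<le> h a * \<chi>1 a * dist a b"
    proof (cases "\<psi> b = 0")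
      case False
      then have "1 \<le> \<chi>1 a" using \<delta> ab by auto
      have "\<psi> b * \<bar>w a - w b\<bar> \<le> 1 * \<bar>w a - w b\<bar>" using \<psi> by (intro mult_right_mono) auto
      also have "\<dots> \<le> 1 * (h a * dist a b)" using d ab by simp
      also have "\<dots> \<le> \<chi>1 a * (h a * dist a b)"
        using \<open>1 \<le> \<chi>1 a\<close> lip_pair_grad_nonneg[OF assms(1)] by (intro mult_right_mono) auto
      finally show ?thesis by (simp add: ac_simps)
    qed (use \<chi> lip_pair_grad_nonneg[OF assms(1)] in simp)
    also have "w a * \<bar>\<psi> a - \<psi> b\<bar> \<le> L * w a * \<chi>2 a * dist a b"
    proof (cases "\<psi> a = \<psi> b")
      case False
      then have "1 \<le> \<chi>2 a" using \<delta> ab by auto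
      have "w a * \<bar>\<psi> a - \<psi> b\<bar> \<le> 1 * (w a * (L * dist a b))" using \<psi> w by (simp add: mult_left_mono)
      also have "\<dots> \<le> \<chi>2 a * (w a * (L * dist a b))"
        using \<open>1 \<le> \<chi>2 a\<close> w L by (intro mult_right_mono) auto
      finally show ?thesis by (simp add: ac_simps)
    qed (use \<chi> w L in simp)
    finally show "\<bar>\<psi> a * w a - \<psi> b * w b\<bar> \<le> (h a * \<chi>1 a + L * w a * \<chi>2 a) * dist a b"
      by (simp add: distrib_right)
  qed (use d \<delta> in auto)
qed

section \<open>Doubling measures\<close>

text \<open>Multiples of the distance to the complement, truncated at 1. On U the values are
  eventually equal to 1, not merely convergent to it, so that finitely many such sets can be handled
  with one index k.\<close>

lemma open_indicator_approx:
  fixes U :: "'a::metric_space set"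
  assumes "open U"
  obtains a :: "nat \<Rightarrow> 'a \<Rightarrow> real" where "\<And>k. continuous_on UNIV (a k)" "\<And>k y. 0 \<le> a k y"
    "\<And>k y. a k y \<le> indicator U y" "\<And>k y. a k y \<le> a (Suc k) y"
    "\<And>y. y \<in> U \<Longrightarrow> \<forall>\<^sub>F k in sequentially. a k y = 1"
proof (cases "U = UNIV")
  \<comment> \<open>\<open>infdist\<close> to the empty set is 0, so the general formula would fail
    here.\<close>
  case True
  then show ?thesis by (intro that[of "\<lambda>_ _. 1"]) auto
next
  case False
  define a where "a = (\<lambda>k y. min 1 (real k * infdist y (-U)))"
  show ?thesis
  proof (rule that[of a])
    show "continuous_on UNIV (a k)" for k unfolding a_def by (intro continuous_intros)
    show "0 \<le> a k y" for k y by (simp add: a_def infdist_nonneg)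
    show "a k y \<le> indicator U y" for k y by (auto simp: a_def indicator_def)
    show "a k y \<le> a (Suc k) y" for k y
      using infdist_nonneg[of y "-U"] by (simp add: a_def distrib_right min.coboundedI2)
    fix y assume "y \<in> U"
    then have pos: "infdist y (-U) > 0"
      using assms False in_closed_iff_infdist_zero[of "-U" y] infdist_nonneg[of y "-U"]
      by (auto simp: less_le closed_Compl)
    show "\<forall>\<^sub>F k in sequentially. a k y = 1"
    proof -
      obtain N :: nat where "1 / infdist y (-U) < real N" using reals_Archimedean2 by blast
      then have N: "1 < real N * infdist y (-U)" using pos by (simp add: field_simps)
      have "a k y = 1" if "k \<ge> N" for k
        using N mult_right_mono[of "real N" "real k" "infdist y (-U)"] pos that unfolding a_def by linarith
      then show ?thesis by (auto simp: eventually_sequentially)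
    qed
  qed
qed

text \<open>Discrete layer-cake formula: c times the number of n with n * c < z rounds z up to a
  multiple of c. It turns a Borel function into a sum of indicators of superlevel sets with uniform
  error c.\<close>

lemma layer_sum_bounds:
  fixes z :: ennreal and c :: real
  assumes "c > 0"
  defines "s \<equiv> \<Sum>n. ennreal c * (if ennreal (real n * c) < z then 1 else 0)"
  shows "z \<le> s" "s \<le> z + ennreal c"
proof -
  have "z \<le> s \<and> s \<le> z + ennreal c"
  proof (cases z)
    case (real r)
    define N where "N = nat \<lceil>r / c\<rceil>"
    have iff: "ennreal (real n * c) < z \<longleftrightarrow> n < N" for n
    proof -
      have "ennreal (real n * c) < z \<longleftrightarrow> real n < r / c"
        using real assms(1) by (simp add: ennreal_less_iff field_simps)
      also have "\<dots> \<longleftrightarrow> int n < \<lceil>r / c\<rceil>" by (simp add: less_ceiling_iff)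
      also have "\<dots> \<longleftrightarrow> n < N" unfolding N_def by linarith
      finally show ?thesis .
    qed
    have "s = (\<Sum>n<N. ennreal c)"
      unfolding s_def iff by (subst suminf_finite[of "{..<N}"]) auto
    also have "\<dots> = ennreal (real N * c)"
      using assms(1) by (simp add: ennreal_of_nat_eq_real_of_nat ennreal_mult)
    finally have s: "s = ennreal (real N * c)" .
    have "0 \<le> r / c" using real assms(1) by simp
    then have "r / c \<le> real N" "real N \<le> r / c + 1" unfolding N_def by linarith+
    then have "r \<le> real N * c" "real N * c \<le> r + c" using assms(1) by (simp_all add: field_simps)
    then show ?thesis using s real assms(1)
      by (auto simp: ennreal_le_iff ennreal_plus[symmetric] simp del: ennreal_plus)
  next
    case top
    have "s = (\<Sum>n. ennreal c)" unfolding s_def top by (simp add: ennreal_less_top)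
    also have "\<dots> = top"
    proof (rule ccontr)
      assume "(\<Sum>n. ennreal c) \<noteq> top"
      then have "summable (\<lambda>n::nat. c)" using assms(1) by (intro summable_suminf_not_top) auto
      then show False using assms(1) by (simp add: summable_const_iff)
    qed
    finally show ?thesis using top by simp
  qed
  then show "z \<le> s" "s \<le> z + ennreal c" by auto
qed

section \<open>Doubling measures: volume packing, compact balls, regularity\<close>

locale pi_space =
  fixes M :: "'a::complete_space measure" and Cd CP lam :: real
  assumes two_points: "\<exists>a b::'a. a \<noteq> b"
    and regular: "borel_regular M"
    and Cd: "1 \<le> Cd"
    and emeasure_ball_pos: "\<And>y r. 0 < r \<Longrightarrow> 0 < emeasure M (ball y r)"
    and emeasure_ball_double: "\<And>y r. 0 < r \<Longrightarrow> emeasure M (ball y (2 * r)) \<le> ennreal Cd * emeasure M (ball y r)"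
    and emeasure_ball_finite': "\<And>y r. 0 < r \<Longrightarrow> emeasure M (ball y (2 * r)) < \<infinity>"
    and CP: "0 < CP" and lam: "1 \<le> lam"
    and poincare: "\<And>y r u g. 0 < r \<Longrightarrow> L1_loc M u \<Longrightarrow> upper_gradient UNIV u g \<Longrightarrow>
      (\<integral>\<^sup>+ z\<in>ball y r. ennreal \<bar>u z - (LINT z:ball y r|M. u z) / measure M (ball y r)\<bar> \<partial>M) / emeasure M (ball y r)
          \<le> ennreal (CP * r) * ((\<integral>\<^sup>+ z\<in>ball y (lam * r). g z \<partial>M) / emeasure M (ball y (lam * r)))"
begin

lemma space_M [simp]: "space M = UNIV"
  using regular by (simp add: borel_regular_def)

lemma borel_sets_M: "A \<in> sets borel \<Longrightarrow> A \<in> sets M"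
  using regular by (auto simp: borel_regular_def)

lemma open_sets_M [measurable]: "open A \<Longrightarrow> A \<in> sets M"
  and closed_sets_M [measurable]: "closed A \<Longrightarrow> A \<in> sets M"
  by (auto intro: borel_sets_M)

lemma measurable_M:
  assumes "f \<in> measurable borel N" shows "f \<in> measurable M N"
proof (rule measurableI)
  show "f x \<in> space N" for x using measurable_space[OF assms, of x] by simp
  show "f -` A \<inter> space M \<in> sets M" if "A \<in> sets N" for A
    using measurable_sets[OF assms that] by (auto intro: borel_sets_M)
qed

lemma emeasure_ball_finite: "emeasure M (ball y r) < \<infinity>"
  using emeasure_ball_finite'[of "r/2" y] by (cases "r > 0") (auto simp: ball_empty)

lemma emeasure_ball_eq: "emeasure M (ball y r) = ennreal (measure M (ball y r))"
  using emeasure_ball_finite[of y r] by (intro emeasure_eq_ennreal_measure) auto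

lemma measure_ball_pos: "0 < r \<Longrightarrow> 0 < measure M (ball y r)"
  using emeasure_ball_pos[of r y] emeasure_ball_eq[of y r] by (simp add: measure_nonneg)

lemma measure_ball_double: "0 < r \<Longrightarrow> measure M (ball y (2 * r)) \<le> Cd * measure M (ball y r)"
  using emeasure_ball_double[of r y] Cd
  by (simp add: emeasure_ball_eq ennreal_mult[symmetric] ennreal_le_iff)

lemma measure_ball_double_power: "0 < r \<Longrightarrow> measure M (ball y (2 ^ n * r)) \<le> Cd ^ n * measure M (ball y r)"
proof (induction n)
  case (Suc n)
  have "measure M (ball y (2 * (2 ^ n * r))) \<le> Cd * measure M (ball y (2 ^ n * r))"
    using Suc by (intro measure_ball_double) auto
  also have "\<dots> \<le> Cd * (Cd ^ n * measure M (ball y r))" using Suc Cd by (intro mult_left_mono) auto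
  finally show ?case by (simp add: ac_simps)
qed simp

lemma fmeasurable_ball [simp]: "ball y r \<in> fmeasurable M"
  using emeasure_ball_finite by (auto intro: fmeasurableI)

lemma measure_mono_ball: "A \<subseteq> ball y r \<Longrightarrow> A \<in> sets M \<Longrightarrow> measure M A \<le> measure M (ball y r)"
  by (intro measure_mono_fmeasurable) auto

text \<open>Volume packing: the balls of radius e/2 about the points are disjoint, lie in one large
  ball, and by doubling each has at least a fixed fraction of the measure of a ball about x.\<close>

lemma card_separated_bounded:
  fixes x :: 'a
  assumes "e > 0"
  obtains N where "\<And>P. finite P \<Longrightarrow> P \<subseteq> cball x R \<Longrightarrow> (\<forall>a\<in>P. \<forall>b\<in>P. a \<noteq> b \<longrightarrow> e \<le> dist a b) \<Longrightarrow> card P \<le> N"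
proof -
  define R' where "R' = \<bar>R\<bar> + e"
  have R': "R' > 0" "R \<le> R'" "e \<le> R'" using assms by (auto simp: R'_def)
  obtain n where "4 * R' / e < 2 ^ n" using real_arch_pow[of 2] by auto
  then have n: "2 * R' \<le> 2 ^ n * (e / 2)" using assms by (simp add: field_simps)
  have low: "measure M (ball x R') \<le> Cd ^ n * measure M (ball y (e / 2))" if "y \<in> cball x R" for y
  proof -
    have "ball x R' \<subseteq> ball y (2 ^ n * (e/2))"
    proof
      fix z assume "z \<in> ball x R'"
      then show "z \<in> ball y (2 ^ n * (e/2))"
        using that n R' dist_triangle[of y z x] by (auto simp: dist_commute)
    qed
    then have "measure M (ball x R') \<le> measure M (ball y (2 ^ n * (e/2)))"
      by (intro measure_mono_ball) auto
    also have "\<dots> \<le> Cd ^ n * measure M (ball y (e / 2))" using assms by (intro measure_ball_double_power) auto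
    finally show ?thesis .
  qed
  define q where "q = Cd ^ n * measure M (ball x (2 * R')) / measure M (ball x R')"
  show ?thesis
  proof (rule that[of "nat \<lceil>q\<rceil>"])
    fix P assume P: "finite P" "P \<subseteq> cball x R" "\<forall>a\<in>P. \<forall>b\<in>P. a \<noteq> b \<longrightarrow> e \<le> dist a b"
    have "disjoint_family_on (\<lambda>y. ball y (e/2)) P"
      unfolding disjoint_family_on_def
    proof (intro ballI impI equals0I)
      fix a b z assume "a \<in> P" "b \<in> P" "a \<noteq> b" "z \<in> ball a (e/2) \<inter> ball b (e/2)"
      then show False using P(3) dist_triangle[of a b z] by (force simp: dist_commute)
    qed
    then have "(\<Sum>y\<in>P. measure M (ball y (e/2))) = measure M (\<Union>y\<in>P. ball y (e/2))"
      using P(1) by (intro measure_finite_Union[symmetric]) (auto simp: emeasure_ball_eq)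
    also have "\<dots> \<le> measure M (ball x (2 * R'))"
    proof (rule measure_mono_ball)
      show "(\<Union>y\<in>P. ball y (e / 2)) \<subseteq> ball x (2 * R')"
      proof
        fix z assume "z \<in> (\<Union>y\<in>P. ball y (e / 2))"
        then obtain y where "y \<in> P" "dist y z < e / 2" by auto
        then show "z \<in> ball x (2 * R')" using P(2) R' assms dist_triangle[of x z y] by force
      qed
    qed (use P(1) in \<open>auto intro!: sets.finite_UN\<close>)
    finally have 1: "(\<Sum>y\<in>P. measure M (ball y (e/2))) \<le> measure M (ball x (2 * R'))" .
    have "real (card P) * measure M (ball x R') = (\<Sum>y\<in>P. measure M (ball x R'))" by simp
    also have "\<dots> \<le> (\<Sum>y\<in>P. Cd ^ n * measure M (ball y (e/2)))"
      using low P(2) by (intro sum_mono) auto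
    also have "\<dots> \<le> Cd ^ n * measure M (ball x (2 * R'))"
      using 1 Cd by (simp add: sum_distrib_left[symmetric])
    finally have "real (card P) \<le> q"
      using measure_ball_pos[OF R'(1), of x] by (simp add: q_def field_simps)
    then show "card P \<le> nat \<lceil>q\<rceil>" by linarith
  qed
qed

text \<open>A separated subset of maximal cardinality is a finite e-net, since a point that is not
  covered could be added. Compactness of closed balls later produces limit curves from
  chains.\<close>

lemma compact_cball: "compact (cball (x::'a) R)"
  unfolding compact_eq_totally_bounded
proof (intro conjI allI impI)
  show "complete (cball x R)" by (simp add: complete_eq_closed)
  fix e :: real assume "e > 0"
  obtain N where N: "\<And>P. finite P \<Longrightarrow> P \<subseteq> cball x R \<Longrightarrow> (\<forall>a\<in>P. \<forall>b\<in>P. a \<noteq> b \<longrightarrow> e \<le> dist a b) \<Longrightarrow> card P \<le> N"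
    using card_separated_bounded[OF \<open>e > 0\<close>] by metis
  define Q where "Q = (\<lambda>P. finite P \<and> P \<subseteq> cball x R \<and> (\<forall>a\<in>P. \<forall>b\<in>P. a \<noteq> b \<longrightarrow> e \<le> dist a b))"
  have "Q {}" by (simp add: Q_def)
  then obtain P where P: "Q P" "\<And>P'. Q P' \<Longrightarrow> card P' \<le> card P"
    using ex_has_greatest_nat[of Q "{}" card "Suc N"] N by (metis Q_def less_Suc_eq_le)
  have "cball x R \<subseteq> (\<Union>y\<in>P. ball y e)"
  proof
    fix z assume z: "z \<in> cball x R"
    show "z \<in> (\<Union>y\<in>P. ball y e)"
    proof (rule ccontr)
      assume "z \<notin> (\<Union>y\<in>P. ball y e)"
      then have far: "e \<le> dist y z" if "y \<in> P" for y using that by force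
      then have "z \<notin> P" using \<open>e > 0\<close> by force
      have "Q (insert z P)" using P(1) z far by (auto simp: Q_def dist_commute)
      then show False using P(2)[of "insert z P"] P(1) \<open>z \<notin> P\<close> by (simp add: Q_def)
    qed
  qed
  then show "\<exists>k. finite k \<and> cball x R \<subseteq> (\<Union>y\<in>k. ball y e)" using P(1) by (auto simp: Q_def)
qed

text \<open>Induction over the generation of the Borel sets. Inner closed and outer open sets are
  carried along together so that the complement step merely exchanges them; intersecting with a ball
  makes all measures finite, as continuity from above requires.\<close>

lemma closed_open_approx:
  fixes x :: 'a
  assumes "E \<in> sets borel" "\<epsilon> > 0"
  shows "\<exists>C U. closed C \<and> open U \<and> C \<subseteq> E \<and> E \<subseteq> U \<and> emeasure M ((U - C) \<inter> ball x \<rho>) < ennreal \<epsilon>"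
proof -
  let ?B = "ball x \<rho>"
  have fin: "emeasure M (A \<inter> ?B) \<noteq> \<infinity>" for A
    using emeasure_mono[of "A \<inter> ?B" ?B M] emeasure_ball_finite[of x \<rho>] by (auto simp: top_unique)
  have lim: "\<exists>n. emeasure M (D n \<inter> ?B) < a"
    if D: "\<And>n. D n \<in> sets M" "decseq D" "emeasure M ((\<Inter>n. D n) \<inter> ?B) < a" for D :: "nat \<Rightarrow> 'a set" and a
  proof -
    have "(\<lambda>n. emeasure M (D n \<inter> ?B)) \<longlonglongrightarrow> emeasure M (\<Inter>n. D n \<inter> ?B)"
      using D fin by (intro Lim_emeasure_decseq) (auto simp: decseq_def)
    then have "\<forall>\<^sub>F n in sequentially. emeasure M (D n \<inter> ?B) < a"
      by (rule order_tendstoD) (use D(3) in simp)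
    then show ?thesis by (auto simp: eventually_sequentially)
  qed
  have "E \<in> sigma_sets UNIV {S. open S}" using assms(1) by (simp add: borel_def)
  then show ?thesis using assms(2)
  proof (induction arbitrary: \<epsilon>)
    case (Basic U)
    then have "open U" by simp
    show ?case
    proof (cases "U = UNIV")
      case True
      then show ?thesis using Basic by (intro exI[of _ UNIV]) auto
    next
      case False
      define C where "C = (\<lambda>n. {y. 1 / real (Suc n) \<le> infdist y (-U)})"
      have C: "closed (C n)" for n unfolding C_def by (intro closed_Collect_le continuous_intros)
      have sub: "C n \<subseteq> U" for n by (auto simp: C_def) (metis ComplI infdist_zero not_one_le_zero of_nat_0_less_iff divide_le_0_1_iff linorder_not_le of_nat_Suc zero_less_Suc)
      have "y \<in> (\<Union>n. C n)" if "y \<in> U" for y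
      proof -
        have "infdist y (-U) > 0"
          using \<open>open U\<close> False that in_closed_iff_infdist_zero[of "-U" y] infdist_nonneg[of y "-U"]
          by (auto simp: less_le closed_Compl)
        then obtain n where "inverse (real (Suc n)) < infdist y (-U)" using reals_Archimedean by blast
        then show ?thesis by (auto simp: C_def inverse_eq_divide intro!: exI[of _ n])
      qed
      then have "(\<Inter>n. U - C n) = {}" by auto
      then have "\<exists>n. emeasure M ((U - C n) \<inter> ?B) < ennreal \<epsilon>"
      proof (intro lim)
        show "U - C n \<in> sets M" for n using \<open>open U\<close> C by auto
        have "C m \<subseteq> C n" if "m \<le> n" for m n
        proof
          fix y assume "y \<in> C m"
          moreover have "1 / real (Suc n) \<le> 1 / real (Suc m)" using that by (intro divide_left_mono) auto
          ultimately show "y \<in> C n" unfolding C_def mem_Collect_eq by linarith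
        qed
        then show "decseq (\<lambda>n. U - C n)" unfolding decseq_def by blast
        have "emeasure M ((\<Inter>n. U - C n) \<inter> ?B) = 0" unfolding \<open>(\<Inter>n. U - C n) = {}\<close> by simp
        then show "emeasure M ((\<Inter>n. U - C n) \<inter> ?B) < ennreal \<epsilon>" using Basic by simp
      qed
      then show ?thesis using C sub \<open>open U\<close> by blast
    qed
  next
    case Empty
    then show ?case by (intro exI[of _ "{}"]) auto
  next
    case (Compl E)
    then obtain C U where "closed C" "open U" "C \<subseteq> E" "E \<subseteq> U" "emeasure M ((U - C) \<inter> ?B) < ennreal \<epsilon>"
      using Compl.IH[OF Compl.prems] by (elim exE conjE)
    moreover have "(- C) - (- U) = U - C" by auto
    ultimately show ?case by (intro exI[of _ "- U"] exI[of _ "- C"]) (auto simp: Compl_eq_Diff_UNIV[symmetric])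
  next
    case (Union E)
    \<comment> \<open>Half of \<epsilon> is spread over the sets E i. The other half is the room for
      replacing the union of the C i, which need not be closed, by a finite union.\<close>
    have "\<exists>C U. closed C \<and> open U \<and> C \<subseteq> E i \<and> E i \<subseteq> U \<and> emeasure M ((U - C) \<inter> ?B) < ennreal (\<epsilon> / 2 * (1/2) ^ Suc i)" for i
      using Union by simp
    then obtain C U where CU: "\<And>i. closed (C i)" "\<And>i. open (U i)" "\<And>i. C i \<subseteq> E i" "\<And>i. E i \<subseteq> U i"
      "\<And>i. emeasure M ((U i - C i) \<inter> ?B) < ennreal (\<epsilon> / 2 * (1/2) ^ Suc i)" by metis
    have meas [measurable]: "C i \<in> sets M" "U i \<in> sets M" for i using CU by auto
    define D where "D = (\<lambda>n. (\<Union>i. U i) - (\<Union>i<n. C i))"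
    have "emeasure M ((\<Inter>n. D n) \<inter> ?B) \<le> emeasure M (\<Union>i. (U i - C i) \<inter> ?B)"
      by (intro emeasure_mono) (auto simp: D_def)
    also have "\<dots> \<le> (\<Sum>i. emeasure M ((U i - C i) \<inter> ?B))"
      by (intro emeasure_subadditive_countably) auto
    also have "\<dots> \<le> (\<Sum>i. ennreal (\<epsilon> / 2 * (1/2) ^ Suc i))"
      using CU(5) by (intro suminf_le) (auto intro: less_imp_le)
    also have "\<dots> = ennreal (\<epsilon> / 2)"
    proof (rule suminf_ennreal_eq)
      show "(\<lambda>i. \<epsilon> / 2 * (1 / 2) ^ Suc i) sums (\<epsilon> / 2)"
        using sums_mult[OF power_half_series, of "\<epsilon> / 2"] by simp
    qed (use Union in simp)
    also have "\<dots> < ennreal \<epsilon>" using Union by (intro ennreal_lessI) auto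
    finally have "\<exists>n. emeasure M (D n \<inter> ?B) < ennreal \<epsilon>"
      by (intro lim) (auto simp: D_def decseq_def)
    then obtain n where "emeasure M (D n \<inter> ?B) < ennreal \<epsilon>" by blast
    moreover have "closed (\<Union>i<n. C i)" "open (\<Union>i. U i)" using CU by auto
    moreover have "(\<Union>i<n. C i) \<subseteq> (\<Union>i. E i)" "(\<Union>i. E i) \<subseteq> (\<Union>i. U i)"
      using CU(3,4) by blast+
    ultimately show ?case unfolding D_def by blast
  qed
qed

lemma outer_open_approx:
  fixes x :: 'a
  assumes "E \<in> sets borel" "\<epsilon> > 0"
  obtains U where "open U" "E \<inter> ball x \<rho> \<subseteq> U" "U \<subseteq> ball x \<rho>"
    "emeasure M U \<le> emeasure M (E \<inter> ball x \<rho>) + ennreal \<epsilon>"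
proof -
  obtain C U where CU: "closed C" "open U" "C \<subseteq> E" "E \<subseteq> U" "emeasure M ((U - C) \<inter> ball x \<rho>) < ennreal \<epsilon>"
    using closed_open_approx[OF assms, of x \<rho>] by (elim exE conjE)
  have "emeasure M (U \<inter> ball x \<rho>) \<le> emeasure M ((E \<inter> ball x \<rho>) \<union> ((U - C) \<inter> ball x \<rho>))"
    using CU borel_sets_M[OF assms(1)] by (intro emeasure_mono) auto
  also have "\<dots> \<le> emeasure M (E \<inter> ball x \<rho>) + emeasure M ((U - C) \<inter> ball x \<rho>)"
    using CU borel_sets_M[OF assms(1)] by (intro emeasure_subadditive) auto
  also have "\<dots> \<le> emeasure M (E \<inter> ball x \<rho>) + ennreal \<epsilon>" using CU(5) by (intro add_left_mono) simp
  finally show ?thesis using CU by (intro that[of "U \<inter> ball x \<rho>"]) auto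
qed

end

section \<open>Chain functions and limit curves\<close>

text \<open>Discrete counterpart of a line integral. With the minimum over both endpoints each step
  is bounded by g at either end, as the one-sided bound in \<open>lip_pair\<close> demands.\<close>

definition chain_cost :: "('a::metric_space \<Rightarrow> real) \<Rightarrow> (nat \<Rightarrow> 'a) \<Rightarrow> nat \<Rightarrow> real" where
  "chain_cost g p n = (\<Sum>i<n. min (g (p i)) (g (p (Suc i))) * dist (p i) (p (Suc i)))"

text \<open>Chains stop at their first point in F. When F is the complement of a ball, all earlier
  points stay in that ball and the last one is a single step away, which confines the chain to a
  compact set.\<close>

definition chains_to :: "real \<Rightarrow> 'a::metric_space set \<Rightarrow> 'a \<Rightarrow> (nat \<times> (nat \<Rightarrow> 'a)) set" where
  "chains_to d F y = {(n, p). p 0 = y \<and> p n \<in> F \<and> (\<forall>i<n. p i \<notin> F \<and> dist (p i) (p (Suc i)) < d)}"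

definition chain_costs :: "('a::metric_space \<Rightarrow> real) \<Rightarrow> real \<Rightarrow> 'a set \<Rightarrow> 'a \<Rightarrow> real set" where
  "chain_costs g d F y = (\<lambda>(n, p). chain_cost g p n) ` chains_to d F y"

text \<open>Inserting 1 truncates the infimum at 1 and covers the case that no chain exists.\<close>

definition chain_fun :: "('a::metric_space \<Rightarrow> real) \<Rightarrow> real \<Rightarrow> 'a set \<Rightarrow> 'a \<Rightarrow> real" where
  "chain_fun g d F y = Inf (insert 1 (chain_costs g d F y))"

lemma chain_cost_nonneg: "(\<And>z. 0 \<le> g z) \<Longrightarrow> 0 \<le> chain_cost g p n"
  unfolding chain_cost_def by (intro sum_nonneg) auto

lemma chain_costs_bdd_below: "(\<And>z. 0 \<le> g z) \<Longrightarrow> bdd_below (insert 1 (chain_costs g d F y))"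
  by (rule bdd_belowI[of _ 0]) (auto simp: chain_costs_def chain_cost_nonneg)

lemma chain_fun_nonneg: "(\<And>z. 0 \<le> g z) \<Longrightarrow> 0 \<le> chain_fun g d F y"
  unfolding chain_fun_def by (rule cInf_greatest) (auto simp: chain_costs_def chain_cost_nonneg)

lemma chain_fun_le_one: "(\<And>z. 0 \<le> g z) \<Longrightarrow> chain_fun g d F y \<le> 1"
  unfolding chain_fun_def by (intro cInf_lower chain_costs_bdd_below) auto

lemma chain_fun_le_cost:
  "(\<And>z. 0 \<le> g z) \<Longrightarrow> (n, p) \<in> chains_to d F y \<Longrightarrow> chain_fun g d F y \<le> chain_cost g p n"
  unfolding chain_fun_def by (intro cInf_lower chain_costs_bdd_below) (auto simp: chain_costs_def)

lemma chain_fun_zero: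
  assumes "\<And>z. 0 \<le> g z" "y \<in> F" shows "chain_fun g d F y = 0"
proof -
  have "(0, \<lambda>_. y) \<in> chains_to d F y" using assms by (simp add: chains_to_def)
  from chain_fun_le_cost[of g, OF assms(1) this] show ?thesis
    using chain_fun_nonneg[of g d F y] assms(1) by (simp add: chain_cost_def)
qed

lemma chain_fun_less_obtains:
  assumes "\<And>z. 0 \<le> g z" "chain_fun g d F y < c" "c \<le> 1"
  obtains n p where "(n, p) \<in> chains_to d F y" "chain_cost g p n < c"
proof -
  obtain e where "e \<in> insert 1 (chain_costs g d F y)" "e < c"
    using assms(2) unfolding chain_fun_def
    by (subst (asm) cInf_less_iff[OF insert_not_empty chain_costs_bdd_below]) (auto intro: assms(1))
  then show ?thesis using that assms(3) by (auto simp: chain_costs_def)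
qed

text \<open>A chain from b is prolonged by a as its new first point. For a in F the result would not
  be an admissible chain, but then the left side is 0.\<close>

lemma chain_fun_step:
  assumes g: "\<And>z. 0 \<le> g z" and ab: "dist a b < d"
  shows "chain_fun g d F a \<le> min (g a) (g b) * dist a b + chain_fun g d F b"
proof (cases "a \<in> F")
  case True
  then show ?thesis using chain_fun_zero[of g a F d] chain_fun_nonneg[of g d F b] g by simp
next
  case False
  have "chain_fun g d F a - min (g a) (g b) * dist a b \<le> Inf (insert 1 (chain_costs g d F b))"
  proof (rule cInf_greatest)
    fix e assume "e \<in> insert 1 (chain_costs g d F b)"
    then consider "e = 1" | n p where "(n, p) \<in> chains_to d F b" "e = chain_cost g p n"
      by (auto simp: chain_costs_def)
    then show "chain_fun g d F a - min (g a) (g b) * dist a b \<le> e"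
    proof cases
      case 1
      have "0 \<le> min (g a) (g b) * dist a b" using g by simp
      then show ?thesis using 1 chain_fun_le_one[of g d F a, OF g] by linarith
    next
      case 2
      define p' where "p' = case_nat a p"
      have "(Suc n, p') \<in> chains_to d F a"
        using 2 False ab by (auto simp: chains_to_def p'_def less_Suc_eq_0_disj)
      moreover have "chain_cost g p' (Suc n) = min (g a) (g b) * dist a b + chain_cost g p n"
        using 2 unfolding chain_cost_def by (subst sum.lessThan_Suc_shift) (auto simp: p'_def chains_to_def)
      ultimately show ?thesis using chain_fun_le_cost[of g "Suc n" p' d F a] g 2 by simp
    qed
  qed simp
  then show ?thesis by (simp add: chain_fun_def)
qed

lemma lip_pair_chain_fun:
  assumes "\<And>z. 0 \<le> g z" "continuous_on UNIV g" "d > 0"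
  shows "lip_pair (chain_fun g d F) g"
proof (rule lip_pairI[OF assms(2,1,3)])
  fix a b :: 'a assume "dist a b < d"
  then have "chain_fun g d F a \<le> min (g a) (g b) * dist a b + chain_fun g d F b"
    "chain_fun g d F b \<le> min (g b) (g a) * dist b a + chain_fun g d F a"
    using chain_fun_step[of g a b d F] chain_fun_step[of g b a d F] assms(1) by (auto simp: dist_commute)
  moreover have "min (g a) (g b) * dist a b \<le> g a * dist a b" "min (g b) (g a) * dist b a \<le> g a * dist a b"
    by (auto simp: dist_commute intro!: mult_right_mono)
  ultimately show "\<bar>chain_fun g d F a - chain_fun g d F b\<bar> \<le> g a * dist a b" by linarith
qed

lemma chain_fun_mono:
  assumes "\<And>z. 0 \<le> g z" "\<And>z. g z \<le> g' z" "d' \<le> d"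
  shows "chain_fun g d F y \<le> chain_fun g' d' F y"
  unfolding chain_fun_def[of g']
proof (rule cInf_greatest)
  fix e assume "e \<in> insert 1 (chain_costs g' d' F y)"
  then consider "e = 1" | n p where "(n, p) \<in> chains_to d' F y" "e = chain_cost g' p n"
    by (auto simp: chain_costs_def)
  then show "chain_fun g d F y \<le> e"
  proof cases
    case 1 then show ?thesis using chain_fun_le_one[of g] assms by simp
  next
    case 2
    then have "(n, p) \<in> chains_to d F y" using assms(3) by (force simp: chains_to_def)
    then have "chain_fun g d F y \<le> chain_cost g p n" using assms(1) by (intro chain_fun_le_cost)
    also have "\<dots> \<le> e" unfolding 2 chain_cost_def
      using assms by (intro sum_mono mult_right_mono min.mono) auto
    finally show ?thesis .
  qed
qed simp

section \<open>Compactness for sequences of chains with vanishing step size\<close>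

lemma pointwise_convergent_subsequence:
  fixes f :: "nat \<Rightarrow> 'b \<Rightarrow> 'a::metric_space"
  assumes "countable S" "compact K" "\<And>k q. q \<in> S \<Longrightarrow> f k q \<in> K"
  obtains r where "strict_mono (r :: nat \<Rightarrow> nat)" "\<And>q. q \<in> S \<Longrightarrow> convergent (\<lambda>k. f (r k) q)"
proof (cases "S = {}")
  case True
  then show ?thesis using that[of id] by (simp add: strict_mono_def)
next
  case False
  define \<sigma> where "\<sigma> = from_nat_into S"
  have \<sigma>: "\<sigma> i \<in> S" for i by (simp add: \<sigma>_def False from_nat_into)
  interpret subseqs "\<lambda>i r. convergent (\<lambda>k. f (r k) (\<sigma> i))"
  proof
    fix i and s :: "nat \<Rightarrow> nat"
    obtain l r where "strict_mono (r :: nat \<Rightarrow> nat)" "((\<lambda>k. f (s k) (\<sigma> i)) \<circ> r) \<longlonglongrightarrow> l"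
      using assms(2,3) \<sigma> unfolding compact_def by (metis (no_types, lifting))
    then show "\<exists>r'. strict_mono r' \<and> convergent (\<lambda>k. f ((s \<circ> r') k) (\<sigma> i))"
      by (auto simp: o_def convergent_def)
  qed
  have "convergent (\<lambda>k. f (diagseq k) (\<sigma> i))" for i
  proof -
    \<comment> \<open>Only from index \<open>Suc i\<close> on is the diagonal a subsequence of the
      one chosen at stage i; the offset is removed below.\<close>
    have "convergent (\<lambda>k. f ((diagseq \<circ> (+) (Suc i)) k) (\<sigma> i))"
    proof (rule diagseq_holds)
      fix r s :: "nat \<Rightarrow> nat" and n assume "strict_mono r" "convergent (\<lambda>k. f (s k) (\<sigma> n))"
      then show "convergent (\<lambda>k. f ((s \<circ> r) k) (\<sigma> n))"
        using LIMSEQ_subseq_LIMSEQ unfolding convergent_def by (fastforce simp: o_def)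
    qed
    then obtain l where "(\<lambda>k. f (diagseq (k + Suc i)) (\<sigma> i)) \<longlonglongrightarrow> l"
      by (auto simp: o_def add.commute convergent_def)
    then have "(\<lambda>k. f (diagseq k) (\<sigma> i)) \<longlonglongrightarrow> l"
      by (rule LIMSEQ_offset)
    then show ?thesis by (rule convergentI)
  qed
  moreover have "\<exists>i. q = \<sigma> i" if "q \<in> S" for q
    using from_nat_into_surj[OF assms(1) that] by (auto simp: \<sigma>_def)
  ultimately show ?thesis using that[OF subseq_diagseq] by metis
qed

lemma lipschitz_rectifiable:
  assumes "\<And>s t. s \<in> {0..1} \<Longrightarrow> t \<in> {0..1} \<Longrightarrow> dist (\<gamma> s) (\<gamma> t) \<le> \<Lambda> * \<bar>s - t\<bar>"
  shows "rectifiable_curve \<gamma>"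
proof -
  have "continuous_on {0..1} \<gamma>"
    unfolding continuous_on_iff
  proof (intro ballI allI impI)
    fix s e :: real assume s: "s \<in> {0..1}" "0 < e"
    show "\<exists>d>0. \<forall>t\<in>{0..1}. dist t s < d \<longrightarrow> dist (\<gamma> t) (\<gamma> s) < e"
    proof (intro exI conjI ballI impI)
      show "0 < e / (\<bar>\<Lambda>\<bar> + 1)" using s by simp
      fix t assume t: "t \<in> {0..1}" "dist t s < e / (\<bar>\<Lambda>\<bar> + 1)"
      have "dist (\<gamma> t) (\<gamma> s) \<le> \<Lambda> * \<bar>t - s\<bar>" using assms s t by auto
      also have "\<dots> \<le> (\<bar>\<Lambda>\<bar> + 1) * \<bar>t - s\<bar>" by (intro mult_right_mono) auto
      also have "\<dots> < e" using t(2) by (simp add: dist_real_def field_simps)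
      finally show "dist (\<gamma> t) (\<gamma> s) < e" .
    qed
  qed
  moreover have "curve_length \<gamma> 0 1 \<le> ennreal \<Lambda>"
  proof (rule curve_length_leI)
    fix n and t :: "nat \<Rightarrow> real" assume t: "t 0 = 0" "t n = 1" "\<And>i. i < n \<Longrightarrow> t i \<le> t (Suc i)"
    have in01: "t i \<in> {0..1}" if "i \<le> n" for i using partition_bounds[of n t i] t that by auto
    have "partition_sum \<gamma> n t \<le> (\<Sum>i<n. \<Lambda> * (t (Suc i) - t i))"
      unfolding partition_sum_def
    proof (rule sum_mono)
      fix i assume "i \<in> {..<n}"
      then show "dist (\<gamma> (t (Suc i))) (\<gamma> (t i)) \<le> \<Lambda> * (t (Suc i) - t i)"
        using assms[of "t (Suc i)" "t i"] in01[of i] in01[of "Suc i"] t(3)[of i] by simp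
    qed
    also have "\<dots> = \<Lambda>" using sum_lessThan_telescope[of t n] t by (simp add: sum_distrib_left[symmetric])
    finally show "ennreal (partition_sum \<gamma> n t) \<le> ennreal \<Lambda>" by (rule ennreal_leI)
  qed
  ultimately show ?thesis by (auto simp: rectifiable_curve_def curve_def intro: le_less_trans)
qed

lemma partition_sum_near_arc_fun:
  assumes "rectifiable_curve \<gamma>" "0 \<le> s" "s \<le> t" "t \<le> 1" "e > 0"
  obtains n T where "T 0 = s" "T n = t" "\<And>i. i < n \<Longrightarrow> T i \<le> T (Suc i)"
    "arc_fun \<gamma> t - arc_fun \<gamma> s - e < partition_sum \<gamma> n T"
proof -
  define L where "L = arc_fun \<gamma> t - arc_fun \<gamma> s"
  have L: "ennreal L = curve_length \<gamma> s t" "0 \<le> L"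
    using arc_fun_diff[OF assms(1-4)] by (auto simp: L_def)
  have "ennreal (L - e) < curve_length \<gamma> s t \<or> L = 0"
    unfolding L(1)[symmetric] using L(2) assms(5) by (cases "L = 0") (auto intro!: ennreal_lessI)
  then show ?thesis
  proof
    assume "ennreal (L - e) < curve_length \<gamma> s t"
    then show ?thesis
      unfolding curve_length_def less_SUP_iff
      by (clarsimp simp: partition_sum_def[symmetric] split: prod.splits)
         (metis that ennreal_leI linorder_not_le L_def)
  next
    assume "L = 0"
    then have "arc_fun \<gamma> t - arc_fun \<gamma> s - e < partition_sum \<gamma> 1 (\<lambda>i. if i = 0 then s else t)"
      using assms(5) partition_sum_nonneg[of \<gamma> 1 "\<lambda>i. if i = 0 then s else t"] unfolding L_def by linarith
    then show ?thesis using that[of "\<lambda>i. if i = 0 then s else t" 1] assms by simp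
  qed
qed

lemma sum_consecutive_blocks:
  fixes a :: "nat \<Rightarrow> real"
  assumes "\<And>j. j < N \<Longrightarrow> J j \<le> J (Suc j)"
  shows "(\<Sum>j<N. \<Sum>i=J j..<J (Suc j). a i) = (\<Sum>i=J 0..<J N. a i)"
  using assms
proof (induction N)
  case (Suc N)
  have "J 0 \<le> J N" using Suc.prems by (induction N) (auto intro: order_trans)
  then have "(\<Sum>i=J 0..<J N. a i) + (\<Sum>i=J N..<J (Suc N). a i) = (\<Sum>i=J 0..<J (Suc N). a i)"
    using Suc.prems by (intro sum.atLeastLessThan_concat) auto
  then show ?case using Suc by simp
qed simp

text \<open>A curve is arbitrary outside [0, 1]. Clamping the parameter gives a function that is
  continuous on the line and agrees with the curve on [0, 1], to which the indicator
  restricts.\<close>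

lemma borel_measurable_along_curve:
  assumes "curve \<gamma>" "f \<in> borel_measurable borel"
  shows "(\<lambda>t. f (\<gamma> t) * indicator {0..1} t :: ennreal) \<in> borel_measurable (interval_measure F)"
proof -
  have "continuous_on UNIV (\<lambda>t. \<gamma> (max 0 (min 1 t)))"
    using assms(1) unfolding curve_def by (rule continuous_on_compose2) (auto intro!: continuous_intros)
  then have [measurable]: "(\<lambda>t. \<gamma> (max 0 (min 1 t))) \<in> borel_measurable borel"
    by (rule borel_measurable_continuous_onI)
  note assms(2)[measurable]
  have "(\<lambda>t. f (\<gamma> (max 0 (min 1 t))) * indicator {0..1} t) \<in> borel_measurable borel" by measurable
  also have "(\<lambda>t. f (\<gamma> (max 0 (min 1 t))) * indicator {0..1} t) = (\<lambda>t. f (\<gamma> t) * indicator {0..1} t)"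
    by (auto simp: indicator_def)
  finally show ?thesis by simp
qed

text \<open>Chains of bounded cost and vanishing step size. Since \<open>g k\<close> is bounded below by \<open>\<delta>\<close>, their lengths
  are bounded by \<open>1 / \<delta>\<close>; parametrised proportionally to arc length they are almost Lipschitz step
  functions, and a diagonal argument on the rational parameters yields a limit curve.\<close>

locale chain_sequence =
  fixes g :: "nat \<Rightarrow> 'a::complete_space \<Rightarrow> real" and p :: "nat \<Rightarrow> nat \<Rightarrow> 'a" and n :: "nat \<Rightarrow> nat"
    and d :: "nat \<Rightarrow> real" and K F :: "'a set" and \<theta> \<delta> :: real and y :: 'a
  assumes compact_K: "compact K" and closed_F: "closed F"
    and g_cont: "\<And>k. continuous_on UNIV (g k)" and g_nonneg: "\<And>k z. 0 \<le> g k z"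
    and g_inc: "\<And>k z. g k z \<le> g (Suc k) z" and g_bdd: "\<And>k. \<exists>C. \<forall>z. g k z \<le> C"
    and g_lower: "\<And>k z. z \<in> K \<Longrightarrow> \<delta> \<le> g k z" and \<delta>: "0 < \<delta>"
    and p_0: "\<And>k. p k 0 = y" and p_n: "\<And>k. p k (n k) \<in> F"
    and p_K: "\<And>k i. i \<le> n k \<Longrightarrow> p k i \<in> K"
    and p_step: "\<And>k i. i < n k \<Longrightarrow> dist (p k i) (p k (Suc i)) < d k"
    and cost: "\<And>k. chain_cost (g k) (p k) (n k) \<le> \<theta>" and \<theta>: "\<theta> \<le> 1"
    and d_pos: "\<And>k. d k > 0" and d_lim: "d \<longlonglongrightarrow> 0"
begin

text \<open>A common bound for the lengths of the chains. All of them are run at speed \<Lambda> on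
  [0, 1], a shorter one resting at its last point.\<close>

definition \<Lambda> where "\<Lambda> = 1 / \<delta>"

definition len :: "nat \<Rightarrow> nat \<Rightarrow> real" where "len k i = (\<Sum>j<i. dist (p k j) (p k (Suc j)))"

definition idx :: "nat \<Rightarrow> real \<Rightarrow> nat" where "idx k t = Max {i. i \<le> n k \<and> len k i \<le> \<Lambda> * t}"

definition step_curve :: "nat \<Rightarrow> real \<Rightarrow> 'a" where "step_curve k t = p k (idx k t)"

lemma \<Lambda>_pos: "\<Lambda> > 0"
  using \<delta> by (simp add: \<Lambda>_def)

lemma len_mono: "i \<le> j \<Longrightarrow> len k i \<le> len k j"
  unfolding len_def by (intro sum_mono2) auto

lemma dist_le_len: "i \<le> j \<Longrightarrow> dist (p k i) (p k j) \<le> len k j - len k i"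
proof (induction j)
  case (Suc j)
  show ?case
  proof (cases "i = Suc j")
    case False
    then have "dist (p k i) (p k j) \<le> len k j - len k i" using Suc by simp
    then show ?thesis using dist_triangle[of "p k i" "p k (Suc j)" "p k j"] by (simp add: len_def)
  qed simp
qed simp

lemma len_le: "len k (n k) \<le> \<Lambda>"
proof -
  have "\<delta> * len k (n k) = (\<Sum>i<n k. \<delta> * dist (p k i) (p k (Suc i)))" by (simp add: len_def sum_distrib_left)
  also have "\<dots> \<le> chain_cost (g k) (p k) (n k)"
    unfolding chain_cost_def
  proof (rule sum_mono)
    fix i assume "i \<in> {..<n k}"
    then show "\<delta> * dist (p k i) (p k (Suc i)) \<le> min (g k (p k i)) (g k (p k (Suc i))) * dist (p k i) (p k (Suc i))"
      using p_K[of i k] p_K[of "Suc i" k] g_lower by (intro mult_right_mono) auto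
  qed
  also have "\<dots> \<le> 1" using cost[of k] \<theta> by linarith
  finally show ?thesis using \<delta> by (simp add: \<Lambda>_def field_simps)
qed

lemma idx_props:
  assumes "0 \<le> t"
  shows "idx k t \<le> n k" "len k (idx k t) \<le> \<Lambda> * t" "i \<le> n k \<Longrightarrow> len k i \<le> \<Lambda> * t \<Longrightarrow> i \<le> idx k t"
proof -
  let ?S = "{i. i \<le> n k \<and> len k i \<le> \<Lambda> * t}"
  have fin: "finite ?S" by (rule finite_subset[of _ "{..n k}"]) auto
  have "0 \<in> ?S" using assms \<Lambda>_pos by (simp add: len_def)
  then have "idx k t \<in> ?S" unfolding idx_def using fin Max_in by blast
  then show "idx k t \<le> n k" "len k (idx k t) \<le> \<Lambda> * t" by auto
  show "i \<le> idx k t" if "i \<le> n k" "len k i \<le> \<Lambda> * t" using that fin unfolding idx_def by (intro Max_ge) auto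
qed

lemma idx_mono: "0 \<le> s \<Longrightarrow> s \<le> t \<Longrightarrow> idx k s \<le> idx k t"
proof -
  assume a: "0 \<le> s" "s \<le> t"
  have "\<Lambda> * s \<le> \<Lambda> * t" using a \<Lambda>_pos by simp
  then show ?thesis using idx_props(1,2)[OF a(1), of k] a by (intro idx_props(3)) auto
qed

lemma idx_1: "idx k 1 = n k"
  using idx_props(1)[of 1 k] idx_props(3)[of 1 "n k" k] len_le[of k] by simp

lemma len_idx_lower:
  assumes "0 \<le> t" "idx k t < n k" shows "\<Lambda> * t - d k < len k (idx k t)"
proof -
  have "\<not> len k (Suc (idx k t)) \<le> \<Lambda> * t"
    using idx_props(3)[OF assms(1), of "Suc (idx k t)" k] assms(2) by auto
  then show ?thesis using p_step[OF assms(2)] by (simp add: len_def)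
qed

text \<open>The term \<open>d k\<close> accounts for the step of the chain that is still incomplete
  at the parameter s.\<close>

lemma len_idx_diff:
  assumes "0 \<le> s" "s \<le> t" shows "len k (idx k t) - len k (idx k s) \<le> \<Lambda> * (t - s) + d k"
proof (cases "idx k s < n k")
  case True
  then show ?thesis using len_idx_lower[OF assms(1) True] idx_props(2)[of t k] assms by (simp add: algebra_simps)
next
  case False
  then have "idx k s = n k" using idx_props(1)[OF assms(1), of k] by simp
  then have "idx k t = idx k s" using idx_mono[OF assms, of k] idx_props(1)[of t k] assms by simp
  then show ?thesis using assms \<Lambda>_pos d_pos[of k] by simp
qed

lemma step_curve_dist:
  assumes "0 \<le> s" "s \<le> t"
  shows "dist (step_curve k s) (step_curve k t) \<le> len k (idx k t) - len k (idx k s)"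
  unfolding step_curve_def by (intro dist_le_len idx_mono assms)

lemma step_curve_almost_lipschitz:
  assumes "0 \<le> s" "0 \<le> t"
  shows "dist (step_curve k s) (step_curve k t) \<le> \<Lambda> * \<bar>s - t\<bar> + d k"
  using step_curve_dist[of s t k] step_curve_dist[of t s k] len_idx_diff[of s t k] len_idx_diff[of t s k] assms
  by (cases "s \<le> t") (auto simp: dist_commute)

lemma step_curve_0: "step_curve k 0 = y"
proof -
  have "dist y (step_curve k 0) \<le> 0"
    using dist_le_len[of 0 "idx k 0" k] idx_props(2)[of 0 k] unfolding step_curve_def len_def p_0 by (simp del: dist_le_zero_iff)
  then show ?thesis by simp
qed

lemma step_curve_1: "step_curve k 1 \<in> F"
  by (simp add: step_curve_def idx_1 p_n)

lemma step_curve_K: "0 \<le> t \<Longrightarrow> step_curve k t \<in> K"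
  unfolding step_curve_def by (intro p_K idx_props)

text \<open>The almost-Lipschitz estimate carries convergence from rational to all parameters,
  because its error \<open>d k\<close> tends to 0.\<close>

lemma limit_curve:
  obtains r \<gamma> where "strict_mono (r::nat \<Rightarrow> nat)" "\<And>t. t \<in> {0..1} \<Longrightarrow> (\<lambda>k. step_curve (r k) t) \<longlonglongrightarrow> \<gamma> t"
proof -
  have "countable (\<rat> \<inter> {0..1::real})" by (simp add: countable_rat)
  then obtain r where r: "strict_mono (r::nat \<Rightarrow> nat)"
    "\<And>q. q \<in> \<rat> \<inter> {0..1} \<Longrightarrow> convergent (\<lambda>k. step_curve (r k) q)"
    using pointwise_convergent_subsequence[of "\<rat> \<inter> {0..1::real}" K step_curve] compact_K step_curve_K by auto
  have dr: "(\<lambda>k. d (r k)) \<longlonglongrightarrow> 0" using LIMSEQ_subseq_LIMSEQ[OF d_lim r(1)] by (simp add: o_def)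
  have "convergent (\<lambda>k. step_curve (r k) t)" if t: "t \<in> {0..1}" for t
  proof (rule Cauchy_convergent, rule metric_CauchyI)
    fix e :: real assume "e > 0"
    \<comment> \<open>Two comparisons of t with a rational q cost 2 * \<epsilon> each, and
      convergence at q costs one more.\<close>
    define \<epsilon> where "\<epsilon> = e / 5"
    have "\<epsilon> > 0" using \<open>e > 0\<close> by (simp add: \<epsilon>_def)
    have "\<exists>q\<in>\<rat> \<inter> {0..1}. \<Lambda> * \<bar>t - q\<bar> \<le> \<epsilon>"
    proof (cases "t = 1")
      case True then show ?thesis using \<open>\<epsilon> > 0\<close> by (intro bexI[of _ 1]) auto
    next
      case False
      then have "t < min 1 (t + \<epsilon> / \<Lambda>)" using t \<open>\<epsilon> > 0\<close> \<Lambda>_pos by auto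
      then obtain q where "q \<in> \<rat>" "t < q" "q < min 1 (t + \<epsilon> / \<Lambda>)" using Rats_dense_in_real by blast
      then show ?thesis using t \<Lambda>_pos by (intro bexI[of _ q]) (auto simp: field_simps)
    qed
    then obtain q where q: "q \<in> \<rat> \<inter> {0..1}" "\<Lambda> * \<bar>t - q\<bar> \<le> \<epsilon>" by blast
    have "Cauchy (\<lambda>k. step_curve (r k) q)" using r(2)[OF q(1)] by (rule convergent_Cauchy)
    then obtain N1 where N1: "\<And>k m. k \<ge> N1 \<Longrightarrow> m \<ge> N1 \<Longrightarrow> dist (step_curve (r k) q) (step_curve (r m) q) < \<epsilon>"
      using \<open>\<epsilon> > 0\<close> unfolding Cauchy_def by meson
    obtain N2 where N2: "\<And>k. k \<ge> N2 \<Longrightarrow> d (r k) < \<epsilon>"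
      using order_tendstoD(2)[OF dr \<open>\<epsilon> > 0\<close>] by (auto simp: eventually_sequentially)
    show "\<exists>N. \<forall>k\<ge>N. \<forall>m\<ge>N. dist (step_curve (r k) t) (step_curve (r m) t) < e"
    proof (intro exI[of _ "max N1 N2"] allI impI)
      fix k m assume km: "k \<ge> max N1 N2" "m \<ge> max N1 N2"
      have "dist (step_curve (r j) t) (step_curve (r j) q) < 2 * \<epsilon>" if "j \<ge> max N1 N2" for j
        using step_curve_almost_lipschitz[of t q "r j"] t q N2[of j] that by auto
      from this[OF km(1)] this[OF km(2)] N1[of k m] km
        dist_triangle[of "step_curve (r k) t" "step_curve (r m) t" "step_curve (r k) q"]
        dist_triangle[of "step_curve (r k) q" "step_curve (r m) t" "step_curve (r m) q"]
      show "dist (step_curve (r k) t) (step_curve (r m) t) < e" by (simp add: dist_commute \<epsilon>_def)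
    qed
  qed
  then show ?thesis using that[OF r(1), of "\<lambda>t. lim (\<lambda>k. step_curve (r k) t)"]
    by (simp add: convergent_LIMSEQ_iff)
qed

text \<open>For fixed m, three facts bound the line integral of \<open>g m\<close> by the chain
  costs: arc length is lower semicontinuous, so the limit curve over a cell is asymptotically no
  longer than the chains over that cell; \<open>g m\<close> is nearly constant over a short cell,
  along curve and chain alike; and \<open>g m\<close> \<le> \<open>g (r k)\<close> once m \<le> r k.
  Monotone convergence in m then gives the supremum.\<close>

lemma limit_curve_line_integral:
  obtains \<gamma> where "rectifiable_curve \<gamma>" "\<gamma> 0 = y" "\<gamma> 1 \<in> F" "\<gamma> ` {0..1} \<subseteq> K"
    "line_integral (\<lambda>z. SUP k. ennreal (g k z)) \<gamma> \<le> ennreal \<theta>"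
proof -
  obtain r \<gamma> where r: "strict_mono (r::nat \<Rightarrow> nat)"
    and \<gamma>: "\<And>t. t \<in> {0..1} \<Longrightarrow> (\<lambda>k. step_curve (r k) t) \<longlonglongrightarrow> \<gamma> t" using limit_curve by blast
  have dr: "(\<lambda>k. d (r k)) \<longlonglongrightarrow> 0" using LIMSEQ_subseq_LIMSEQ[OF d_lim r] by (simp add: o_def)
  have \<gamma>_lip: "dist (\<gamma> s) (\<gamma> t) \<le> \<Lambda> * \<bar>s - t\<bar>" if "s \<in> {0..1}" "t \<in> {0..1}" for s t
  proof (rule LIMSEQ_le)
    show "(\<lambda>k. dist (step_curve (r k) s) (step_curve (r k) t)) \<longlonglongrightarrow> dist (\<gamma> s) (\<gamma> t)"
      using that by (intro tendsto_intros \<gamma>)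
    show "(\<lambda>k. \<Lambda> * \<bar>s - t\<bar> + d (r k)) \<longlonglongrightarrow> \<Lambda> * \<bar>s - t\<bar>"
      using tendsto_add[OF tendsto_const dr, of "\<Lambda> * \<bar>s - t\<bar>"] by simp
  qed (use that step_curve_almost_lipschitz in auto)
  have rect: "rectifiable_curve \<gamma>" by (rule lipschitz_rectifiable[OF \<gamma>_lip])
  have \<gamma>_K: "\<gamma> t \<in> K" if "t \<in> {0..1}" for t
    using closed_sequentially[OF compact_imp_closed[OF compact_K] _ \<gamma>[OF that]] step_curve_K that by auto
  have \<gamma>0: "\<gamma> 0 = y" using \<gamma>[of 0] by (simp add: step_curve_0 LIMSEQ_const_iff)
  have \<gamma>1: "\<gamma> 1 \<in> F" using closed_sequentially[OF closed_F _ \<gamma>[of 1]] step_curve_1 by auto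
  define A where "A = arc_fun \<gamma>"
  define lk where "lk = (\<lambda>k t. len (r k) (idx (r k) t))"
  \<comment> \<open>Lower semicontinuity of length: a partition sum of the limit curve is the limit
    of those of the step curves, which do not exceed the chain length traversed.\<close>
  have arc_le: "\<forall>\<^sub>F k in sequentially. A t - A s \<le> lk k t - lk k s + e" if st: "0 \<le> s" "s \<le> t" "t \<le> 1" "e > 0" for s t e
  proof -
    have "e / 2 > 0" using st by simp
    then obtain m T where T: "T 0 = s" "T m = t" "\<And>i. i < m \<Longrightarrow> T i \<le> T (Suc i)"
      "A t - A s - e/2 < partition_sum \<gamma> m T"
      unfolding A_def using partition_sum_near_arc_fun[OF rect st(1-3)] by metis
    have bd: "T i \<in> {0..1}" if "i \<le> m" for i using partition_bounds[of m T i] T st that by auto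
    have "(\<lambda>k. partition_sum (step_curve (r k)) m T) \<longlonglongrightarrow> partition_sum \<gamma> m T"
      unfolding partition_sum_def using bd by (intro tendsto_intros \<gamma>) auto
    then have "\<forall>\<^sub>F k in sequentially. partition_sum \<gamma> m T - e/2 < partition_sum (step_curve (r k)) m T"
      using st by (intro order_tendstoD) auto
    then show ?thesis
    proof eventually_elim
      case (elim k)
      have "partition_sum (step_curve (r k)) m T \<le> (\<Sum>i<m. lk k (T (Suc i)) - lk k (T i))"
        unfolding partition_sum_def
      proof (rule sum_mono)
        fix i assume "i \<in> {..<m}"
        then show "dist (step_curve (r k) (T (Suc i))) (step_curve (r k) (T i)) \<le> lk k (T (Suc i)) - lk k (T i)"
          using step_curve_dist[of "T i" "T (Suc i)" "r k"] bd[of i] T(3)[of i] by (simp add: dist_commute lk_def)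
      qed
      also have "\<dots> = lk k t - lk k s" using sum_lessThan_telescope[of "\<lambda>i. lk k (T i)" m] T by simp
      finally show ?case using elim T(4) by simp
    qed
  qed
  have main: "line_integral (\<lambda>z. ennreal (g m z)) \<gamma> \<le> ennreal \<theta>" for m
  proof (rule ennreal_le_epsilon)
    fix e :: real assume "e > 0"
    obtain C where C: "\<And>z. g m z \<le> C" using g_bdd by blast
    have C0: "0 \<le> C" using C g_nonneg order_trans by blast
    \<comment> \<open>Error budget: 2 * \<epsilon> * \<Lambda> from comparing weights along the
      chain and (C + 1) * \<epsilon> from comparing lengths; \<epsilon> \<le> 1 gives c j \<le> C +
      1.\<close>
    define \<epsilon> where "\<epsilon> = min 1 (e / (2 * \<Lambda> + C + 1))"
    have S: "0 < 2 * \<Lambda> + C + 1" using C0 \<Lambda>_pos by simp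
    have "\<epsilon> \<le> e / (2 * \<Lambda> + C + 1)" by (simp add: \<epsilon>_def)
    then have "\<epsilon> * (2 * \<Lambda> + C + 1) \<le> e" using S by (simp add: pos_le_divide_eq)
    moreover have "\<epsilon> > 0" "\<epsilon> \<le> 1" using \<open>e > 0\<close> S by (simp_all add: \<epsilon>_def)
    ultimately have \<epsilon>: "\<epsilon> > 0" "\<epsilon> \<le> 1" "\<epsilon> * (2 * \<Lambda> + C + 1) \<le> e" by auto
    have "uniformly_continuous_on K (g m)"
      by (intro compact_uniformly_continuous compact_K continuous_on_subset[OF g_cont]) simp
    then obtain \<eta> where \<eta>: "\<eta> > 0" "\<And>a b. a \<in> K \<Longrightarrow> b \<in> K \<Longrightarrow> dist a b < \<eta> \<Longrightarrow> dist (g m a) (g m b) < \<epsilon>"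
      using \<epsilon>(1) unfolding uniformly_continuous_on_def by meson
    \<comment> \<open>Within a cell the chain moves at most \<Lambda> / N + d < \<eta> / 2, and it
      starts within \<eta> / 4 of the curve.\<close>
    obtain N' where "inverse (real (Suc N')) < \<eta> / (4 * \<Lambda>)"
      using reals_Archimedean[of "\<eta> / (4 * \<Lambda>)"] \<eta>(1) \<Lambda>_pos by auto
    then obtain N where N: "N > 0" "\<Lambda> / real N < \<eta> / 4"
      using that[of "Suc N'"] \<Lambda>_pos by (simp add: inverse_eq_divide field_simps)
    define T where "T = (\<lambda>j. real j / real N)"
    have T: "T j \<in> {0..1}" if "j \<le> N" for j using that N by (auto simp: T_def field_simps)
    have T01: "T 0 = 0" "T N = 1" using N by (auto simp: T_def)
    have TS: "T (Suc j) - T j = 1 / real N" for j by (simp add: T_def field_simps add_divide_distrib)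
    have Tle: "T j \<le> T (Suc j)" for j using N by (simp add: T_def field_simps)
    define c where "c = (\<lambda>j. g m (\<gamma> (T j)) + \<epsilon>)"
    have c: "0 \<le> c j" "c j \<le> C + 1" for j
      using g_nonneg[of m "\<gamma> (T j)"] C[of "\<gamma> (T j)"] \<epsilon> by (auto simp: c_def)
    have "line_integral (\<lambda>z. ennreal (g m z)) \<gamma> \<le> (\<Sum>j<N. ennreal (c j) * ennreal (A (T (Suc j)) - A (T j)))"
      unfolding T_def A_def
    proof (rule line_integral_le_step_sum[OF rect N(1)])
      fix j t assume j: "j < N" "t \<in> {real j / real N<..real (Suc j) / real N}"
      then have "T j < t" "t \<le> T (Suc j)" by (auto simp: T_def)
      then have t: "t \<in> {0..1}" "\<bar>T j - t\<bar> \<le> 1 / real N"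
        using T[of j] T[of "Suc j"] TS[of j] j(1) by auto
      have "dist (\<gamma> (T j)) (\<gamma> t) \<le> \<Lambda> * \<bar>T j - t\<bar>" using \<gamma>_lip t T[of j] j by auto
      also have "\<dots> \<le> \<Lambda> * (1 / real N)" using t \<Lambda>_pos by (intro mult_left_mono) auto
      also have "\<Lambda> * (1 / real N) = \<Lambda> / real N" by simp
      also have "\<dots> < \<eta>" using N(2) \<eta>(1) by linarith
      finally have "dist (g m (\<gamma> (T j))) (g m (\<gamma> t)) < \<epsilon>" using t T[of j] j by (intro \<eta> \<gamma>_K) auto
      then show "ennreal (g m (\<gamma> t)) \<le> ennreal (c j)" by (intro ennreal_leI) (auto simp: c_def dist_real_def)
    qed
    also have "\<dots> = ennreal (\<Sum>j<N. c j * (A (T (Suc j)) - A (T j)))"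
    proof -
      have "ennreal (c j) * ennreal (A (T (Suc j)) - A (T j)) = ennreal (c j * (A (T (Suc j)) - A (T j)))" for j
        using arc_fun_mono[OF rect Tle[of j]] c by (simp add: ennreal_mult A_def)
      moreover have "0 \<le> c j * (A (T (Suc j)) - A (T j))" for j
        using arc_fun_mono[OF rect Tle[of j]] c by (simp add: A_def)
      ultimately show ?thesis by simp
    qed
    finally have LI: "line_integral (\<lambda>z. ennreal (g m z)) \<gamma> \<le> ennreal (\<Sum>j<N. c j * (A (T (Suc j)) - A (T j)))" .
    have "\<forall>\<^sub>F k in sequentially. \<forall>j\<in>{..<N}. A (T (Suc j)) - A (T j) \<le> lk k (T (Suc j)) - lk k (T j) + \<epsilon> / real N"
      using T Tle N \<epsilon> by (intro eventually_ball_finite ballI arc_le) auto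
    moreover have "\<forall>\<^sub>F k in sequentially. \<forall>j\<in>{..<N}. dist (step_curve (r k) (T j)) (\<gamma> (T j)) < \<eta> / 4"
      using T \<eta>(1) by (intro eventually_ball_finite ballI tendstoD[OF \<gamma>]) auto
    moreover have "\<forall>\<^sub>F k in sequentially. d (r k) < \<eta> / 4"
      using dr \<eta>(1) by (intro order_tendstoD) auto
    moreover have "\<forall>\<^sub>F k in sequentially. m \<le> r k"
      using filterlim_subseq[OF r] by (simp add: filterlim_at_top)
    ultimately have "\<forall>\<^sub>F k in sequentially. (\<Sum>j<N. c j * (A (T (Suc j)) - A (T j))) \<le> \<theta> + e"
    proof eventually_elim
      case (elim k)
      define J where "J = (\<lambda>j. idx (r k) (T j))"
      have J: "J j \<le> J (Suc j)" if "j < N" for j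
        using idx_mono[OF _ Tle[of j]] T[of j] that by (simp add: J_def)
      have JN: "J N = n (r k)" by (simp add: J_def T01 idx_1)
      define D where "D = (\<lambda>i. dist (p (r k) i) (p (r k) (Suc i)))"
      define G where "G = (\<lambda>i. min (g (r k) (p (r k) i)) (g (r k) (p (r k) (Suc i))))"
      have lenJ: "len (r k) b - len (r k) a = (\<Sum>i=a..<b. D i)" if "a \<le> b" for a b
        using sum.atLeastLessThan_concat[of 0 a b D] that by (simp add: len_def D_def atLeast0LessThan)
      have near: "c j \<le> G i + 2 * \<epsilon>" if j: "j < N" and i: "J j \<le> i" "i < J (Suc j)" for i j
      proof -
        have *: "g m (\<gamma> (T j)) \<le> g (r k) (p (r k) i') + \<epsilon>" if i': "J j \<le> i'" "i' \<le> J (Suc j)" for i'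
        proof -
          have Sj: "J (Suc j) \<le> n (r k)" using idx_props(1)[of "T (Suc j)" "r k"] T[of "Suc j"] j by (simp add: J_def)
          have "dist (p (r k) (J j)) (p (r k) i') \<le> len (r k) i' - len (r k) (J j)" by (rule dist_le_len) fact
          also have "\<dots> \<le> len (r k) (J (Suc j)) - len (r k) (J j)" using len_mono[OF i'(2)] by simp
          also have "\<dots> \<le> \<Lambda> * (T (Suc j) - T j) + d (r k)"
            unfolding J_def using T[of j] j Tle by (intro len_idx_diff) auto
          also have "\<dots> < \<eta> / 2" using elim N(2) unfolding TS unfolding times_divide_eq_right mult_1_right by linarith
          finally have "dist (p (r k) (J j)) (p (r k) i') < \<eta> / 2" .
          moreover have "dist (p (r k) (J j)) (\<gamma> (T j)) < \<eta> / 4" using elim j by (simp add: step_curve_def J_def)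
          ultimately have "dist (\<gamma> (T j)) (p (r k) i') < \<eta>"
            using dist_triangle[of "\<gamma> (T j)" "p (r k) i'" "p (r k) (J j)"] \<eta>(1) by (simp add: dist_commute)
          then have "dist (g m (\<gamma> (T j))) (g m (p (r k) i')) < \<epsilon>"
            using T[of j] j i' Sj by (intro \<eta> \<gamma>_K p_K) auto
          moreover have "g m (p (r k) i') \<le> g (r k) (p (r k) i')"
            using lift_Suc_mono_le[of "\<lambda>l. g l (p (r k) i')", OF g_inc] elim by blast
          ultimately show ?thesis by (auto simp: dist_real_def)
        qed
        show ?thesis using *[of i] *[of "Suc i"] i by (auto simp: c_def G_def min_def)
      qed
      have "(\<Sum>j<N. c j * (A (T (Suc j)) - A (T j))) \<le> (\<Sum>j<N. c j * (lk k (T (Suc j)) - lk k (T j) + \<epsilon> / real N))"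
        using elim c by (intro sum_mono mult_left_mono) auto
      also have "\<dots> = (\<Sum>j<N. c j * (lk k (T (Suc j)) - lk k (T j))) + (\<Sum>j<N. c j * (\<epsilon> / real N))"
        by (simp add: distrib_left sum.distrib)
      also have "(\<Sum>j<N. c j * (\<epsilon> / real N)) \<le> (\<Sum>j<N. (C + 1) * (\<epsilon> / real N))"
        using c \<epsilon> by (intro sum_mono mult_right_mono) auto
      also have "\<dots> = (C + 1) * \<epsilon>" using N by simp
      also have "(\<Sum>j<N. c j * (lk k (T (Suc j)) - lk k (T j))) \<le> (\<Sum>j<N. \<Sum>i=J j..<J (Suc j). (G i + 2 * \<epsilon>) * D i)"
      proof (rule sum_mono)
        fix j assume "j \<in> {..<N}"
        then have j: "j < N" by simp
        have "c j * (lk k (T (Suc j)) - lk k (T j)) = (\<Sum>i=J j..<J (Suc j). c j * D i)"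
          using lenJ[OF J[OF j]] by (simp add: lk_def J_def sum_distrib_left)
        also have "\<dots> \<le> (\<Sum>i=J j..<J (Suc j). (G i + 2 * \<epsilon>) * D i)"
          using near[OF j] by (intro sum_mono mult_right_mono) (auto simp: D_def)
        finally show "c j * (lk k (T (Suc j)) - lk k (T j)) \<le> (\<Sum>i=J j..<J (Suc j). (G i + 2 * \<epsilon>) * D i)" .
      qed
      also have "\<dots> = (\<Sum>i=J 0..<J N. (G i + 2 * \<epsilon>) * D i)"
        by (rule sum_consecutive_blocks) (rule J)
      \<comment> \<open>Only an inequality, since J 0 is positive when the chain begins with
        repeated points.\<close>
      also have "\<dots> \<le> (\<Sum>i=0..<n (r k). (G i + 2 * \<epsilon>) * D i)"
        using \<epsilon> g_nonneg by (intro sum_mono2) (auto simp: JN G_def D_def)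
      also have "\<dots> = chain_cost (g (r k)) (p (r k)) (n (r k)) + 2 * \<epsilon> * len (r k) (n (r k))"
        by (simp add: chain_cost_def G_def D_def len_def distrib_right sum.distrib sum_distrib_left atLeast0LessThan)
      also have "\<dots> \<le> \<theta> + 2 * \<epsilon> * \<Lambda>"
        using cost len_le \<epsilon> by (intro add_mono mult_left_mono) auto
      finally have "(\<Sum>j<N. c j * (A (T (Suc j)) - A (T j))) \<le> \<theta> + 2 * \<epsilon> * \<Lambda> + (C + 1) * \<epsilon>" by simp
      also have "\<dots> \<le> \<theta> + e" using \<epsilon>(3) by (simp add: algebra_simps)
      finally show ?case .
    qed
    then obtain k where "(\<Sum>j<N. c j * (A (T (Suc j)) - A (T j))) \<le> \<theta> + e"
      by (auto simp: eventually_sequentially)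
    moreover have "0 \<le> \<theta>" using cost[of 0] chain_cost_nonneg[of "g 0" "p 0" "n 0", OF g_nonneg] by linarith
    ultimately show "line_integral (\<lambda>z. ennreal (g m z)) \<gamma> \<le> ennreal \<theta> + ennreal e"
      using LI \<open>e > 0\<close> by (auto simp: ennreal_plus[symmetric] simp del: ennreal_plus intro: order_trans ennreal_leI)
  qed
  have meas: "(\<lambda>t. ennreal (g m (\<gamma> t)) * indicator {0..1} t) \<in> borel_measurable (interval_measure (arc_fun \<gamma>))" for m
    using rect by (intro borel_measurable_along_curve measurable_compose[OF _ measurable_ennreal]
      borel_measurable_continuous_onI g_cont) (auto simp: rectifiable_curve_def)
  have "line_integral (\<lambda>z. SUP k. ennreal (g k z)) \<gamma> = (SUP k. line_integral (\<lambda>z. ennreal (g k z)) \<gamma>)"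
    unfolding line_integral_def SUP_mult_right_ennreal
    by (intro nn_integral_monotone_convergence_SUP meas)
       (auto simp: incseq_Suc_iff le_fun_def intro!: mult_right_mono ennreal_leI g_inc)
  also have "\<dots> \<le> ennreal \<theta>" by (intro SUP_least main)
  finally show ?thesis using that[of \<gamma>] rect \<gamma>0 \<gamma>1 \<gamma>_K by blast
qed

end

section \<open>Continuous approximation of capacity test functions\<close>

context pi_space
begin

lemma continuous_measurable_M: "continuous_on UNIV f \<Longrightarrow> f \<in> borel_measurable M"
  by (intro measurable_M borel_measurable_continuous_onI)

text \<open>A form of the Vitali--Caratheodory theorem: the lower semicontinuous majorant is given by an
  increasing sequence of continuous functions.\<close>

lemma continuous_upper_approx:
  fixes x :: 'a and f :: "'a \<Rightarrow> ennreal"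
  assumes f: "f \<in> borel_measurable borel" and "\<epsilon> > 0"
  obtains g :: "nat \<Rightarrow> 'a \<Rightarrow> real" where "\<And>k. continuous_on UNIV (g k)" "\<And>k y. 0 \<le> g k y"
    "\<And>k y. g k y \<le> g (Suc k) y" "\<And>k. \<exists>C. \<forall>y. g k y \<le> C"
    "\<And>y. y \<in> ball x \<rho> \<Longrightarrow> f y \<le> (SUP k. ennreal (g k y))"
    "(\<integral>\<^sup>+y. (SUP k. ennreal (g k y)) \<partial>M) \<le> (\<integral>\<^sup>+y\<in>ball x \<rho>. f y \<partial>M) + ennreal \<epsilon>"
proof -
  let ?B = "ball x \<rho>"
  \<comment> \<open>Two errors have to fit into \<epsilon>: c * \<open>measure M ?B\<close> from
    rounding f up to multiples of c, and c from enlarging the superlevel sets to open sets, with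
    excess (1/2) ^ Suc n at level n.\<close>
  define c where "c = \<epsilon> / (measure M ?B + 1)"
  have m1: "measure M ?B + 1 > 0" by (simp add: add_nonneg_pos)
  have "c * (measure M ?B + 1) = \<epsilon>" using m1 by (simp add: c_def)
  then have c: "c > 0" "c * measure M ?B + c = \<epsilon>"
    using assms(2) m1 by (simp_all add: c_def distrib_left)
  define E where "E = (\<lambda>n::nat. {y. ennreal (real n * c) < f y})"
  have E: "E n \<in> sets borel" for n unfolding E_def using f by measurable
  note EM [measurable] = borel_sets_M[OF E]
  have "\<exists>U. open U \<and> E n \<inter> ?B \<subseteq> U \<and> U \<subseteq> ?B \<and> emeasure M U \<le> emeasure M (E n \<inter> ?B) + ennreal ((1/2) ^ Suc n)" for n
    using outer_open_approx[OF E, of "(1/2) ^ Suc n" n x \<rho>] by (metis zero_less_power half_gt_zero zero_less_one)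
  then obtain U where U: "\<And>n. open (U n)" "\<And>n. E n \<inter> ?B \<subseteq> U n" "\<And>n. U n \<subseteq> ?B"
    "\<And>n. emeasure M (U n) \<le> emeasure M (E n \<inter> ?B) + ennreal ((1/2) ^ Suc n)" by metis
  have UM [measurable]: "U n \<in> sets M" for n using U(1) by auto
  have "\<exists>a::nat \<Rightarrow> 'a \<Rightarrow> real. (\<forall>k. continuous_on UNIV (a k)) \<and> (\<forall>k y. 0 \<le> a k y) \<and> (\<forall>k y. a k y \<le> indicator (U n) y) \<and>
     (\<forall>k y. a k y \<le> a (Suc k) y) \<and> (\<forall>y\<in>U n. \<forall>\<^sub>F k in sequentially. a k y = 1)" for n
    using open_indicator_approx[OF U(1)[of n]] by metis
  then obtain a :: "nat \<Rightarrow> nat \<Rightarrow> 'a \<Rightarrow> real" where a: "\<And>n k. continuous_on UNIV (a n k)" "\<And>n k y. 0 \<le> a n k y"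
    "\<And>n k y. a n k y \<le> indicator (U n) y" "\<And>n k y. a n k y \<le> a n (Suc k) y"
    "\<And>n y. y \<in> U n \<Longrightarrow> \<forall>\<^sub>F k in sequentially. a n k y = 1" by metis
  \<comment> \<open>One index k both truncates the series over the levels and selects the
    approximants of the indicators; g is increasing in k for both reasons.\<close>
  define g where "g = (\<lambda>k y. \<Sum>n<k. c * a n k y)"
  define G where "G = (\<lambda>y. \<Sum>n. ennreal c * indicator (U n) y)"
  have ga: "ennreal (g k y) = (\<Sum>n<k. ennreal c * ennreal (a n k y))" for k y
    using c a(2) by (simp add: g_def sum_ennreal[symmetric] ennreal_mult del: sum_ennreal)
  have gG: "ennreal (g k y) \<le> G y" for k y
  proof -
    have "ennreal (g k y) \<le> (\<Sum>n<k. ennreal c * indicator (U n) y)"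
      unfolding ga using a(3) by (intro sum_mono mult_left_mono) (auto simp: ennreal_indicator[symmetric] intro!: ennreal_leI)
    also have "\<dots> \<le> G y" unfolding G_def by (intro sum_le_suminf) auto
    finally show ?thesis .
  qed
  show ?thesis
  proof (rule that[of g])
    show "continuous_on UNIV (g k)" for k unfolding g_def by (intro continuous_intros a)
    show "0 \<le> g k y" for k y unfolding g_def using c a(2) by (intro sum_nonneg) auto
    show "g k y \<le> g (Suc k) y" for k y
    proof -
      have "g k y \<le> (\<Sum>n<k. c * a n (Suc k) y)" unfolding g_def using c a(4) by (intro sum_mono) auto
      also have "\<dots> \<le> g (Suc k) y" unfolding g_def using c a(2) by simp
      finally show ?thesis .
    qed
    show "\<exists>C. \<forall>y. g k y \<le> C" for k
    proof (intro exI allI)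
      fix y
      have "a n k y \<le> 1" for n using a(3)[of n k y] by (auto simp: indicator_def split: if_splits intro: order_trans)
      then show "g k y \<le> (\<Sum>n<k. c)" unfolding g_def using c by (intro sum_mono) auto
    qed
    show "f y \<le> (SUP k. ennreal (g k y))" if y: "y \<in> ?B" for y
    proof -
      have "f y \<le> (\<Sum>n. ennreal c * (if ennreal (real n * c) < f y then 1 else 0))" by (rule layer_sum_bounds(1)[OF c(1)])
      also have "\<dots> \<le> (SUP k. ennreal (g k y))"
        unfolding suminf_eq_SUP
      proof (rule SUP_least)
        fix N :: nat
        let ?I = "{n. n < N \<and> y \<in> U n}"
        have "\<forall>\<^sub>F k in sequentially. \<forall>n\<in>?I. a n k y = 1" by (intro eventually_ball_finite) (auto intro: a(5))
        then have "\<forall>\<^sub>F k in sequentially. (\<forall>n\<in>?I. a n k y = 1) \<and> N \<le> k"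
          using eventually_ge_at_top by (rule eventually_conj)
        then obtain k where k: "\<And>n. n \<in> ?I \<Longrightarrow> a n k y = 1" "N \<le> k" by (auto simp: eventually_sequentially)
        have "(\<Sum>n<N. ennreal c * (if ennreal (real n * c) < f y then 1 else 0)) \<le> (\<Sum>n<N. ennreal c * ennreal (a n k y))"
        proof (intro sum_mono mult_left_mono)
          fix n assume "n \<in> {..<N}"
          then show "(if ennreal (real n * c) < f y then 1 else 0) \<le> ennreal (a n k y)"
            using k(1)[of n] U(2)[of n] y by (auto simp: E_def)
        qed simp
        also have "\<dots> \<le> ennreal (g k y)" unfolding ga using k(2) by (intro sum_mono2) auto
        also have "\<dots> \<le> (SUP k. ennreal (g k y))" by (rule SUP_upper) simp
        finally show "(\<Sum>n<N. ennreal c * (if ennreal (real n * c) < f y then 1 else 0)) \<le> (SUP k. ennreal (g k y))" .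
      qed
      finally show ?thesis .
    qed
    have fM [measurable]: "f \<in> borel_measurable M" using f by (rule measurable_M)
    have cs: "c * (1 / 2) ^ Suc n \<ge> 0" for n using c by simp
    have "(\<integral>\<^sup>+y. (SUP k. ennreal (g k y)) \<partial>M) \<le> (\<integral>\<^sup>+y. G y \<partial>M)"
      by (intro nn_integral_mono SUP_least gG)
    also have "\<dots> = (\<Sum>n. ennreal c * emeasure M (U n))"
      unfolding G_def by (subst nn_integral_suminf) (auto simp: nn_integral_cmult_indicator)
    also have "\<dots> \<le> (\<Sum>n. ennreal c * emeasure M (E n \<inter> ?B) + ennreal (c * (1/2) ^ Suc n))"
    proof (intro suminf_le allI)
      fix n
      have "ennreal c * emeasure M (U n) \<le> ennreal c * (emeasure M (E n \<inter> ?B) + ennreal ((1/2) ^ Suc n))"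
        by (intro mult_left_mono U) simp
      also have "\<dots> = ennreal c * emeasure M (E n \<inter> ?B) + ennreal (c * (1/2) ^ Suc n)"
        using c by (subst ennreal_mult) (auto simp: distrib_left)
      finally show "ennreal c * emeasure M (U n) \<le> ennreal c * emeasure M (E n \<inter> ?B) + ennreal (c * (1/2) ^ Suc n)" .
    qed auto
    also have "\<dots> = (\<Sum>n. ennreal c * emeasure M (E n \<inter> ?B)) + (\<Sum>n. ennreal (c * (1/2) ^ Suc n))"
      by (intro suminf_add[symmetric]) auto
    also have "(\<Sum>n. ennreal (c * (1/2) ^ Suc n)) = ennreal c"
      using sums_mult[OF power_half_series, of c] cs by (intro suminf_ennreal_eq) auto
    also have "(\<Sum>n. ennreal c * emeasure M (E n \<inter> ?B)) = (\<integral>\<^sup>+y. (\<Sum>n. ennreal c * indicator (E n \<inter> ?B) y) \<partial>M)"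
      by (subst nn_integral_suminf) (auto simp: nn_integral_cmult_indicator)
    also have "\<dots> \<le> (\<integral>\<^sup>+y. f y * indicator ?B y + ennreal c * indicator ?B y \<partial>M)"
    proof (rule nn_integral_mono)
      fix y
      show "(\<Sum>n. ennreal c * indicator (E n \<inter> ?B) y) \<le> f y * indicator ?B y + ennreal c * indicator ?B y"
      proof (cases "y \<in> ?B")
        case True
        then have "(\<Sum>n. ennreal c * indicator (E n \<inter> ?B) y) = (\<Sum>n. ennreal c * (if ennreal (real n * c) < f y then 1 else 0))"
          by (intro suminf_cong) (auto simp: E_def)
        then show ?thesis using layer_sum_bounds(2)[OF c(1), of "f y"] True by simp
      qed simp
    qed
    also have "\<dots> = (\<integral>\<^sup>+y\<in>?B. f y \<partial>M) + ennreal c * emeasure M ?B"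
      by (subst nn_integral_add) (auto simp: nn_integral_cmult_indicator)
    also have "ennreal c * emeasure M ?B = ennreal (c * measure M ?B)"
      using c by (simp add: emeasure_ball_eq ennreal_mult)
    finally have "(\<integral>\<^sup>+y. (SUP k. ennreal (g k y)) \<partial>M) \<le> (\<integral>\<^sup>+y\<in>?B. f y \<partial>M) + (ennreal (c * measure M ?B) + ennreal c)"
      by (simp add: add.assoc add_right_mono)
    also have "ennreal (c * measure M ?B) + ennreal c = ennreal \<epsilon>"
      using c by (subst ennreal_plus[symmetric]) auto
    finally show "(\<integral>\<^sup>+y. (SUP k. ennreal (g k y)) \<partial>M) \<le> (\<integral>\<^sup>+y\<in>?B. f y \<partial>M) + ennreal \<epsilon>" .
  qed
qed

text \<open>A small multiple of the function witnessing zero modulus has infinite line integral on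
  every exceptional curve. Adding it removes the exceptional family at a cost of at most
  \<epsilon>.\<close>

lemma weak_upper_gradient_strengthen:
  assumes "weak_upper_gradient M D u g" "\<epsilon> > 0"
  obtains f where "upper_gradient D u f" "(\<integral>\<^sup>+y. f y \<partial>M) \<le> (\<integral>\<^sup>+y. g y \<partial>M) + ennreal \<epsilon>"
proof -
  obtain \<Gamma> where g: "g \<in> borel_measurable borel" and \<Gamma>: "zero_mod1 M \<Gamma>"
    "\<And>\<gamma>. adm_curve D \<gamma> \<Longrightarrow> \<gamma> \<notin> \<Gamma> \<Longrightarrow> ennreal \<bar>u (\<gamma> 0) - u (\<gamma> 1)\<bar> \<le> line_integral g \<gamma>"
    using assms(1) unfolding weak_upper_gradient_def by blast
  obtain \<rho> where \<rho>: "\<rho> \<in> borel_measurable borel" "(\<integral>\<^sup>+ z. \<rho> z \<partial>M) < \<infinity>" "\<And>\<gamma>. \<gamma> \<in> \<Gamma> \<Longrightarrow> line_integral \<rho> \<gamma> = \<infinity>"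
    using \<Gamma>(1) unfolding zero_mod1_def by blast
  obtain R where R: "(\<integral>\<^sup>+ z. \<rho> z \<partial>M) = ennreal R" "0 \<le> R" using \<rho>(2) by (cases "\<integral>\<^sup>+ z. \<rho> z \<partial>M") auto
  define c where "c = \<epsilon> / (R + 1)"
  have c: "c > 0" "c * R \<le> \<epsilon>" using assms(2) R(2) by (auto simp: c_def field_simps)
  note [measurable] = g \<rho>(1) measurable_M[OF g] measurable_M[OF \<rho>(1)]
  show ?thesis
  proof (rule that[of "\<lambda>y. g y + ennreal c * \<rho> y"])
    show "upper_gradient D u (\<lambda>y. g y + ennreal c * \<rho> y)"
      unfolding upper_gradient_def
    proof (intro conjI allI impI)
      fix \<gamma> :: "real \<Rightarrow> 'a" assume adm: "adm_curve D \<gamma>"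
      show "ennreal \<bar>u (\<gamma> 0) - u (\<gamma> 1)\<bar> \<le> line_integral (\<lambda>y. g y + ennreal c * \<rho> y) \<gamma>"
      proof (cases "\<gamma> \<in> \<Gamma>")
        case False
        have "line_integral g \<gamma> \<le> line_integral (\<lambda>y. g y + ennreal c * \<rho> y) \<gamma>"
          unfolding line_integral_def by (intro nn_integral_mono mult_right_mono) auto
        then show ?thesis using \<Gamma>(2)[OF adm False] by (rule order_trans[rotated])
      next
        case True
        have "curve \<gamma>" using adm by (simp add: adm_curve_def rectifiable_curve_def)
        then have "ennreal c * line_integral \<rho> \<gamma> = line_integral (\<lambda>y. ennreal c * \<rho> y) \<gamma>"
          unfolding line_integral_def mult.assoc
          by (intro nn_integral_cmult[symmetric] borel_measurable_along_curve) simp_all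
        also have "\<dots> \<le> line_integral (\<lambda>y. g y + ennreal c * \<rho> y) \<gamma>"
          unfolding line_integral_def by (intro nn_integral_mono mult_right_mono) auto
        finally show ?thesis using \<rho>(3)[OF True] c by (simp add: ennreal_mult_top top_unique)
      qed
    qed measurable
    have "(\<integral>\<^sup>+y. g y + ennreal c * \<rho> y \<partial>M) = (\<integral>\<^sup>+y. g y \<partial>M) + ennreal (c * R)"
      using c R by (simp add: nn_integral_add nn_integral_cmult ennreal_mult)
    also have "\<dots> \<le> (\<integral>\<^sup>+y. g y \<partial>M) + ennreal \<epsilon>" using c by (intro add_left_mono ennreal_leI) auto
    finally show "(\<integral>\<^sup>+y. g y + ennreal c * \<rho> y \<partial>M) \<le> (\<integral>\<^sup>+y. g y \<partial>M) + ennreal \<epsilon>" .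
  qed
qed

text \<open>The set where some \<open>w k\<close> exceeds a given level is open. This replaces quasicontinuity of the
  capacity test function.\<close>

lemma capacity_approximants:
  fixes x :: 'a
  assumes r: "r > 0" and cap: "cap1 M A (ball x (2 * r)) < ennreal e" and A: "A \<subseteq> ball x r"
  obtains w h :: "nat \<Rightarrow> 'a \<Rightarrow> real" where "\<And>k. lip_pair (w k) (h k)" "\<And>k. \<exists>C. \<forall>y. h k y \<le> C"
    "\<And>k y. h k y \<le> h (Suc k) y" "\<And>k y. 0 \<le> w k y" "\<And>k y. w k y \<le> 1" "\<And>k y. w k y \<le> w (Suc k) y"
    "\<And>k y. y \<notin> ball x (2 * r) \<Longrightarrow> w k y = 0" "\<And>y t. y \<in> A \<Longrightarrow> t < 1 \<Longrightarrow> \<exists>k. t < w k y"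
    "(\<integral>\<^sup>+y. (SUP k. ennreal (h k y)) \<partial>M) \<le> ennreal e"
proof -
  obtain u g0 where u: "u \<in> N011 M (ball x (2 * r))" "\<And>y. y \<in> A \<Longrightarrow> 1 \<le> u y"
    and g0: "weak_upper_gradient M UNIV u g0" "(\<integral>\<^sup>+y. g0 y \<partial>M) < ennreal e"
    using cap unfolding cap1_def INF_less_iff by auto
  obtain a where a: "(\<integral>\<^sup>+y. g0 y \<partial>M) = ennreal a" "0 \<le> a" using g0(2) by (cases "\<integral>\<^sup>+y. g0 y \<partial>M") auto
  have ae: "a < e" using g0(2) a by (simp add: ennreal_less_iff)
  \<comment> \<open>Three losses: passing to a genuine upper gradient, passing to its continuous
    approximation, and adding the positive floor \<delta>.\<close>
  define b where "b = (e - a) / 3"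
  have b: "b > 0" "a + b + b + b = e" using ae by (auto simp: b_def field_simps)
  obtain f where f: "upper_gradient UNIV u f" "(\<integral>\<^sup>+y. f y \<partial>M) \<le> ennreal a + ennreal b"
    using weak_upper_gradient_strengthen[OF g0(1) b(1)] a by metis
  have fb: "f \<in> borel_measurable borel" using f(1) by (simp add: upper_gradient_def)
  obtain g where g: "\<And>k. continuous_on UNIV (g k)" "\<And>k y. 0 \<le> g k y"
    "\<And>k y. g k y \<le> g (Suc k) y" "\<And>k. \<exists>C. \<forall>y. g k y \<le> C"
    "\<And>y. y \<in> ball x (4 * r) \<Longrightarrow> f y \<le> (SUP k. ennreal (g k y))"
    "(\<integral>\<^sup>+y. (SUP k. ennreal (g k y)) \<partial>M) \<le> (\<integral>\<^sup>+y\<in>ball x (4 * r). f y \<partial>M) + ennreal b"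
    using continuous_upper_approx[OF fb b(1), of x "4 * r"] by blast
  \<comment> \<open>The weights need a positive lower bound where the chains run, since this bounds
    the lengths of the chains; the bump below confines its cost to B(x, 4r).\<close>
  define \<delta> where "\<delta> = b / (measure M (ball x (4 * r)) + 1)"
  have m1: "measure M (ball x (4 * r)) + 1 > 0" by (simp add: add_nonneg_pos)
  have \<delta>: "\<delta> > 0" "\<delta> * measure M (ball x (4 * r)) \<le> b"
    using b m1 by (auto simp: \<delta>_def field_simps)
  define bump where "bump = (\<lambda>y. clip (4 - dist x y / r))"
  have bump: "continuous_on UNIV bump" unfolding bump_def using r by (intro continuous_intros) auto
  have bump1: "bump y = 1" if "dist x y \<le> 3 * r" for y using that r by (simp add: bump_def clip_def field_simps)
  have bump0: "bump y = 0" if "dist x y \<ge> 4 * r" for y using that r by (simp add: bump_def clip_def field_simps)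
  have bump01: "0 \<le> bump y" "bump y \<le> 1" for y by (auto simp: bump_def)
  define h where "h = (\<lambda>k y. g k y + \<delta> * bump y)"
  have h0: "0 \<le> h k y" for k y using g(2) \<delta> bump01 by (simp add: h_def)
  have hc: "continuous_on UNIV (h k)" for k unfolding h_def by (intro continuous_intros g bump)
  have hinc: "h k y \<le> h (Suc k) y" for k y using g(3) by (simp add: h_def)
  define F where "F = - ball x (2 * r)"
  define d where "d = (\<lambda>k::nat. r / real (Suc k))"
  have d: "d k > 0" "d (Suc k) \<le> d k" "d k \<le> r" for k
    using r by (auto simp: d_def frac_le field_simps)
  define w where "w = (\<lambda>k. chain_fun (h k) (d k) F)"
  have hbdd: "\<exists>C. \<forall>y. h k y \<le> C" for k
  proof -
    obtain C where "\<And>y. g k y \<le> C" using g(4) by blast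
    then have "h k y \<le> C + \<delta>" for y using \<delta> bump01[of y] by (simp add: h_def add_mono mult_left_le)
    then show ?thesis by blast
  qed
  \<comment> \<open>If no w k y exceeds t, then chains of cost below \<theta> join y to F at every
    fineness. Along their limit curve the integral of f is at most \<theta> < 1, although u falls
    from at least 1 to 0.\<close>
  have one: "\<exists>k. t < w k y" if y: "y \<in> A" and t: "t < 1" for y t
  proof (rule ccontr)
    assume "\<nexists>k. t < w k y"
    then have le: "w k y \<le> t" for k by (simp add: not_less)
    \<comment> \<open>The infimum over chains need not be attained, hence a level strictly between t
      and 1.\<close>
    define \<theta> where "\<theta> = (1 + t) / 2"
    have t\<theta>: "t < \<theta>" "\<theta> < 1" using t by (auto simp: \<theta>_def)
    have "\<exists>n p. (n, p) \<in> chains_to (d k) F y \<and> chain_cost (h k) p n < \<theta>" for k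
    proof -
      have "chain_fun (h k) (d k) F y < \<theta>" "\<theta> \<le> 1" using le[of k] t\<theta> unfolding w_def by linarith+
      from chain_fun_less_obtains[of "h k", OF h0 this] show ?thesis by blast
    qed
    then obtain n p where np: "\<And>k. (n k, p k) \<in> chains_to (d k) F y" "\<And>k. chain_cost (h k) (p k) (n k) < \<theta>"
      by metis
    have yF: "y \<notin> F" using A y r by (auto simp: F_def)
    interpret chain_sequence h p n d "cball x (3 * r)" F \<theta> \<delta> y
    proof
      show "compact (cball x (3 * r))" by (rule compact_cball)
      show "closed F" by (simp add: F_def closed_Compl)
      show "\<delta> \<le> h k z" if "z \<in> cball x (3 * r)" for k z using bump1[of z] that g(2) by (simp add: h_def)
      show "p k 0 = y" "p k (n k) \<in> F" for k using np(1)[of k] by (auto simp: chains_to_def)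
      show step: "dist (p k i) (p k (Suc i)) < d k" if "i < n k" for k i using np(1)[of k] that by (auto simp: chains_to_def)
      show "p k i \<in> cball x (3 * r)" if "i \<le> n k" for k i
      proof (cases "i = n k")
        case False
        then have "p k i \<notin> F" using np(1)[of k] that by (auto simp: chains_to_def)
        then show ?thesis using r by (simp add: F_def)
      next
        case True
        have "p k 0 = y" "p k (n k) \<in> F" using np(1)[of k] by (auto simp: chains_to_def)
        then have "n k \<noteq> 0" using yF by metis
        then obtain j where j: "n k = Suc j" using not0_implies_Suc by blast
        then have "p k j \<in> ball x (2 * r)" using np(1)[of k] by (auto simp: chains_to_def F_def)
        moreover have "dist (p k j) (p k (Suc j)) < r" using step[of j k] j d(3)[of k] by simp
        ultimately show ?thesis using dist_triangle[of x "p k (Suc j)" "p k j"] True j by simp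
      qed
      show "chain_cost (h k) (p k) (n k) \<le> \<theta>" for k using np(2)[of k] by simp
      show "d \<longlonglongrightarrow> 0" unfolding d_def by (intro real_tendsto_divide_at_top[OF tendsto_const] filterlim_compose[OF filterlim_real_sequentially filterlim_Suc])
    qed (use h0 hc hinc hbdd \<delta> t\<theta> d in auto)
    obtain \<gamma> where \<gamma>: "rectifiable_curve \<gamma>" "\<gamma> 0 = y" "\<gamma> 1 \<in> F" "\<gamma> ` {0..1} \<subseteq> cball x (3 * r)"
      "line_integral (\<lambda>z. SUP k. ennreal (h k z)) \<gamma> \<le> ennreal \<theta>" using limit_curve_line_integral by blast
    have "adm_curve UNIV \<gamma>"
      using \<gamma> yF by (auto simp: adm_curve_def nonconstant_curve_def intro!: bexI[of _ 1])
    then have "ennreal \<bar>u (\<gamma> 0) - u (\<gamma> 1)\<bar> \<le> line_integral f \<gamma>" using f(1) by (simp add: upper_gradient_def)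
    also have "\<dots> \<le> line_integral (\<lambda>z. SUP k. ennreal (h k z)) \<gamma>"
      unfolding line_integral_def
    proof (rule nn_integral_mono)
      fix t :: real
      show "f (\<gamma> t) * indicator {0..1} t \<le> (SUP k. ennreal (h k (\<gamma> t))) * indicator {0..1} t"
      proof (cases "t \<in> {0..1}")
        case True
        then have "\<gamma> t \<in> ball x (4 * r)" using \<gamma>(4) r by force
        then have "f (\<gamma> t) \<le> (SUP k. ennreal (g k (\<gamma> t)))" by (rule g)
        also have "\<dots> \<le> (SUP k. ennreal (h k (\<gamma> t)))"
          using \<delta> bump01 by (intro SUP_mono') (auto simp: h_def intro!: ennreal_leI)
        finally show ?thesis using True by simp
      qed simp
    qed
    also have "\<dots> \<le> ennreal \<theta>" by (rule \<gamma>)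
    also have "\<dots> < ennreal 1" using t\<theta> by (intro ennreal_lessI) auto
    finally have "ennreal \<bar>u (\<gamma> 0) - u (\<gamma> 1)\<bar> < ennreal 1" .
    moreover have "u (\<gamma> 1) = 0" using u(1) \<gamma>(3) by (auto simp: N011_def F_def)
    moreover have "1 \<le> u (\<gamma> 0)" using u(2) y \<gamma>(2) by simp
    ultimately show False by (simp add: ennreal_less_iff flip: ennreal_1)
  qed
  have int: "(\<integral>\<^sup>+y. (SUP k. ennreal (h k y)) \<partial>M) \<le> ennreal e"
  proof -
    have [measurable]: "(\<lambda>y. ennreal (g k y)) \<in> borel_measurable M" for k
      by (intro measurable_compose[OF _ measurable_ennreal] continuous_measurable_M g)
    have "(\<integral>\<^sup>+y. (SUP k. ennreal (h k y)) \<partial>M) \<le>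
        (\<integral>\<^sup>+y. (SUP k. ennreal (g k y)) + ennreal \<delta> * indicator (ball x (4 * r)) y \<partial>M)"
    proof (intro nn_integral_mono SUP_least)
      fix y k
      have "ennreal (h k y) = ennreal (g k y) + ennreal (\<delta> * bump y)"
        using g(2) \<delta> bump01 by (simp add: h_def)
      also have "ennreal (\<delta> * bump y) \<le> ennreal \<delta> * indicator (ball x (4 * r)) y"
        using bump0[of y] bump01[of y] \<delta> by (cases "dist x y < 4 * r") (auto intro!: ennreal_leI simp: mult_left_le)
      finally show "ennreal (h k y) \<le> (SUP k. ennreal (g k y)) + ennreal \<delta> * indicator (ball x (4 * r)) y"
        by (meson SUP_upper UNIV_I add_mono order_trans add_left_mono add_right_mono)
    qed
    also have "\<dots> = (\<integral>\<^sup>+y. (SUP k. ennreal (g k y)) \<partial>M) + ennreal (\<delta> * measure M (ball x (4 * r)))"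
      using \<delta> by (subst nn_integral_add) (auto simp: nn_integral_cmult_indicator emeasure_ball_eq ennreal_mult)
    also have "\<dots> \<le> ((\<integral>\<^sup>+y\<in>ball x (4 * r). f y \<partial>M) + ennreal b) + ennreal b"
      using g(6) \<delta> by (intro add_mono ennreal_leI) auto
    also have "(\<integral>\<^sup>+y\<in>ball x (4 * r). f y \<partial>M) \<le> (\<integral>\<^sup>+y. f y \<partial>M)"
      by (intro nn_integral_mono) (auto simp: indicator_def)
    also note f(2)
    also have "ennreal a + ennreal b + ennreal b + ennreal b = ennreal e"
      using a b by (simp flip: ennreal_plus)
    finally show ?thesis by (simp add: add_right_mono)
  qed
  show ?thesis
  proof (rule that[of w h])
    show "lip_pair (w k) (h k)" for k unfolding w_def by (intro lip_pair_chain_fun h0 hc d)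
    show "w k y \<le> w (Suc k) y" for k y unfolding w_def by (intro chain_fun_mono h0 hinc d)
    show "w k y = 0" if "y \<notin> ball x (2 * r)" for k y
      unfolding w_def using that by (intro chain_fun_zero h0) (auto simp: F_def)
  qed (use hbdd hinc one int h0 in \<open>auto simp: w_def chain_fun_nonneg chain_fun_le_one\<close>)
qed

end

section \<open>Oscillation over concentric balls\<close>

context pi_space
begin

text \<open>The Poincare inequality freed of its normalisations: the mean becomes some constant m,
  and dividing the right side by the measure of the smaller ball instead of the larger one only
  increases it, after which the measure cancels.\<close>

lemma poincare_lip_pair:
  assumes w: "lip_pair w h" and bdd: "\<And>y. \<bar>w y\<bar> \<le> K" and r: "r > 0"
  obtains m where "(\<integral>\<^sup>+z\<in>ball y r. ennreal \<bar>w z - m\<bar> \<partial>M) \<le>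
    ennreal (CP * r) * (\<integral>\<^sup>+z\<in>ball y (lam * r). ennreal (h z) \<partial>M)"
proof -
  have wM [measurable]: "w \<in> borel_measurable M"
    by (intro continuous_measurable_M lip_pair_continuous[OF w])
  have L1: "L1_loc M w"
    unfolding L1_loc_def
  proof (intro conjI allI wM)
    fix y :: 'a
    have "(\<integral>\<^sup>+z\<in>ball y 1. ennreal \<bar>w z\<bar> \<partial>M) \<le> (\<integral>\<^sup>+z. ennreal K * indicator (ball y 1) z \<partial>M)"
      by (intro nn_integral_mono) (auto simp: indicator_def intro!: ennreal_leI bdd)
    also have "\<dots> = ennreal K * emeasure M (ball y 1)" by (simp add: nn_integral_cmult_indicator)
    also have "\<dots> < \<infinity>" by (simp add: emeasure_ball_eq ennreal_mult_less_top)
    finally show "\<exists>r>0. (\<integral>\<^sup>+z\<in>ball y r. ennreal \<bar>w z\<bar> \<partial>M) < \<infinity>" by (intro exI[of _ 1]) auto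
  qed
  define m where "m = (LINT z:ball y r|M. w z) / measure M (ball y r)"
  define I where "I = (\<integral>\<^sup>+z\<in>ball y r. ennreal \<bar>w z - m\<bar> \<partial>M)"
  define J where "J = (\<integral>\<^sup>+z\<in>ball y (lam * r). ennreal (h z) \<partial>M)"
  define \<mu> where "\<mu> = emeasure M (ball y r)"
  have \<mu>: "\<mu> \<noteq> 0" "\<mu> \<noteq> top" using emeasure_ball_pos[OF r, of y] emeasure_ball_finite[of y r] by (auto simp: \<mu>_def)
  have cancel: "\<mu> * (a / \<mu>) = a" for a
    using \<mu> by (simp add: ennreal_times_divide mult.commute[of \<mu>] mult_divide_eq_ennreal)
  have "r \<le> lam * r" using lam r by simp
  then have sub: "\<mu> \<le> emeasure M (ball y (lam * r))"
    unfolding \<mu>_def by (intro emeasure_mono) auto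
  have "I / \<mu> \<le> ennreal (CP * r) * (J / emeasure M (ball y (lam * r)))"
    using poincare[OF r L1 lip_pair_upper_gradient[OF w], of y] by (simp add: I_def J_def \<mu>_def m_def)
  also have "\<dots> \<le> ennreal (CP * r) * (J / \<mu>)"
  proof (rule mult_left_mono)
    have "J = \<mu> * (J / \<mu>)" by (simp add: cancel)
    also have "\<dots> \<le> emeasure M (ball y (lam * r)) * (J / \<mu>)" by (intro mult_right_mono sub) simp
    finally show "J / emeasure M (ball y (lam * r)) \<le> J / \<mu>"
      using sub \<mu> by (intro divide_le_posI_ennreal) (auto simp: zero_less_iff_neq_zero)
  qed simp
  finally have "\<mu> * (I / \<mu>) \<le> \<mu> * (ennreal (CP * r) * (J / \<mu>))" by (intro mult_left_mono) auto
  also have "\<dots> = ennreal (CP * r) * (\<mu> * (J / \<mu>))" by (simp add: ac_simps)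
  finally have "I \<le> ennreal (CP * r) * J" by (simp add: cancel)
  then show ?thesis using that by (simp add: I_def J_def)
qed

text \<open>Chebyshev's inequality in real numbers. Values c \<le> 0 are allowed because in the
  applications the sign of a level minus m is unknown.\<close>

lemma deviation_bound:
  assumes "(\<integral>\<^sup>+z\<in>ball y r. ennreal \<bar>w z - m\<bar> \<partial>M) \<le> ennreal D" "0 \<le> D"
    and Z: "Z \<in> sets M" "Z \<subseteq> ball y r" and c: "\<And>z. z \<in> Z \<Longrightarrow> c \<le> \<bar>w z - m\<bar>"
  shows "c * measure M Z \<le> D"
proof (cases "c \<le> 0")
  case True
  then show ?thesis using assms(2) by (meson measure_nonneg mult_nonpos_nonneg order_trans)
next
  case False
  have Zf: "emeasure M Z = ennreal (measure M Z)"
    using emeasure_mono[OF Z(2), of M] emeasure_ball_finite[of y r]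
    by (intro emeasure_eq_ennreal_measure) (auto simp: top_unique)
  have "ennreal (c * measure M Z) = ennreal c * emeasure M Z" using False by (simp add: Zf ennreal_mult)
  also have "\<dots> = (\<integral>\<^sup>+z. ennreal c * indicator Z z \<partial>M)" using Z by (simp add: nn_integral_cmult_indicator)
  also have "\<dots> \<le> (\<integral>\<^sup>+z\<in>ball y r. ennreal \<bar>w z - m\<bar> \<partial>M)"
    using Z(2) by (intro nn_integral_mono) (auto simp: indicator_def intro!: ennreal_leI c)
  also have "\<dots> \<le> ennreal D" by (rule assms(1))
  finally show ?thesis using assms(2) by (simp add: ennreal_le_iff)
qed

text \<open>Cd ^ 5 compares B(x, 4r) with a ball of radius r/4 inside the annulus between 2r and 4r.
  The factor 2 yields \<open>ann_c * Cd\<close> \<le> 1 - \<open>ann_c\<close>: a set filling more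
  than 1 - \<open>ann_c\<close> of a ball then fills at least \<open>ann_c\<close> of the ball of
  twice the radius.\<close>

definition ann_c :: real where "ann_c = 1 / (2 * Cd ^ 5)"

lemma ann_c: "0 < ann_c" "ann_c \<le> 1 / 2" "ann_c * Cd \<le> 1 - ann_c"
proof -
  have "1 \<le> Cd ^ 5" "1 \<le> Cd ^ 4" using Cd by auto
  then show "0 < ann_c" "ann_c \<le> 1 / 2" using Cd by (auto simp: ann_c_def)
  have "ann_c * Cd = 1 / (2 * Cd ^ 4)" using Cd by (simp add: ann_c_def field_simps power_Suc[symmetric] del: power_Suc)
  also have "\<dots> \<le> 1 / 2" using \<open>1 \<le> Cd ^ 4\<close> by (intro divide_left_mono) auto
  finally show "ann_c * Cd \<le> 1 - ann_c" using \<open>ann_c \<le> 1 / 2\<close> by simp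
qed

text \<open>Otherwise the indicator of a ball would be locally constant, against the Poincare inequality.\<close>

lemma annulus_nonempty:
  fixes x z :: 'a
  assumes "0 < r" "8 * r < dist x z"
  shows "\<exists>y. 9 / 4 * r < dist x y \<and> dist x y < 13 / 4 * r"
proof (rule ccontr)
  assume "\<not> ?thesis"
  then have empty: "dist x y \<le> 9 / 4 * r \<or> 13 / 4 * r \<le> dist x y" for y by (meson not_le)
  define w where "w = (\<lambda>y. if dist x y \<le> 9 / 4 * r then 0 else 1 :: real)"
  have "lip_pair w (\<lambda>_. 0)"
  proof (rule lip_pairI[OF _ _ assms(1)])
    fix a b :: 'a assume "dist a b < r"
    then have "dist x a \<le> 9 / 4 * r \<longleftrightarrow> dist x b \<le> 9 / 4 * r"
      using empty[of a] empty[of b] dist_triangle[of x a b] dist_triangle[of x b a] by (auto simp: dist_commute)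
    then show "\<bar>w a - w b\<bar> \<le> 0 * dist a b" by (simp add: w_def)
  qed auto
  moreover have "\<bar>w y\<bar> \<le> 1" for y by (simp add: w_def)
  moreover have R: "2 * dist x z > 0" using assms by linarith
  ultimately obtain m where "(\<integral>\<^sup>+z\<in>ball x (2 * dist x z). ennreal \<bar>w z - m\<bar> \<partial>M) \<le>
    ennreal (CP * (2 * dist x z)) * (\<integral>\<^sup>+y\<in>ball x (lam * (2 * dist x z)). ennreal 0 \<partial>M)"
    using poincare_lip_pair by blast
  then have m: "(\<integral>\<^sup>+y\<in>ball x (2 * dist x z). ennreal \<bar>w y - m\<bar> \<partial>M) \<le> ennreal 0" by simp
  \<comment> \<open>w = 0 on B(x, r) forces m = 0, and then w = 1 around z contradicts the vanishing
    oscillation.\<close>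
  have "\<bar>m\<bar> * measure M (ball x r) \<le> 0"
    by (rule deviation_bound[OF m]) (use assms in \<open>auto simp: w_def\<close>)
  then have "m = 0" using measure_ball_pos[OF assms(1), of x] by (simp add: mult_le_0_iff)
  have "1 * measure M (ball z (dist x z / 2)) \<le> 0"
  proof (rule deviation_bound[OF m])
    show "ball z (dist x z / 2) \<subseteq> ball x (2 * dist x z)"
    proof
      fix y assume "y \<in> ball z (dist x z / 2)"
      then show "y \<in> ball x (2 * dist x z)" using dist_triangle[of x y z] R unfolding mem_ball by linarith
    qed
    fix y assume "y \<in> ball z (dist x z / 2)"
    then have "9 / 4 * r < dist x y" using dist_triangle[of x z y] assms by (simp add: dist_commute)
    then show "1 \<le> \<bar>w y - m\<bar>" by (simp add: w_def \<open>m = 0\<close>)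
  qed auto
  then show False using measure_ball_pos[of "dist x z / 2" z] R by simp
qed

lemma annulus_measure:
  fixes x z :: 'a
  assumes "0 < r" "8 * r < dist x z"
  shows "ann_c * measure M (ball x (4 * r)) \<le> measure M (ball x (4 * r) - ball x (2 * r))"
proof -
  obtain y where y: "9 / 4 * r < dist x y" "dist x y < 13 / 4 * r"
    using annulus_nonempty[OF assms] by blast
  \<comment> \<open>The radius 2 ^ 5 * (r / 4) = 8 * r exceeds 4 * r + 13/4 * r. The margins in the
    choice of y leave room for a ball of radius r/4 on both sides of the annulus.\<close>
  have "ball x (4 * r) \<subseteq> ball y (2 ^ 5 * (r / 4))"
  proof
    fix v assume "v \<in> ball x (4 * r)"
    then show "v \<in> ball y (2 ^ 5 * (r / 4))" using y dist_triangle[of y v x] by (simp add: dist_commute)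
  qed
  then have "measure M (ball x (4 * r)) \<le> measure M (ball y (2 ^ 5 * (r / 4)))" by (intro measure_mono_ball) auto
  also have "\<dots> \<le> Cd ^ 5 * measure M (ball y (r / 4))" using assms by (intro measure_ball_double_power) auto
  also have "\<dots> \<le> Cd ^ 5 * measure M (ball x (4 * r) - ball x (2 * r))"
  proof (intro mult_left_mono measure_mono_fmeasurable)
    show "ball y (r / 4) \<subseteq> ball x (4 * r) - ball x (2 * r)"
    proof
      fix v assume "v \<in> ball y (r / 4)"
      then show "v \<in> ball x (4 * r) - ball x (2 * r)"
        using y dist_triangle[of x y v] dist_triangle[of x v y] by (simp add: dist_commute)
    qed
  qed (use Cd in auto)
  finally have "measure M (ball x (4 * r)) \<le> Cd ^ 5 * measure M (ball x (4 * r) - ball x (2 * r))" .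
  moreover have "1 \<le> Cd ^ 5" using Cd by auto
  moreover have "ann_c * measure M (ball x (4 * r)) \<le> 1 / Cd ^ 5 * measure M (ball x (4 * r))"
    using Cd by (intro mult_right_mono) (auto simp: ann_c_def field_simps)
  moreover have "1 / Cd ^ 5 * measure M (ball x (4 * r)) \<le> measure M (ball x (4 * r) - ball x (2 * r))"
    using calculation(1) Cd by (simp add: pos_divide_le_eq mult.commute)
  ultimately show ?thesis by linarith
qed

section \<open>Energies of level sets and the oscillation between levels\<close>

definition energy :: "('a \<Rightarrow> real) \<Rightarrow> 'a set \<Rightarrow> real" where
  "energy h S = measure (density M (\<lambda>z. ennreal (h z))) S"

text \<open>\<open>energy\<close> is real-valued for the sake of linear arithmetic. It represents
  the integral only if this is finite, so the bound E on the total accompanies the facts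
  below.\<close>

lemma energy_eq:
  assumes "continuous_on UNIV h" "(\<integral>\<^sup>+z. ennreal (h z) \<partial>M) \<le> ennreal E" "S \<in> sets M"
  shows "(\<integral>\<^sup>+z\<in>S. ennreal (h z) \<partial>M) = ennreal (energy h S)"
proof -
  have [measurable]: "(\<lambda>z. ennreal (h z)) \<in> borel_measurable M"
    by (intro measurable_compose[OF _ measurable_ennreal] continuous_measurable_M assms)
  have "(\<integral>\<^sup>+z\<in>S. ennreal (h z) \<partial>M) \<le> (\<integral>\<^sup>+z. ennreal (h z) \<partial>M)"
    by (intro nn_integral_mono) (auto simp: indicator_def)
  also note assms(2)
  also have "ennreal E < top" by simp
  finally have "(\<integral>\<^sup>+z\<in>S. ennreal (h z) \<partial>M) < top" .
  then show ?thesis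
    using assms(3) by (simp add: energy_def measure_def emeasure_density)
qed

lemma energy_mono:
  assumes "continuous_on UNIV h" "(\<integral>\<^sup>+z. ennreal (h z) \<partial>M) \<le> ennreal E" "S \<in> sets M" "T \<in> sets M" "S \<subseteq> T"
  shows "energy h S \<le> energy h T"
proof -
  have "ennreal (energy h S) \<le> ennreal (energy h T)"
    unfolding energy_eq[OF assms(1,2,3), symmetric] energy_eq[OF assms(1,2,4), symmetric]
    using assms(5) by (intro nn_integral_mono) (auto simp: indicator_def)
  then show ?thesis by (simp add: ennreal_le_iff energy_def)
qed

lemma energy_disjoint:
  assumes "continuous_on UNIV h" "(\<integral>\<^sup>+z. ennreal (h z) \<partial>M) \<le> ennreal E"
    "S \<in> sets M" "T \<in> sets M" "U \<in> sets M" "S \<union> T \<subseteq> U" "S \<inter> T = {}"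
  shows "energy h S + energy h T \<le> energy h U"
proof -
  have [measurable]: "(\<lambda>z. ennreal (h z)) \<in> borel_measurable M" "S \<in> sets M" "T \<in> sets M"
    by (intro measurable_compose[OF _ measurable_ennreal] continuous_measurable_M assms)+
  have "ennreal (energy h S + energy h T) = ennreal (energy h S) + ennreal (energy h T)"
    by (simp add: energy_def)
  also have "\<dots> = (\<integral>\<^sup>+z. ennreal (h z) * indicator S z + ennreal (h z) * indicator T z \<partial>M)"
    unfolding energy_eq[OF assms(1,2,3), symmetric] energy_eq[OF assms(1,2,4), symmetric]
    by (intro nn_integral_add[symmetric]) measurable
  also have "\<dots> \<le> (\<integral>\<^sup>+z\<in>U. ennreal (h z) \<partial>M)"
    using assms(6,7) by (intro nn_integral_mono) (auto simp: indicator_def)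
  also have "\<dots> = ennreal (energy h U)" by (rule energy_eq) fact+
  finally show ?thesis by (rule ennreal_le_iff[THEN iffD1, rotated]) (simp add: energy_def)
qed

lemma energy_le:
  assumes "continuous_on UNIV h" "(\<integral>\<^sup>+z. ennreal (h z) \<partial>M) \<le> ennreal E" "0 \<le> E" "S \<in> sets M"
  shows "energy h S \<le> E"
proof -
  have "ennreal (energy h S) \<le> ennreal E"
    unfolding energy_eq[OF assms(1,2,4), symmetric]
    by (rule order_trans[OF _ assms(2)]) (auto intro!: nn_integral_mono simp: indicator_def)
  then show ?thesis using assms(3) by (simp add: ennreal_le_iff)
qed

lemma level_sets_M:
  assumes "continuous_on UNIV w"
  shows "{z. (w z :: real) \<le> s} \<in> sets M" "{z. s < w z} \<in> sets M" "{z. s < w z \<and> w z < t} \<in> sets M"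
proof -
  have [measurable]: "w \<in> borel_measurable borel" using assms by (rule borel_measurable_continuous_onI)
  show "{z. w z \<le> s} \<in> sets M" "{z. s < w z} \<in> sets M" "{z. s < w z \<and> w z < t} \<in> sets M"
    by (intro borel_sets_M; measurable)+
qed

lemma measure_ball_split:
  assumes "continuous_on UNIV w"
  shows "measure M (ball y r) = measure M (ball y r \<inter> {z. s < w z}) + measure M (ball y r \<inter> {z. (w z :: real) \<le> s})"
proof -
  note lev = level_sets_M[OF assms]
  have "measure M (ball y r - (ball y r \<inter> {z. s < w z})) = measure M (ball y r) - measure M (ball y r \<inter> {z. s < w z})"
    using lev by (intro measurable_measure_Diff) auto
  moreover have "ball y r - (ball y r \<inter> {z. s < w z}) = ball y r \<inter> {z. w z \<le> s}" by auto
  ultimately show ?thesis by simp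
qed

text \<open>Poincare for w truncated between the levels s and t: the gradient of the truncation
  lives in {s < w < t}, so only the energy of this band pays. Adding the deviations from m on Z and
  on Z' makes m cancel, hence the factor 2.\<close>

lemma truncation_oscillation:
  fixes y :: 'a
  assumes w: "lip_pair w h" and hC: "\<And>z. h z \<le> C" and E: "(\<integral>\<^sup>+z. ennreal (h z) \<partial>M) \<le> ennreal E"
    and st: "s < t" and r: "r > 0"
    and Z: "Z \<in> sets M" "Z \<subseteq> ball y r" "\<And>z. z \<in> Z \<Longrightarrow> w z \<le> s" "a \<le> measure M Z"
    and Z': "Z' \<in> sets M" "Z' \<subseteq> ball y r" "\<And>z. z \<in> Z' \<Longrightarrow> t \<le> w z" "a \<le> measure M Z'"
  shows "(t - s) * a \<le> 2 * CP * r * energy h {z. s < w z \<and> w z < t}"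
proof (cases "a \<le> 0")
  case True
  then have "(t - s) * a \<le> 0" using st by (simp add: mult_nonneg_nonpos)
  then show ?thesis using CP r by (simp add: energy_def order_trans[OF _ mult_nonneg_nonneg])
next
  case False
  then have a: "a > 0" by simp
  have wc: "continuous_on UNIV w" and hc: "continuous_on UNIV h"
    using lip_pair_continuous[OF w] lip_pair_grad_continuous[OF w] by auto
  define S where "S = {z. s < w z \<and> w z < t}"
  have S: "S \<in> sets M" unfolding S_def by (rule level_sets_M[OF wc])
  define D where "D = CP * r * energy h S"
  have D: "0 \<le> D" using CP r by (simp add: D_def energy_def)
  \<comment> \<open>The margin 4 * \<eta> stems from the continuous fading of the gradient; it tends
    to 0 at the end.\<close>
  have step: "(t - s - 4 * \<eta>) * a \<le> 2 * D" if \<eta>: "\<eta> > 0" "4 * \<eta> \<le> t - s" for \<eta>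
  proof -
    define W where "W = (\<lambda>z. max (s + 2 * \<eta>) (min (w z) (t - 2 * \<eta>)))"
    define H where "H = (\<lambda>z. h z * clip (min (w z - s) (t - w z) / \<eta>))"
    have "lip_pair W H" unfolding W_def H_def by (rule lip_pair_truncate[OF w hC \<eta>(1)])
    moreover have "\<bar>W z\<bar> \<le> \<bar>s\<bar> + \<bar>t\<bar> + 2 * \<eta>" for z using \<eta> unfolding W_def by linarith
    ultimately obtain m where m: "(\<integral>\<^sup>+z\<in>ball y r. ennreal \<bar>W z - m\<bar> \<partial>M) \<le>
        ennreal (CP * r) * (\<integral>\<^sup>+z\<in>ball y (lam * r). ennreal (H z) \<partial>M)"
      using poincare_lip_pair[OF _ _ r] by blast
    have "(\<integral>\<^sup>+z\<in>ball y (lam * r). ennreal (H z) \<partial>M) \<le> (\<integral>\<^sup>+z\<in>S. ennreal (h z) \<partial>M)"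
    proof (rule nn_integral_mono)
      fix z
      show "ennreal (H z) * indicator (ball y (lam * r)) z \<le> ennreal (h z) * indicator S z"
      proof (cases "z \<in> S")
        case True
        have "H z \<le> h z" unfolding H_def using lip_pair_grad_nonneg[OF w] by (simp add: mult_left_le)
        then show ?thesis using True by (auto simp: indicator_def intro: ennreal_leI)
      next
        case False
        then have "min (w z - s) (t - w z) / \<eta> \<le> 0" using \<eta> by (auto simp: S_def divide_le_0_iff min_def)
        then have "H z = 0" by (simp add: H_def clip_def)
        then show ?thesis by simp
      qed
    qed
    then have "(\<integral>\<^sup>+z\<in>ball y r. ennreal \<bar>W z - m\<bar> \<partial>M) \<le> ennreal (CP * r) * ennreal (energy h S)"
      unfolding energy_eq[OF hc E S] by (intro order_trans[OF m] mult_left_mono) auto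
    then have D': "(\<integral>\<^sup>+z\<in>ball y r. ennreal \<bar>W z - m\<bar> \<partial>M) \<le> ennreal D"
      using CP r by (simp add: D_def ennreal_mult energy_def)
    have "(m - (s + 2 * \<eta>)) * measure M Z \<le> D"
      by (rule deviation_bound[OF D' D Z(1,2)]) (use Z(3) \<eta> st in \<open>fastforce simp: W_def\<close>)
    moreover have "((t - 2 * \<eta>) - m) * measure M Z' \<le> D"
      by (rule deviation_bound[OF D' D Z'(1,2)]) (use Z'(3) \<eta> st in \<open>fastforce simp: W_def\<close>)
    \<comment> \<open>Passing from the measure of Z to its lower bound a is monotone for u \<ge> 0;
      for u \<le> 0 the claim is trivial.\<close>
    moreover have "u * a \<le> D" if "u * v \<le> D" "a \<le> v" for u v
    proof (cases "u \<le> 0")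
      case True
      then have "u * a \<le> 0" using a by (simp add: mult_nonpos_nonneg)
      then show ?thesis using D by simp
    next
      case False
      then have "u * a \<le> u * v" using that by (intro mult_left_mono) auto
      then show ?thesis using that by simp
    qed
    ultimately have "(m - (s + 2 * \<eta>)) * a \<le> D" "((t - 2 * \<eta>) - m) * a \<le> D" using Z(4) Z'(4) by blast+
    then show ?thesis by (simp add: algebra_simps)
  qed
  have "(t - s) * a \<le> 2 * D"
  proof (rule field_le_epsilon)
    fix e :: real assume "e > 0"
    define \<eta> where "\<eta> = min ((t - s) / 4) (e / (4 * a))"
    have "\<eta> \<le> (t - s) / 4" unfolding \<eta>_def by (rule min.cobounded1)
    then have "4 * \<eta> \<le> t - s" by (simp only: le_divide_eq_numeral1 mult.commute)
    moreover have "\<eta> > 0" using st \<open>e > 0\<close> a by (simp add: \<eta>_def)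
    moreover have "4 * \<eta> * a \<le> e"
    proof -
      have "\<eta> \<le> e / (4 * a)" by (simp add: \<eta>_def)
      then show ?thesis using a by (simp add: field_simps)
    qed
    ultimately show "(t - s) * a \<le> 2 * D + e" using step[of \<eta>] by (simp add: algebra_simps)
  qed
  then show ?thesis by (simp add: D_def S_def mult.assoc)
qed

text \<open>2 * CP is the constant of \<open>truncation_oscillation\<close>; each of the two sets
  compared in a ball occupies at least the fraction \<open>ann_c\<close> of its measure.\<close>

definition drift_K :: real where "drift_K = 2 * CP / ann_c"

lemma drift_K_pos: "drift_K > 0"
  using CP ann_c by (simp add: drift_K_def)

text \<open>Telescoping the averages over the balls costs one copy of the whole energy per scale. Truncating
  at the levels actually crossed between two consecutive scales makes the energies that are used disjoint,
  so that the total drift is bounded independently of the number of scales.\<close>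

lemma level_drift:
  fixes x :: 'a
  assumes w: "lip_pair w h" and hC: "\<And>z. h z \<le> C" and E: "(\<integral>\<^sup>+z. ennreal (h z) \<partial>M) \<le> ennreal E"
    and R: "R > 0" and \<kappa>: "\<kappa> > 0" "\<And>i. i \<le> l \<Longrightarrow> \<kappa> * (R / 2 ^ i) \<le> measure M (ball x (R / 2 ^ i))"
    and Z0: "Z0 \<in> sets M" "Z0 \<subseteq> ball x R" "ann_c * measure M (ball x R) \<le> measure M Z0" "\<And>z. z \<in> Z0 \<Longrightarrow> w z = 0"
    and i: "i \<le> l" and \<tau>: "0 \<le> \<tau>"
    and large: "(1 - ann_c) * measure M (ball x (R / 2 ^ i)) < measure M (ball x (R / 2 ^ i) \<inter> {z. \<tau> < w z})"
  shows "\<kappa> * \<tau> \<le> drift_K * energy h {z. 0 < w z \<and> w z < \<tau>}"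
  using i \<tau> large
proof (induction i arbitrary: \<tau>)
  \<comment> \<open>Contradictory: w vanishes on Z0, which leaves too little room for {\<tau> <
    w}.\<close>
  case 0
  have wc: "continuous_on UNIV w" using lip_pair_continuous[OF w] .
  have "measure M (ball x R \<inter> {z. \<tau> < w z}) \<le> measure M (ball x R - Z0)"
  proof (rule measure_mono_fmeasurable)
    show "ball x R \<inter> {z. \<tau> < w z} \<subseteq> ball x R - Z0" using Z0(4) 0 by auto
    show "ball x R - Z0 \<in> fmeasurable M" using Z0 by (intro fmeasurable_Diff) auto
  qed (use level_sets_M[OF wc] in auto)
  also have "\<dots> = measure M (ball x R) - measure M Z0"
    using Z0 by (intro measure_Diff) (auto simp: emeasure_ball_eq)
  finally show ?case using Z0(3) 0 by (simp add: algebra_simps)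
next
  case (Suc i)
  have wc: "continuous_on UNIV w" and hc: "continuous_on UNIV h"
    using lip_pair_continuous[OF w] lip_pair_grad_continuous[OF w] by auto
  note lev [simp] = level_sets_M[OF wc]
  define \<rho> where "\<rho> = R / 2 ^ i"
  have \<rho>: "\<rho> > 0" "R / 2 ^ Suc i = \<rho> / 2" using R by (auto simp: \<rho>_def)
  let ?B = "ball x \<rho>"
  define \<nu> where "\<nu> = (\<lambda>s t. energy h {z. s < w z \<and> w z < t})"
  have \<nu>_mono: "\<nu> s t \<le> \<nu> s' t'" if "s' \<le> s" "t \<le> t'" for s t s' t'
    unfolding \<nu>_def using that by (intro energy_mono[OF hc E]) auto
  \<comment> \<open>\<sigma> is the supremum of the levels up to \<tau> that are exceeded on most of
    the larger ball. Levels below \<sigma> are paid for by the induction hypothesis, those between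
    \<sigma> and \<tau> at the present scale. The set S may be empty, whence
    \<open>insert 0\<close>.\<close>
  define S where "S = {\<sigma>. 0 \<le> \<sigma> \<and> \<sigma> \<le> \<tau> \<and> (1 - ann_c) * measure M ?B < measure M (?B \<inter> {z. \<sigma> < w z})}"
  define \<sigma> where "\<sigma> = Sup (insert 0 S)"
  have bdd: "bdd_above (insert 0 S)" by (rule bdd_aboveI[of _ \<tau>]) (use Suc.prems in \<open>auto simp: S_def\<close>)
  have \<sigma>: "0 \<le> \<sigma>" "\<sigma> \<le> \<tau>"
    unfolding \<sigma>_def using bdd Suc.prems by (auto intro!: cSup_upper cSup_least simp: S_def)
  have up: "s \<le> \<sigma>" if "s \<in> S" for s unfolding \<sigma>_def using bdd that by (intro cSup_upper) auto
  have 1: "\<kappa> * \<sigma> \<le> drift_K * \<nu> 0 \<sigma>"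
  proof -
    have "s \<le> drift_K * \<nu> 0 \<sigma> / \<kappa>" if "s \<in> insert 0 S" for s
    proof (cases "s \<in> S")
      case True
      then have "\<kappa> * s \<le> drift_K * \<nu> 0 s"
        unfolding \<nu>_def using Suc.prems by (intro Suc.IH) (auto simp: S_def \<rho>_def)
      also have "\<dots> \<le> drift_K * \<nu> 0 \<sigma>" using drift_K_pos up[OF True] by (intro mult_left_mono \<nu>_mono) auto
      finally show ?thesis using \<kappa> by (simp add: field_simps)
    next
      case False
      then show ?thesis using that drift_K_pos \<kappa> by (simp add: \<nu>_def energy_def)
    qed
    then have "\<sigma> \<le> drift_K * \<nu> 0 \<sigma> / \<kappa>" unfolding \<sigma>_def by (intro cSup_least) (auto simp: \<sigma>_def[symmetric])
    then show ?thesis using \<kappa> by (simp add: field_simps)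
  qed
  show ?case
  proof (cases "\<sigma> = \<tau>")
    case True
    then show ?thesis using 1 by (simp add: \<nu>_def)
  next
    case False
    then have "\<sigma> < \<tau>" using \<sigma> by simp
    \<comment> \<open>Here w \<le> s on a fraction \<open>ann_c\<close> of the ball, while \<tau> <
      w on most of the ball of half the radius, which by doubling is again a fraction
      \<open>ann_c\<close> of the whole. The radius cancels because the measure is at least \<kappa>
      times the radius.\<close>
    have 2: "\<kappa> * (\<tau> - s) \<le> drift_K * \<nu> \<sigma> \<tau>" if s: "\<sigma> < s" "s < \<tau>" for s
    proof -
      have "s \<notin> S" using up[of s] s by auto
      then have le: "measure M (?B \<inter> {z. s < w z}) \<le> (1 - ann_c) * measure M ?B" using s \<sigma> by (auto simp: S_def)
      have "measure M ?B = measure M (?B \<inter> {z. s < w z}) + measure M (?B \<inter> {z. w z \<le> s})"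
        by (rule measure_ball_split) (rule wc)
      then have Z: "ann_c * measure M ?B \<le> measure M (?B \<inter> {z. w z \<le> s})" using le by (simp add: algebra_simps)
      have "measure M ?B \<le> Cd * measure M (ball x (\<rho> / 2))" using measure_ball_double[of "\<rho> / 2" x] \<rho> by simp
      then have "ann_c * measure M ?B \<le> ann_c * (Cd * measure M (ball x (\<rho> / 2)))" using ann_c by (intro mult_left_mono) auto
      also have "\<dots> \<le> (1 - ann_c) * measure M (ball x (\<rho> / 2))"
        unfolding mult.assoc[symmetric] using ann_c by (intro mult_right_mono) auto
      also have "\<dots> \<le> measure M (ball x (\<rho> / 2) \<inter> {z. \<tau> < w z})" using Suc.prems(3) unfolding \<rho> by simp
      finally have Z': "ann_c * measure M ?B \<le> measure M (ball x (\<rho> / 2) \<inter> {z. \<tau> < w z})" .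
      have "(\<tau> - s) * (ann_c * measure M ?B) \<le> 2 * CP * \<rho> * energy h {z. s < w z \<and> w z < \<tau>}"
        by (rule truncation_oscillation[OF w hC E s(2) \<rho>(1) _ _ _ Z _ _ _ Z']) (use \<rho> in auto)
      moreover have "\<kappa> * \<rho> \<le> measure M ?B" using \<kappa>(2)[of i] Suc.prems by (simp add: \<rho>_def)
      then have "(\<tau> - s) * (ann_c * (\<kappa> * \<rho>)) \<le> (\<tau> - s) * (ann_c * measure M ?B)"
        using s ann_c by (intro mult_left_mono) auto
      ultimately have "(\<tau> - s) * (ann_c * (\<kappa> * \<rho>)) \<le> 2 * CP * \<rho> * \<nu> s \<tau>" by (simp add: \<nu>_def)
      then have "\<rho> * ((\<tau> - s) * (ann_c * \<kappa>)) \<le> \<rho> * (2 * CP * \<nu> s \<tau>)" by (simp only: ac_simps)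
      then have "(\<tau> - s) * (ann_c * \<kappa>) \<le> 2 * CP * \<nu> s \<tau>" using \<rho>(1) by (rule mult_left_le_imp_le)
      then have "\<kappa> * (\<tau> - s) \<le> drift_K * \<nu> s \<tau>" using ann_c(1) by (simp add: drift_K_def field_simps)
      also have "\<dots> \<le> drift_K * \<nu> \<sigma> \<tau>" using s drift_K_pos by (intro mult_left_mono \<nu>_mono) auto
      finally show ?thesis .
    qed
    have 3: "\<kappa> * (\<tau> - \<sigma>) \<le> drift_K * \<nu> \<sigma> \<tau>"
    proof (rule field_le_epsilon)
      fix e :: real assume "e > 0"
      define s where "s = \<sigma> + min ((\<tau> - \<sigma>) / 2) (e / \<kappa>)"
      have "min ((\<tau> - \<sigma>) / 2) (e / \<kappa>) > 0" using \<open>\<sigma> < \<tau>\<close> \<open>e > 0\<close> \<kappa>(1) by simp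
      then have s: "\<sigma> < s" "s < \<tau>" "s - \<sigma> \<le> e / \<kappa>" using \<open>\<sigma> < \<tau>\<close>
          min.cobounded1[of "(\<tau> - \<sigma>) / 2" "e / \<kappa>"] min.cobounded2[of "(\<tau> - \<sigma>) / 2" "e / \<kappa>"]
        unfolding s_def diff_divide_distrib by linarith+
      have "\<kappa> * (s - \<sigma>) \<le> e" using s(3) \<kappa> by (simp add: field_simps)
      then show "\<kappa> * (\<tau> - \<sigma>) \<le> drift_K * \<nu> \<sigma> \<tau> + e" using 2[OF s(1,2)] by (simp add: algebra_simps)
    qed
    have "\<nu> 0 \<sigma> + \<nu> \<sigma> \<tau> \<le> \<nu> 0 \<tau>"
      unfolding \<nu>_def using \<sigma> by (intro energy_disjoint[OF hc E]) auto
    then have "drift_K * \<nu> 0 \<sigma> + drift_K * \<nu> \<sigma> \<tau> \<le> drift_K * \<nu> 0 \<tau>"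
      using drift_K_pos by (simp flip: distrib_left)
    then show ?thesis using 1 3 by (simp add: \<nu>_def algebra_simps)
  qed
qed

text \<open>By the drift bound, small E prevents w > 1/12 on most of the ball. A constant m > 1/6
  would then deviate from w by 1/12 on a fraction \<open>ann_c\<close>, again contradicting the
  smallness of E. With m \<le> 1/6 one has \<open>clip (6 * w z - 1)\<close> \<le> 6 * |w z - m|,
  and Poincare bounds the integral of the right side.\<close>

lemma ball_average_bound:
  fixes x :: 'a
  assumes w: "lip_pair w h" "\<And>z. 0 \<le> w z" "\<And>z. w z \<le> 1" and hC: "\<And>z. h z \<le> C"
    and E: "(\<integral>\<^sup>+z. ennreal (h z) \<partial>M) \<le> ennreal E" "0 \<le> E"
    and R: "R > 0" and \<kappa>: "\<kappa> > 0" "\<And>i. i \<le> l \<Longrightarrow> \<kappa> * (R / 2 ^ i) \<le> measure M (ball x (R / 2 ^ i))"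
    and Z0: "Z0 \<in> sets M" "Z0 \<subseteq> ball x R" "ann_c * measure M (ball x R) \<le> measure M Z0" "\<And>z. z \<in> Z0 \<Longrightarrow> w z = 0"
    and small: "12 * (drift_K * E) < \<kappa>"
  shows "(\<integral>\<^sup>+z\<in>ball x (R / 2 ^ l). ennreal (clip (6 * w z - 1)) \<partial>M) \<le>
    ennreal (6 * CP * (R / 2 ^ l)) * (\<integral>\<^sup>+z\<in>ball x (lam * (R / 2 ^ l)). ennreal (h z) \<partial>M)"
proof -
  have wc: "continuous_on UNIV w" and hc: "continuous_on UNIV h"
    using lip_pair_continuous[OF w(1)] lip_pair_grad_continuous[OF w(1)] by auto
  note lev [simp] = level_sets_M[OF wc]
  define \<rho> where "\<rho> = R / 2 ^ l"
  have \<rho>: "\<rho> > 0" using R by (simp add: \<rho>_def)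
  let ?B = "ball x \<rho>"
  have "\<not> (1 - ann_c) * measure M ?B < measure M (?B \<inter> {z. 1/12 < w z})"
  proof
    assume "(1 - ann_c) * measure M ?B < measure M (?B \<inter> {z. 1/12 < w z})"
    then have "\<kappa> * (1/12) \<le> drift_K * energy h {z. 0 < w z \<and> w z < 1/12}"
      by (intro level_drift[OF w(1) hC E(1) R \<kappa> Z0, of l l]) (auto simp: \<rho>_def)
    also have "\<dots> \<le> drift_K * E"
      using drift_K_pos lev(3)[of 0 "1/12"] by (intro mult_left_mono energy_le[OF hc E]) (auto simp del: lev)
    finally show False using small by simp
  qed
  moreover have "measure M ?B = measure M (?B \<inter> {z. 1/12 < w z}) + measure M (?B \<inter> {z. w z \<le> 1/12})"
    by (rule measure_ball_split) (rule wc)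
  ultimately have Z: "ann_c * measure M ?B \<le> measure M (?B \<inter> {z. w z \<le> 1/12})" by (simp add: algebra_simps)
  obtain m where m: "(\<integral>\<^sup>+z\<in>?B. ennreal \<bar>w z - m\<bar> \<partial>M) \<le>
      ennreal (CP * \<rho>) * (\<integral>\<^sup>+z\<in>ball x (lam * \<rho>). ennreal (h z) \<partial>M)"
    by (rule poincare_lip_pair[OF w(1) _ \<rho>, of 1 x]) (use w in auto)
  also have "\<dots> \<le> ennreal (CP * \<rho>) * ennreal E"
    by (intro mult_left_mono order_trans[OF _ E(1)] nn_integral_mono) (auto simp: indicator_def)
  also have "\<dots> = ennreal (CP * \<rho> * E)" using CP \<rho> E by (simp add: ennreal_mult)
  finally have D: "(\<integral>\<^sup>+z\<in>?B. ennreal \<bar>w z - m\<bar> \<partial>M) \<le> ennreal (CP * \<rho> * E)" .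
  have "m \<le> 1/6"
  proof (rule ccontr)
    assume "\<not> m \<le> 1/6"
    then have "1/12 * measure M (?B \<inter> {z. w z \<le> 1/12}) \<le> CP * \<rho> * E"
      using CP \<rho> E lev(1)[of "1/12"] by (intro deviation_bound[OF D]) (auto simp del: lev)
    then have "ann_c * measure M ?B \<le> 12 * (CP * \<rho> * E)" using Z by simp
    moreover have "ann_c * (\<kappa> * \<rho>) \<le> ann_c * measure M ?B"
      using \<kappa>(2)[of l] ann_c(1) by (intro mult_left_mono) (simp_all add: \<rho>_def)
    ultimately have "ann_c * \<kappa> * \<rho> \<le> 12 * CP * E * \<rho>" by (simp add: ac_simps)
    then have "ann_c * \<kappa> \<le> 12 * CP * E" using \<rho> by simp
    moreover have "12 * (2 * CP * E) < ann_c * \<kappa>" using small ann_c by (simp add: drift_K_def field_simps)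
    moreover have "0 \<le> CP * E" using CP E by simp
    ultimately show False by simp
  qed
  note [measurable] = continuous_measurable_M[OF wc]
  from \<open>m \<le> 1/6\<close> have "(\<integral>\<^sup>+z\<in>?B. ennreal (clip (6 * w z - 1)) \<partial>M) \<le> (\<integral>\<^sup>+z. ennreal 6 * (ennreal \<bar>w z - m\<bar> * indicator ?B z) \<partial>M)"
  proof (intro nn_integral_mono)
    fix z
    have "clip (6 * w z - 1) \<le> 6 * \<bar>w z - m\<bar>" using \<open>m \<le> 1/6\<close> by (auto simp: clip_def min_def max_def abs_if)
    then have "ennreal (clip (6 * w z - 1)) \<le> ennreal 6 * ennreal \<bar>w z - m\<bar>"
      by (subst ennreal_mult[symmetric]) (auto intro: ennreal_leI)
    then show "ennreal (clip (6 * w z - 1)) * indicator ?B z \<le> ennreal 6 * (ennreal \<bar>w z - m\<bar> * indicator ?B z)"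
      by (auto simp: indicator_def)
  qed
  also have "\<dots> = ennreal 6 * (\<integral>\<^sup>+z\<in>?B. ennreal \<bar>w z - m\<bar> \<partial>M)"
    by (rule nn_integral_cmult) measurable
  also have "\<dots> \<le> ennreal 6 * (ennreal (CP * \<rho>) * (\<integral>\<^sup>+z\<in>ball x (lam * \<rho>). ennreal (h z) \<partial>M))"
    by (intro mult_left_mono m) simp
  also have "\<dots> = ennreal (6 * CP * \<rho>) * (\<integral>\<^sup>+z\<in>ball x (lam * \<rho>). ennreal (h z) \<partial>M)"
    using CP \<rho> by (simp add: ennreal_mult mult.assoc)
  finally show ?thesis by (simp add: \<rho>_def)
qed

end

section \<open>Thin neighbourhoods from small families\<close>

lemma tendsto_zero_ennrealI:
  fixes f :: "'b \<Rightarrow> ennreal"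
  assumes "\<And>\<delta>. \<delta> > 0 \<Longrightarrow> \<forall>\<^sub>F z in F. f z \<le> ennreal \<delta>"
  shows "(f \<longlongrightarrow> 0) F"
proof (rule order_tendstoI)
  fix a :: ennreal assume "0 < a"
  then obtain e where e: "0 < e" "e < a" using dense by blast
  then have "e < top" by (meson less_le_trans top_greatest)
  then obtain \<delta> where \<delta>: "e = ennreal \<delta>" "0 \<le> \<delta>" by (cases e) auto
  then have "\<delta> > 0" using e by (auto simp: less_le)
  from assms[OF this] show "\<forall>\<^sub>F z in F. f z < a"
    by eventually_elim (use e \<delta> in auto)
qed simp

lemma upper_gradient_imp_weak:
  assumes "upper_gradient UNIV u g"
  shows "weak_upper_gradient M D u g"
proof -
  have "zero_mod1 M {}" unfolding zero_mod1_def by (intro exI[of _ "\<lambda>_. 0"]) auto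
  then show ?thesis
    using assms unfolding weak_upper_gradient_def upper_gradient_def adm_curve_def by blast
qed

text \<open>Pointwise increasing limits preserve the upper gradient inequality curve by curve, so no
  exceptional family arises.\<close>

lemma sup_lip_pairs:
  fixes e :: "nat \<Rightarrow> 'a::metric_space \<Rightarrow> real"
  assumes e: "\<And>n. lip_pair (e n) (k n)" "\<And>n y. 0 \<le> e n y" "\<And>n y. e n y \<le> 1" "\<And>n y. e n y \<le> e (Suc n) y"
    and g: "\<And>n y. ennreal (k n y) \<le> g y" "g \<in> borel_measurable borel"
  defines "u \<equiv> \<lambda>y. SUP n. e n y"
  shows "upper_gradient UNIV u g" "u \<in> borel_measurable borel" "\<And>y. 0 \<le> u y" "\<And>y. u y \<le> 1" "\<And>n y. e n y \<le> u y"
proof -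
  have bdd: "bdd_above (range (\<lambda>n. e n y))" for y using e(3) by (auto intro!: bdd_aboveI[of _ 1])
  show eu: "e n y \<le> u y" for n y unfolding u_def using bdd by (intro cSUP_upper) auto
  show "0 \<le> u y" for y using e(2)[of 0 y] eu[of 0 y] by linarith
  show "u y \<le> 1" for y unfolding u_def by (intro cSUP_least e) auto
  have lim: "(\<lambda>n. e n y) \<longlonglongrightarrow> u y" for y
    unfolding u_def by (intro LIMSEQ_incseq_SUP bdd) (simp add: incseq_Suc_iff e)
  show "u \<in> borel_measurable borel"
    by (rule borel_measurable_LIMSEQ_real[OF lim]) (intro borel_measurable_continuous_onI lip_pair_continuous[OF e(1)])
  show "upper_gradient UNIV u g"
    unfolding upper_gradient_def
  proof (intro conjI allI impI g(2))
    fix \<gamma> :: "real \<Rightarrow> 'a" assume adm: "adm_curve UNIV \<gamma>"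
    have "(\<lambda>n. ennreal \<bar>e n (\<gamma> 0) - e n (\<gamma> 1)\<bar>) \<longlonglongrightarrow> ennreal \<bar>u (\<gamma> 0) - u (\<gamma> 1)\<bar>"
      by (intro tendsto_intros lim)
    moreover have "ennreal \<bar>e n (\<gamma> 0) - e n (\<gamma> 1)\<bar> \<le> line_integral g \<gamma>" for n
    proof -
      have "ennreal \<bar>e n (\<gamma> 0) - e n (\<gamma> 1)\<bar> \<le> line_integral (\<lambda>y. ennreal (k n y)) \<gamma>"
        using lip_pair_upper_gradient[OF e(1)] adm unfolding upper_gradient_def by blast
      also have "\<dots> \<le> line_integral g \<gamma>"
        unfolding line_integral_def by (intro nn_integral_mono mult_right_mono g) simp
      finally show ?thesis .
    qed
    ultimately show "ennreal \<bar>u (\<gamma> 0) - u (\<gamma> 1)\<bar> \<le> line_integral g \<gamma>"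
      using LIMSEQ_le_const2 by blast
  qed
qed

context pi_space
begin

lemma N011I:
  fixes x :: 'a
  assumes u: "u \<in> borel_measurable borel" "\<And>y. 0 \<le> u y" "\<And>y. u y \<le> 1" "\<And>y. y \<notin> D \<Longrightarrow> u y = 0"
    and D: "D \<subseteq> ball x \<rho>" and g: "upper_gradient UNIV u g" "(\<integral>\<^sup>+y. g y \<partial>M) < \<infinity>"
  shows "u \<in> N011 M D"
proof -
  have "(\<integral>\<^sup>+ z\<in>UNIV. ennreal \<bar>u z\<bar> \<partial>M) \<le> (\<integral>\<^sup>+ z. indicator (ball x \<rho>) z \<partial>M)"
  proof (rule nn_integral_mono)
    fix z
    show "ennreal \<bar>u z\<bar> * indicator UNIV z \<le> indicator (ball x \<rho>) z"
    proof (cases "z \<in> ball x \<rho>")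
      case False
      then have "u z = 0" using D u(4) by blast
      then show ?thesis by simp
    qed (use u(2,3)[of z] in simp)
  qed
  also have "\<dots> < \<infinity>" using emeasure_ball_finite[of x \<rho>] by simp
  finally have "(\<integral>\<^sup>+ z\<in>UNIV. ennreal \<bar>u z\<bar> \<partial>M) < \<infinity>" .
  moreover have "(INF g \<in> {g. weak_upper_gradient M UNIV u g}. \<integral>\<^sup>+ z\<in>UNIV. g z \<partial>M) \<le> (\<integral>\<^sup>+y. g y \<partial>M)"
    by (rule INF_lower2[of g]) (auto intro: upper_gradient_imp_weak g)
  ultimately have "N11_norm M UNIV u < \<infinity>"
    using g(2) unfolding N11_norm_def by (auto intro: le_less_trans)
  then show ?thesis using measurable_M[OF u(1)] u(4) by (simp add: N011_def N11_def)
qed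

definition has_thin_neighbourhood :: "'a \<Rightarrow> 'a set \<Rightarrow> bool" where
  "has_thin_neighbourhood x A \<longleftrightarrow> (\<exists>R>0. \<exists>G V \<eta>. open G \<and> open V \<and> G \<subseteq> V \<and> \<eta> \<in> N011 M V \<and>
           A \<inter> ball x R \<subseteq> G \<and> thin1 M V x \<and>
           (\<forall>y. 0 \<le> \<eta> y \<and> \<eta> y \<le> 1) \<and> (\<forall>y\<in>G. \<eta> y = 1) \<and>
           ((\<lambda>r. ennreal r / emeasure M (ball x r) * N11_norm M (ball x r) \<eta>) \<longlongrightarrow> 0) (at_right 0))"

text \<open>The supremum f of the family is lower semicontinuous, so {f > 1/3} and {f > 2/3} are
  open, and 3 * f - 1 clipped is 0 off the former and 1 on the latter. Its L1 norm on B(x, r) is at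
  most the measure of the ball, which after multiplication by r / \<mu>(B(x, r)) leaves r. For the
  capacity of \<open>V\<close> the competitor is 3 * f clipped, times a cutoff; its gradient
  involves f / r, which is why the averages of f must be small as well.\<close>

lemma thin_neighbourhood_from_family:
  fixes x :: 'a and f H :: "nat \<Rightarrow> 'a \<Rightarrow> real"
  assumes fH: "\<And>n. lip_pair (f n) (H n)" and f01: "\<And>n y. 0 \<le> f n y" "\<And>n y. f n y \<le> 1"
    and finc: "\<And>n y. f n y \<le> f (Suc n) y"
    and supp: "\<And>n y. y \<notin> ball x \<rho> \<Longrightarrow> f n y = 0"
    and A: "\<And>y. y \<in> A \<inter> ball x R \<Longrightarrow> \<exists>n. 2/3 < f n y" and R: "R > 0"
    and total: "(\<integral>\<^sup>+y. (SUP n. ennreal (H n y)) \<partial>M) < \<infinity>"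
    and smallH: "\<And>\<delta>. \<delta> > 0 \<Longrightarrow> \<forall>\<^sub>F r in at_right 0.
      (\<integral>\<^sup>+y\<in>ball x r. (SUP n. ennreal (H n y)) \<partial>M) \<le> ennreal (\<delta> * (measure M (ball x r) / r))"
    and smallf: "\<And>\<delta>. \<delta> > 0 \<Longrightarrow> \<forall>\<^sub>F r in at_right 0.
      (\<integral>\<^sup>+y\<in>ball x r. (SUP n. ennreal (f n y)) \<partial>M) \<le> ennreal (\<delta> * measure M (ball x r))"
  shows "has_thin_neighbourhood x A"
proof -
  define Hs where "Hs = (\<lambda>y. SUP n. ennreal (H n y))"
  define Fs where "Fs = (\<lambda>y. SUP n. ennreal (f n y))"
  have fc: "continuous_on UNIV (f n)" and Hc: "continuous_on UNIV (H n)" for n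
    using lip_pair_continuous[OF fH] lip_pair_grad_continuous[OF fH] by auto
  have Hsb [measurable]: "Hs \<in> borel_measurable borel"
    unfolding Hs_def by (intro borel_measurable_SUP measurable_compose[OF _ measurable_ennreal] borel_measurable_continuous_onI Hc) simp
  have Fsb [measurable]: "Fs \<in> borel_measurable borel"
    unfolding Fs_def by (intro borel_measurable_SUP measurable_compose[OF _ measurable_ennreal] borel_measurable_continuous_onI fc) simp
  note HsM [measurable] = measurable_M[OF Hsb] measurable_M[OF Fsb]
  define V where "V = (\<Union>n. {y. 1/3 < f n y})"
  define G where "G = (\<Union>n. {y. 2/3 < f n y})"
  have "open V" "open G"
    unfolding V_def G_def by (intro open_UN ballI open_Collect_less continuous_intros fc)+
  have "G \<subseteq> V" unfolding G_def V_def by (intro UN_mono) auto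
  have AG: "A \<inter> ball x R \<subseteq> G" using A by (auto simp: G_def)
  define e where "e = (\<lambda>n y. clip (3 * f n y - 1))"
  define \<eta> where "\<eta> = (\<lambda>y. SUP n. e n y)"
  have "lip_pair (e n) (\<lambda>y. 3 * H n y)" for n unfolding e_def by (intro lip_pair_clip fH) simp
  moreover have "e n y \<le> e (Suc n) y" for n y unfolding e_def by (intro clip_mono) (use finc[of n y] in simp)
  moreover have "ennreal (3 * H n y) \<le> 3 * Hs y" for n y
    unfolding Hs_def by (simp add: ennreal_mult') (intro mult_left_mono SUP_upper; simp)
  moreover have "(\<lambda>y. 3 * Hs y) \<in> borel_measurable borel" by measurable
  ultimately have \<eta>: "upper_gradient UNIV \<eta> (\<lambda>y. 3 * Hs y)" "\<eta> \<in> borel_measurable borel"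
    "\<And>y. 0 \<le> \<eta> y" "\<And>y. \<eta> y \<le> 1" "\<And>n y. e n y \<le> \<eta> y"
    unfolding \<eta>_def using sup_lip_pairs[of e "\<lambda>n y. 3 * H n y" "\<lambda>y. 3 * Hs y"] by (simp_all add: e_def)
  have \<eta>0: "\<eta> y = 0" if "y \<notin> V" for y
  proof -
    have le: "f n y \<le> 1 / 3" for n using that by (auto simp: V_def not_less)
    have "e n y = 0" for n unfolding e_def by (rule clip_eq_0) (use le[of n] in simp)
    then show ?thesis by (simp add: \<eta>_def)
  qed
  have "V \<subseteq> ball x \<rho>"
  proof
    fix y assume "y \<in> V"
    then obtain n where "1/3 < f n y" by (auto simp: V_def)
    then show "y \<in> ball x \<rho>" using supp[of y n] by (cases "y \<in> ball x \<rho>") auto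
  qed
  have int3: "(\<integral>\<^sup>+y. 3 * Hs y \<partial>M) < \<infinity>"
    using total by (simp add: nn_integral_cmult Hs_def[symmetric] ennreal_mult_less_top)
  have \<eta>N: "\<eta> \<in> N011 M V"
    by (rule N011I[OF \<eta>(2-4) \<eta>0 \<open>V \<subseteq> ball x \<rho>\<close> \<eta>(1) int3])
  have \<eta>1: "\<eta> y = 1" if "y \<in> G" for y
  proof -
    obtain n where "2/3 < f n y" using \<open>y \<in> G\<close> by (auto simp: G_def)
    then have "e n y = 1" unfolding e_def by (intro clip_eq_1) simp
    then show ?thesis using \<eta>(4)[of y] \<eta>(5)[of n y] by simp
  qed
  have pos: "\<forall>\<^sub>F r in at_right 0. (0::real) < r" by (rule eventually_at_right_less)
  have norm: "((\<lambda>r. ennreal r / emeasure M (ball x r) * N11_norm M (ball x r) \<eta>) \<longlongrightarrow> 0) (at_right 0)"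
  proof (rule tendsto_zero_ennrealI)
    fix \<delta> :: real assume "\<delta> > 0"
    then have "\<delta> / 6 > 0" by simp
    have "\<forall>\<^sub>F r in at_right 0. r \<in> {0<..<\<delta> / 2}" using \<open>\<delta> > 0\<close> by (intro eventually_at_right_real) simp
    with smallH[OF \<open>\<delta> / 6 > 0\<close>] pos
    show "\<forall>\<^sub>F r in at_right 0. ennreal r / emeasure M (ball x r) * N11_norm M (ball x r) \<eta> \<le> ennreal \<delta>"
    proof (eventually_elim)
      case (elim r)
      define m where "m = measure M (ball x r)"
      have m: "m > 0" unfolding m_def using elim by (intro measure_ball_pos)
      have "(\<integral>\<^sup>+ z\<in>ball x r. ennreal \<bar>\<eta> z\<bar> \<partial>M) \<le> (\<integral>\<^sup>+ z. indicator (ball x r) z \<partial>M)"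
        using \<eta>(3,4) by (intro nn_integral_mono) (auto simp: indicator_def)
      also have "\<dots> = ennreal m" by (simp add: m_def emeasure_ball_eq)
      finally have 1: "(\<integral>\<^sup>+ z\<in>ball x r. ennreal \<bar>\<eta> z\<bar> \<partial>M) \<le> ennreal m" .
      have "(INF g \<in> {g. weak_upper_gradient M (ball x r) \<eta> g}. \<integral>\<^sup>+ z\<in>ball x r. g z \<partial>M) \<le> (\<integral>\<^sup>+y\<in>ball x r. 3 * Hs y \<partial>M)"
        by (rule INF_lower) (auto intro: upper_gradient_imp_weak \<eta>)
      also have "\<dots> = 3 * (\<integral>\<^sup>+y\<in>ball x r. Hs y \<partial>M)"
        by (simp add: mult.assoc nn_integral_cmult)
      also have "\<dots> \<le> ennreal 3 * ennreal (\<delta> / 6 * (m / r))" using elim by (auto simp: Hs_def m_def intro!: mult_left_mono)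
      also have "\<dots> = ennreal (\<delta> / 2 * (m / r))" using m elim \<open>\<delta> > 0\<close> by (subst ennreal_mult[symmetric]) auto
      finally have "N11_norm M (ball x r) \<eta> \<le> ennreal (m + \<delta> / 2 * (m / r))"
        unfolding N11_norm_def using 1 m elim \<open>\<delta> > 0\<close> by (subst ennreal_plus) (auto intro: add_mono)
      then have "ennreal r / emeasure M (ball x r) * N11_norm M (ball x r) \<eta> \<le> ennreal (r / m) * ennreal (m + \<delta> / 2 * (m / r))"
        using m elim by (auto simp: emeasure_ball_eq m_def[symmetric] divide_ennreal intro!: mult_left_mono)
      also have "\<dots> = ennreal (r + \<delta> / 2)"
        using m elim \<open>\<delta> > 0\<close> by (subst ennreal_mult[symmetric]) (auto simp: field_simps)
      also have "\<dots> \<le> ennreal \<delta>" using elim by (intro ennreal_leI) auto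
      finally show ?case .
    qed
  qed
  have thin: "thin1 M V x"
    unfolding thin1_def
  proof (rule tendsto_zero_ennrealI)
    fix \<delta> :: real assume "\<delta> > 0"
    \<comment> \<open>Gradients of the competitors live in B(x, 4r), whose measure is at most Cd ^ 2
      times that of B(x, r); the 4 absorbs the coefficients 3/4 and 3.\<close>
    define \<epsilon> where "\<epsilon> = \<delta> / (4 * Cd ^ 2)"
    have \<epsilon>: "\<epsilon> > 0" using \<open>\<delta> > 0\<close> Cd by (simp add: \<epsilon>_def)
    have ten: "filterlim (\<lambda>r::real. 4 * r) (at_right 0) (at_right 0)"
    proof (rule filterlim_at_withinI)
      show "((*) 4 \<longlongrightarrow> 0) (at_right (0::real))"
        using tendsto_mult_right_zero[OF tendsto_ident_at, of 4 "{0<..}"] by simp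
      show "\<forall>\<^sub>F r in at_right 0. 4 * r \<in> {0<..} - {0::real}" using pos by eventually_elim auto
    qed
    have e1: "\<forall>\<^sub>F r in at_right 0. (\<integral>\<^sup>+y\<in>ball x (4 * r). Hs y \<partial>M) \<le> ennreal (\<epsilon> * (measure M (ball x (4 * r)) / (4 * r)))"
      using eventually_compose_filterlim[OF smallH[OF \<epsilon>] ten] by (simp add: Hs_def)
    have e2: "\<forall>\<^sub>F r in at_right 0. (\<integral>\<^sup>+y\<in>ball x (4 * r). Fs y \<partial>M) \<le> ennreal (\<epsilon> * measure M (ball x (4 * r)))"
      using eventually_compose_filterlim[OF smallf[OF \<epsilon>] ten] by (simp add: Fs_def)
    from e1 e2 pos
    show "\<forall>\<^sub>F r in at_right 0. ennreal r * cap1 M (V \<inter> ball x r) (ball x (2 * r)) / emeasure M (ball x r) \<le> ennreal \<delta>"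
    proof eventually_elim
      case (elim r)
      then have r: "r > 0" by simp
      define m where "m = measure M (ball x r)"
      define m4 where "m4 = measure M (ball x (4 * r))"
      have m: "m > 0" "m4 \<ge> 0" "m4 \<le> Cd ^ 2 * m"
        using measure_ball_pos[OF r, of x] measure_ball_double_power[OF r, of x 2] by (auto simp: m_def m4_def)
      \<comment> \<open>\<theta> is the cutoff, 1 on B(x, r) and 0 off B(x, 2r). \<beta> is 1 up to
        distance 3r, hence on the r-neighbourhood of B(x, 2r), and 0 off B(x, 4r); it confines the
        gradient.\<close>
      define \<theta> where "\<theta> = (\<lambda>y. clip (2 - dist x y / r))"
      define \<beta> where "\<beta> = (\<lambda>y. clip (4 - dist x y / r))"
      \<comment> \<open>Subtracting 0 matches the shape of \<open>lip_pair_clip\<close>.\<close>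
      define v where "v = (\<lambda>n y. \<theta> y * clip (3 * f n y - 0))"
      define k where "k = (\<lambda>n y. 3 * H n y * \<beta> y + 1 / r * clip (3 * f n y - 0) * \<beta> y)"
      define g where "g = (\<lambda>y. (3 * Hs y + ennreal (3 / r) * Fs y) * indicator (ball x (4 * r)) y)"
      define u where "u = (\<lambda>y. SUP n. v n y)"
      have \<beta>1: "\<beta> y = 1" if "dist x y \<le> 3 * r" for y using that r by (simp add: \<beta>_def clip_def field_simps)
      have \<beta>0: "\<beta> y = 0" if "y \<notin> ball x (4 * r)" for y using that r by (simp add: \<beta>_def clip_def field_simps)
      have \<beta>c: "continuous_on UNIV \<beta>" unfolding \<beta>_def using r by (intro continuous_intros) auto
      have \<theta>0: "\<theta> y = 0" if "y \<notin> ball x (2 * r)" for y using that r by (simp add: \<theta>_def clip_def field_simps)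
      have \<theta>L: "\<bar>\<theta> a - \<theta> b\<bar> \<le> 1 / r * dist a b" for a b
      proof -
        have "\<bar>\<theta> a - \<theta> b\<bar> \<le> \<bar>(2 - dist x a / r) - (2 - dist x b / r)\<bar>" unfolding \<theta>_def by (rule clip_lipschitz)
        also have "\<dots> = \<bar>dist x b - dist x a\<bar> / r" using r by (simp flip: diff_divide_distrib)
        also have "\<dots> \<le> dist a b / r"
          using r dist_triangle[of x b a] dist_triangle[of x a b] by (intro divide_right_mono) (auto simp: dist_commute abs_le_iff)
        finally show ?thesis by simp
      qed
      have "lip_pair (v n) (k n)" for n
        unfolding v_def k_def
      proof (rule lip_pair_cutoff[where \<delta> = r])
        show "lip_pair (\<lambda>y. clip (3 * f n y - 0)) (\<lambda>y. 3 * H n y)" by (intro lip_pair_clip fH) simp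
        fix a b :: 'a assume ab: "dist a b < r"
        show "1 \<le> \<beta> a" if "\<theta> b \<noteq> 0"
          using \<theta>0[of b] that ab dist_triangle[of x a b] \<beta>1[of a] by (cases "b \<in> ball x (2 * r)") (auto simp: dist_commute)
        show "1 \<le> \<beta> a" if "\<theta> a \<noteq> \<theta> b"
        proof -
          have "a \<in> ball x (2 * r) \<or> b \<in> ball x (2 * r)" using \<theta>0[of a] \<theta>0[of b] that by metis
          then have "dist x a \<le> 3 * r" using ab dist_triangle[of x a b] r by (auto simp: dist_commute)
          then show ?thesis using \<beta>1 by simp
        qed
      qed (use r \<theta>L \<beta>c in \<open>auto simp: \<theta>_def \<beta>_def\<close>)
      moreover have "0 \<le> v n y" "v n y \<le> 1" for n y unfolding v_def \<theta>_def by (auto intro: mult_le_one)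
      moreover have "v n y \<le> v (Suc n) y" for n y
        unfolding v_def using finc[of n y] by (intro mult_left_mono clip_mono) (auto simp: \<theta>_def)
      moreover have "ennreal (k n y) \<le> g y" for n y
      proof (cases "y \<in> ball x (4 * r)")
        case False
        then show ?thesis using \<beta>0 by (simp add: k_def)
      next
        case True
        have H0: "0 \<le> H n y" using lip_pair_grad_nonneg[OF fH] .
        have "k n y \<le> 3 * H n y * 1 + 1 / r * clip (3 * f n y - 0) * 1"
          unfolding k_def using H0 r by (intro add_mono mult_left_mono) (auto simp: \<beta>_def)
        also have "\<dots> \<le> 3 * H n y + 3 / r * f n y"
          using f01[of n y] r by (auto simp: clip_def field_simps)
        finally have "ennreal (k n y) \<le> ennreal (3 * H n y + 3 / r * f n y)" by (rule ennreal_leI)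
        also have "\<dots> = ennreal (3 * H n y) + ennreal (3 / r * f n y)"
          using H0 f01[of n y] r by (intro ennreal_plus) auto
        also have "\<dots> = ennreal 3 * ennreal (H n y) + ennreal (3 / r) * ennreal (f n y)"
          using H0 f01[of n y] r by (intro arg_cong2[where f = plus] ennreal_mult) auto
        also have "\<dots> \<le> 3 * Hs y + ennreal (3 / r) * Fs y"
          unfolding Hs_def Fs_def by (intro add_mono mult_mono SUP_upper) auto
        finally show ?thesis using True by (simp add: g_def)
      qed
      moreover have "g \<in> borel_measurable borel"
      proof -
        have "(\<lambda>y. indicator (ball x (4 * r)) y :: ennreal) \<in> borel_measurable borel"
          by (intro borel_measurable_indicator) simp
        then show ?thesis unfolding g_def
          by (intro borel_measurable_times_ennreal borel_measurable_add borel_measurable_const Hsb Fsb)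
      qed
      ultimately have u: "upper_gradient UNIV u g" "u \<in> borel_measurable borel"
        "\<And>y. 0 \<le> u y" "\<And>y. u y \<le> 1" "\<And>n y. v n y \<le> u y"
        unfolding u_def using sup_lip_pairs[of v k g] by auto
      have "(\<integral>\<^sup>+y. g y \<partial>M) = (\<integral>\<^sup>+y. 3 * (Hs y * indicator (ball x (4 * r)) y) + ennreal (3 / r) * (Fs y * indicator (ball x (4 * r)) y) \<partial>M)"
        by (simp add: g_def distrib_right mult.assoc)
      also have "\<dots> = 3 * (\<integral>\<^sup>+y\<in>ball x (4 * r). Hs y \<partial>M) + ennreal (3 / r) * (\<integral>\<^sup>+y\<in>ball x (4 * r). Fs y \<partial>M)"
        by (simp add: nn_integral_add nn_integral_cmult)
      also have "\<dots> \<le> ennreal 3 * ennreal (\<epsilon> * (m4 / (4 * r))) + ennreal (3 / r) * ennreal (\<epsilon> * m4)"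
        using elim by (intro add_mono mult_mono) (auto simp: m4_def)
      also have "\<dots> = ennreal (3 * (\<epsilon> * (m4 / (4 * r))) + 3 / r * (\<epsilon> * m4))"
        using r m \<epsilon> by (subst ennreal_plus; (subst ennreal_mult)?) (auto simp: ennreal_mult[symmetric])
      also have "\<dots> \<le> ennreal (4 * \<epsilon> * m4 / r)" using r m \<epsilon> by (intro ennreal_leI) (simp add: field_simps)
      also have "\<dots> \<le> ennreal (\<delta> * m / r)"
      proof (intro ennreal_leI divide_right_mono)
        have "4 * \<epsilon> * m4 \<le> 4 * \<epsilon> * (Cd ^ 2 * m)" using m \<epsilon> by (intro mult_left_mono) auto
        also have "\<dots> = \<delta> * m" using Cd by (simp add: \<epsilon>_def)
        finally show "4 * \<epsilon> * m4 \<le> \<delta> * m" .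
      qed (use r in simp)
      finally have gint: "(\<integral>\<^sup>+y. g y \<partial>M) \<le> ennreal (\<delta> * m / r)" .
      then have "(\<integral>\<^sup>+y. g y \<partial>M) < \<infinity>" by (rule le_less_trans) simp
      moreover have "u y = 0" if "y \<notin> ball x (2 * r)" for y using \<theta>0[OF that] by (simp add: u_def v_def)
      ultimately have uN: "u \<in> N011 M (ball x (2 * r))" by (intro N011I[OF u(2-4) _ order_refl u(1)])
      have u1: "1 \<le> u y" if "y \<in> V \<inter> ball x r" for y
      proof -
        obtain n where "1/3 < f n y" using \<open>y \<in> V \<inter> ball x r\<close> by (auto simp: V_def)
        moreover have "\<theta> y = 1" using that r by (simp add: \<theta>_def clip_def field_simps)
        ultimately have "v n y = 1" unfolding v_def by (simp add: clip_eq_1)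
        then show ?thesis using u(5)[of n y] by simp
      qed
      have "cap1 M (V \<inter> ball x r) (ball x (2 * r)) \<le> (\<integral>\<^sup>+y. g y \<partial>M)"
        unfolding cap1_def by (rule INF_lower2[of "(u, g)"]) (use uN u1 upper_gradient_imp_weak[OF u(1)] in auto)
      also note gint
      finally have "ennreal r * cap1 M (V \<inter> ball x r) (ball x (2 * r)) \<le> ennreal r * ennreal (\<delta> * m / r)"
        by (rule mult_left_mono) simp
      also have "\<dots> = ennreal (\<delta> * m)" using r m \<open>\<delta> > 0\<close> by (subst ennreal_mult[symmetric]) auto
      finally have "ennreal r * cap1 M (V \<inter> ball x r) (ball x (2 * r)) / emeasure M (ball x r) \<le> ennreal (\<delta> * m) / ennreal m"
        unfolding emeasure_ball_eq m_def[symmetric] by (rule divide_right_mono_ennreal)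
      also have "\<dots> = ennreal \<delta>" using m \<open>\<delta> > 0\<close> by (simp add: divide_ennreal)
      finally show ?case .
    qed
  qed
  show ?thesis unfolding has_thin_neighbourhood_def
    using R \<open>open G\<close> \<open>open V\<close> \<open>G \<subseteq> V\<close> \<eta>N AG thin \<eta>(3,4) \<eta>1 norm by (intro exI[of _ R] conjI exI[of _ G] exI[of _ V] exI[of _ \<eta>]) auto
qed

end

section \<open>Dyadic scales and blocks\<close>

text \<open>The second point z limits the scales from above: annuli about x are shown to carry mass
  only at radii small compared with \<open>dist x z\<close>.\<close>

locale pointed_pi_space = pi_space M Cd CP lam
  for M :: "'a::complete_space measure" and Cd CP lam +
  fixes x z :: 'a
  assumes x_neq_z: "x \<noteq> z"
begin

text \<open>Dyadic radii, the measures of the corresponding balls, and their codimension-one densities.\<close>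

definition rr :: "nat \<Rightarrow> real" where "rr l = (1/2) ^ l"
definition mm :: "nat \<Rightarrow> real" where "mm l = measure M (ball x (rr l))"
definition qq :: "nat \<Rightarrow> real" where "qq l = mm l / rr l"

lemma rr_pos [simp]: "0 < rr l" and rr_nonneg [simp]: "0 \<le> rr l" and rr_nonzero [simp]: "rr l \<noteq> 0"
  by (simp_all add: rr_def)

lemma rr_Suc: "rr (Suc l) = rr l / 2"
  by (simp add: rr_def)

lemma rr_add: "rr (l + i) = rr l / 2 ^ i"
  by (simp add: rr_def power_add power_one_over)

lemma rr_antimono: "k \<le> l \<Longrightarrow> rr l \<le> rr k"
  unfolding rr_def by (intro power_decreasing) auto

lemma rr_tendsto: "rr \<longlonglongrightarrow> 0"
  unfolding rr_def by (intro LIMSEQ_power_zero) simp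

lemma mm_pos [simp]: "0 < mm l"
  unfolding mm_def by (intro measure_ball_pos) simp

lemma qq_pos [simp]: "0 < qq l" and qq_nonneg [simp]: "0 \<le> qq l"
  by (simp_all add: qq_def less_imp_le)

lemma mm_eq: "mm l = qq l * rr l"
  using rr_pos[of l] by (simp add: qq_def)

lemma mm_le_Suc: "mm l \<le> Cd * mm (Suc l)"
  using measure_ball_double[of "rr (Suc l)" x] by (simp add: mm_def rr_Suc)

lemma qq_le_Suc: "qq l \<le> Cd * qq (Suc l)"
proof -
  have "mm l / rr l \<le> Cd * mm (Suc l) / rr l"
    using mm_le_Suc[of l] by (intro divide_right_mono) (auto intro: less_imp_le)
  also have "\<dots> \<le> Cd * qq (Suc l)"
    using Cd less_imp_le[OF mm_pos[of "Suc l"]] by (auto simp: qq_def rr_Suc intro!: divide_right_mono mult_left_mono)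
  finally show ?thesis by (simp add: qq_def)
qed

lemma qq_le_add: "qq l \<le> Cd ^ s * qq (l + s)"
proof (induction s)
  case (Suc s)
  have "Cd ^ s * qq (l + s) \<le> Cd ^ s * (Cd * qq (Suc (l + s)))"
    using Cd by (intro mult_left_mono qq_le_Suc) auto
  then show ?case using Suc by (simp add: ac_simps)
qed simp

lemma dyadic_scale:
  assumes "0 < r" "r < rr l0"
  obtains l where "l0 \<le> l" "rr (Suc l) \<le> r" "r < rr l"
proof -
  obtain N where "rr N < r"
    using order_tendstoD(2)[OF rr_tendsto assms(1)] by (auto simp: eventually_sequentially)
  define l' where "l' = (LEAST l. rr l \<le> r)"
  have l': "rr l' \<le> r" unfolding l'_def by (rule LeastI[of _ N]) (use \<open>rr N < r\<close> in simp)
  have "l0 < l'"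
  proof (rule ccontr)
    assume "\<not> l0 < l'"
    then have "rr l0 \<le> rr l'" by (intro rr_antimono) simp
    then show False using l' assms(2) by simp
  qed
  then obtain l where l: "l' = Suc l" "l0 \<le> l" by (cases l') auto
  have "\<not> rr l \<le> r" using not_less_Least[of l "\<lambda>l. rr l \<le> r"] l(1) unfolding l'_def by simp
  then show ?thesis using that[of l] l l' by simp
qed

text \<open>Comparing r with the next larger dyadic radius costs one doubling constant.\<close>

lemma eventually_small_from_dyadic:
  fixes I :: "real \<Rightarrow> ennreal"
  assumes mono: "\<And>s t. s \<le> t \<Longrightarrow> I s \<le> I t" and \<delta>: "0 \<le> \<delta>"
    and small: "\<And>l. l0 \<le> l \<Longrightarrow> I (rr l) \<le> ennreal (\<delta> * mm l)"
  shows "\<forall>\<^sub>F r in at_right 0. I r \<le> ennreal (Cd * \<delta> * measure M (ball x r))"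
proof -
  have "\<forall>\<^sub>F r in at_right 0. r \<in> {0<..<rr l0}" by (intro eventually_at_right_real) simp
  then show ?thesis
  proof eventually_elim
    case (elim r)
    then obtain l where l: "l0 \<le> l" "rr (Suc l) \<le> r" "r < rr l" using dyadic_scale by auto
    have "I r \<le> I (rr l)" using l by (intro mono) simp
    also have "\<dots> \<le> ennreal (\<delta> * mm l)" by (rule small) fact
    also have "\<delta> * mm l \<le> \<delta> * (Cd * mm (Suc l))" using \<delta> by (intro mult_left_mono mm_le_Suc)
    also have "\<dots> \<le> \<delta> * (Cd * measure M (ball x r))"
      unfolding mm_def using \<delta> Cd l by (intro mult_left_mono measure_mono_ball) auto
    also have "\<dots> = Cd * \<delta> * measure M (ball x r)" by simp
    finally show ?case by (simp add: ennreal_leI)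
  qed
qed

lemma eventually_small_from_dyadic_ratio:
  fixes I :: "real \<Rightarrow> ennreal"
  assumes mono: "\<And>s t. s \<le> t \<Longrightarrow> I s \<le> I t" and \<delta>: "0 \<le> \<delta>"
    and small: "\<And>l. l0 \<le> l \<Longrightarrow> I (rr l) \<le> ennreal (\<delta> * qq l)"
  shows "\<forall>\<^sub>F r in at_right 0. I r \<le> ennreal (Cd * \<delta> * (measure M (ball x r) / r))"
proof -
  have "\<forall>\<^sub>F r in at_right 0. r \<in> {0<..<rr l0}" by (intro eventually_at_right_real) simp
  then show ?thesis
  proof eventually_elim
    case (elim r)
    then obtain l where l: "l0 \<le> l" "rr (Suc l) \<le> r" "r < rr l" using dyadic_scale by auto
    have "I r \<le> I (rr l)" using l by (intro mono) simp
    also have "\<dots> \<le> ennreal (\<delta> * qq l)" by (rule small) fact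
    also have "\<delta> * qq l \<le> \<delta> * (Cd * (measure M (ball x r) / r))"
    proof (intro mult_left_mono \<delta>)
      have "mm l / rr l \<le> (Cd * measure M (ball x r)) / rr l"
      proof (rule divide_right_mono)
        have "mm l \<le> Cd * mm (Suc l)" by (rule mm_le_Suc)
        also have "\<dots> \<le> Cd * measure M (ball x r)"
          unfolding mm_def using Cd l by (intro mult_left_mono measure_mono_ball) auto
        finally show "mm l \<le> Cd * measure M (ball x r)" .
      qed (simp add: less_imp_le)
      also have "\<dots> \<le> (Cd * measure M (ball x r)) / r"
        using Cd l elim by (intro divide_left_mono) auto
      finally show "qq l \<le> Cd * (measure M (ball x r) / r)" by (simp add: qq_def)
    qed
    also have "\<delta> * (Cd * (measure M (ball x r) / r)) = Cd * \<delta> * (measure M (ball x r) / r)" by simp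
    finally show ?case by (simp add: ennreal_leI)
  qed
qed

text \<open>Each small dyadic annulus takes a fixed fraction of its ball, so the measures of the
  dyadic balls decrease geometrically.\<close>

lemma measure_point_zero: "emeasure M {x} = 0"
proof -
  obtain l0 where l0: "\<And>l. l0 \<le> l \<Longrightarrow> rr l < dist x z / 8"
    using order_tendstoD(2)[OF rr_tendsto, of "dist x z / 8"] x_neq_z by (auto simp: eventually_sequentially)
  have step: "mm (l0 + Suc i) \<le> (1 - ann_c) * mm (l0 + i)" for i
  proof -
    have r: "rr (l0 + i) = 4 * rr (l0 + i + 2)" "rr (l0 + Suc i) = 2 * rr (l0 + i + 2)"
      by (simp_all add: rr_def)
    have "ann_c * measure M (ball x (4 * rr (l0 + i + 2))) \<le> measure M (ball x (4 * rr (l0 + i + 2)) - ball x (2 * rr (l0 + i + 2)))"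
      using l0[of "l0 + i + 2"] by (intro annulus_measure[where z = z]) auto
    also have "\<dots> = measure M (ball x (4 * rr (l0 + i + 2))) - measure M (ball x (2 * rr (l0 + i + 2)))"
      by (intro measurable_measure_Diff) (auto intro!: subset_ball)
    finally show ?thesis unfolding mm_def r by (simp add: algebra_simps)
  qed
  have pw: "mm (l0 + i) \<le> (1 - ann_c) ^ i * mm l0" for i
  proof (induction i)
    case (Suc i)
    have "mm (l0 + Suc i) \<le> (1 - ann_c) * mm (l0 + i)" by (rule step)
    also have "\<dots> \<le> (1 - ann_c) * ((1 - ann_c) ^ i * mm l0)" using Suc ann_c by (intro mult_left_mono) auto
    finally show ?case by (simp add: mult.assoc)
  qed simp
  have "(\<lambda>i. (1 - ann_c) ^ i * mm l0) \<longlonglongrightarrow> 0"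
    using ann_c by (intro tendsto_mult_left_zero LIMSEQ_power_zero) auto
  moreover have "measure M {x} \<le> (1 - ann_c) ^ i * mm l0" for i
    using pw[of i] measure_mono_ball[of "{x}" x "rr (l0 + i)"] by (simp add: mm_def)
  ultimately have "measure M {x} \<le> 0" by (intro LIMSEQ_le_const) auto
  moreover have "emeasure M {x} \<noteq> \<infinity>"
    using emeasure_mono[of "{x}" "ball x 1" M] emeasure_ball_finite[of x 1] by (auto simp: top_unique)
  ultimately show ?thesis using measure_nonneg[of M "{x}"] by (simp add: emeasure_eq_ennreal_measure)
qed

text \<open>Continuity from above of the measure with density g, which gives no mass to x. It serves
  the case of an infinite block, where smallness of the energy has to come from shrinking the
  ball.\<close>

lemma integral_shrinking_balls:
  assumes g: "g \<in> borel_measurable M" "(\<integral>\<^sup>+y. g y \<partial>M) < \<infinity>" and c: "0 < c" and \<delta>: "0 < \<delta>"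
  obtains l0 where "\<And>l. l0 \<le> l \<Longrightarrow> (\<integral>\<^sup>+y\<in>ball x (c * rr l). g y \<partial>M) \<le> ennreal \<delta>"
proof -
  let ?N = "density M g"
  have em: "emeasure ?N S = (\<integral>\<^sup>+y\<in>S. g y \<partial>M)" if "S \<in> sets M" for S
    using g that by (simp add: emeasure_density)
  have "(\<lambda>l. emeasure ?N (ball x (c * rr l))) \<longlonglongrightarrow> emeasure ?N (\<Inter>l. ball x (c * rr l))"
  proof (rule Lim_emeasure_decseq)
    show "decseq (\<lambda>l. ball x (c * rr l))"
      unfolding decseq_def using c rr_antimono by (auto intro!: subset_ball)
    fix l
    have "emeasure ?N (ball x (c * rr l)) \<le> (\<integral>\<^sup>+y. g y \<partial>M)"
      by (subst em) (auto intro!: nn_integral_mono simp: indicator_def)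
    then show "emeasure ?N (ball x (c * rr l)) \<noteq> \<infinity>" using g(2) by (auto simp: top_unique)
  qed auto
  moreover have "(\<Inter>l. ball x (c * rr l)) = {x}"
  proof -
    have "y = x" if y: "\<And>l. dist x y < c * rr l" for y
    proof -
      have "(\<lambda>l. c * rr l) \<longlonglongrightarrow> 0" using tendsto_mult_right_zero[OF rr_tendsto] .
      then have "dist x y \<le> 0" by (rule LIMSEQ_le_const) (use y in \<open>auto intro: less_imp_le\<close>)
      then show ?thesis by simp
    qed
    then show ?thesis using c by auto
  qed
  moreover have "emeasure ?N {x} = 0"
  proof -
    have "AE y in M. y \<notin> {x}" using measure_point_zero by (intro AE_not_in) (simp add: null_sets_def)
    then have "(\<integral>\<^sup>+y\<in>{x}. g y \<partial>M) = 0"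
      by (subst nn_integral_0_iff_AE) (use g in \<open>auto elim: eventually_mono\<close>)
    then show ?thesis by (subst em) auto
  qed
  ultimately have "(\<lambda>l. emeasure ?N (ball x (c * rr l))) \<longlonglongrightarrow> 0" by simp
  then have "\<forall>\<^sub>F l in sequentially. emeasure ?N (ball x (c * rr l)) < ennreal \<delta>"
    using \<delta> by (intro order_tendstoD) auto
  then obtain l0 where "\<And>l. l0 \<le> l \<Longrightarrow> emeasure ?N (ball x (c * rr l)) < ennreal \<delta>"
    by (auto simp: eventually_sequentially)
  then show ?thesis by (intro that[of l0]) (auto simp: em intro: less_imp_le)
qed

text \<open>The test function vanishes off B(x, 2 * \<open>rr j\<close>), so the annulus up to 4 *
  \<open>rr j\<close> is the zero set from which the drift starts. Starting there puts two scales in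
  front of the block, hence the shift by 2, and c \<le> 1/4 provides the density bound at these
  two.\<close>

lemma block_average:
  assumes w: "lip_pair w h" "\<And>y. 0 \<le> w y" "\<And>y. w y \<le> 1" and hC: "\<exists>C. \<forall>y. h y \<le> C"
    and E: "(\<integral>\<^sup>+y. ennreal (h y) \<partial>M) \<le> ennreal E" "0 \<le> E"
    and w0: "\<And>y. y \<notin> ball x (2 * rr j) \<Longrightarrow> w y = 0" and j: "8 * rr j < dist x z"
    and c: "0 < c" "c \<le> 1/4" "\<And>i. i \<le> n \<Longrightarrow> c * qq j \<le> qq (j + i)"
    and small: "12 * (drift_K * E) < c * qq j"
  shows "i \<le> n \<Longrightarrow> (\<integral>\<^sup>+y\<in>ball x (rr (j + i)). ennreal (clip (6 * w y - 1)) \<partial>M) \<le>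
      ennreal (6 * CP * rr (j + i)) * (\<integral>\<^sup>+y\<in>ball x (lam * rr (j + i)). ennreal (h y) \<partial>M)" (is "_ \<Longrightarrow> ?A")
    and "(\<integral>\<^sup>+y\<in>ball x (4 * rr j). ennreal (clip (6 * w y - 1)) \<partial>M) \<le> ennreal (6 * CP * (4 * rr j)) * ennreal E" (is ?B)
proof -
  obtain C where C: "\<And>y. h y \<le> C" using hC by blast
  define R where "R = 4 * rr j"
  have R: "R > 0" by (simp add: R_def)
  have Rrr: "R / 2 ^ (i + 2) = rr (j + i)" for i by (simp add: R_def rr_add power_add)
  have \<kappa>: "c * qq j * (R / 2 ^ i) \<le> measure M (ball x (R / 2 ^ i))" if "i \<le> n + 2" for i
  proof (cases "i < 2")
    case True
    then have le: "rr j \<le> R / 2 ^ i" "R / 2 ^ i \<le> 4 * rr j" by (auto simp: R_def less_2_cases_iff)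
    have "c * qq j * (R / 2 ^ i) \<le> 1/4 * qq j * (4 * rr j)"
      using c le by (intro mult_mono) (auto simp: less_imp_le intro: order_trans[OF _ le(1)])
    also have "\<dots> = mm j" by (simp add: mm_eq)
    also have "\<dots> \<le> measure M (ball x (R / 2 ^ i))"
      unfolding mm_def using le by (intro measure_mono_ball) auto
    finally show ?thesis .
  next
    case False
    then obtain i' where i': "i = i' + 2" using le_Suc_ex[of 2 i] by auto
    have "c * qq j * rr (j + i') \<le> qq (j + i') * rr (j + i')"
      using c(3)[of i'] that i' by (intro mult_right_mono) (auto simp: less_imp_le)
    then show ?thesis unfolding i' Rrr by (simp add: mm_def[symmetric] mm_eq)
  qed
  define Z where "Z = ball x R - ball x (2 * rr j)"
  have Z: "Z \<in> sets M" "Z \<subseteq> ball x R" "ann_c * measure M (ball x R) \<le> measure M Z" "\<And>y. y \<in> Z \<Longrightarrow> w y = 0"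
    using w0 annulus_measure[OF rr_pos j] by (auto simp: Z_def R_def)
  have \<kappa>0: "c * qq j > 0" using c by simp
  show ?A if "i \<le> n"
    using ball_average_bound[OF w C E R \<kappa>0, of "i + 2" x Z, OF _ Z small] \<kappa> that
    unfolding Rrr by auto
  have "?B \<longleftrightarrow> (\<integral>\<^sup>+y\<in>ball x (R / 2 ^ 0). ennreal (clip (6 * w y - 1)) \<partial>M) \<le> ennreal (6 * CP * (R / 2 ^ 0)) * ennreal E"
    by (simp add: R_def)
  moreover have "(\<integral>\<^sup>+y\<in>ball x (R / 2 ^ 0). ennreal (clip (6 * w y - 1)) \<partial>M) \<le>
    ennreal (6 * CP * (R / 2 ^ 0)) * (\<integral>\<^sup>+y\<in>ball x (lam * (R / 2 ^ 0)). ennreal (h y) \<partial>M)"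
    by (rule ball_average_bound[OF w C E R \<kappa>0 _ Z small]) (use \<kappa>[of 0] in auto)
  moreover have "(\<integral>\<^sup>+y\<in>ball x (lam * (R / 2 ^ 0)). ennreal (h y) \<partial>M) \<le> ennreal E"
    by (rule order_trans[OF _ E(1)]) (auto intro!: nn_integral_mono simp: indicator_def)
  ultimately show ?B by (meson mult_left_mono order_trans zero_le)
qed

section \<open>The test function of one block, cut off near x\<close>

definition inner_cut :: "nat \<Rightarrow> 'a \<Rightarrow> real" where "inner_cut k y = clip (dist x y / rr k - 1)"

lemma inner_cut_bounds [simp]: "0 \<le> inner_cut k y" "inner_cut k y \<le> 1"
  by (simp_all add: inner_cut_def)

lemma inner_cut_0: "dist x y \<le> rr k \<Longrightarrow> inner_cut k y = 0"
  unfolding inner_cut_def using rr_pos[of k] by (intro clip_eq_0) (simp add: field_simps)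

lemma inner_cut_1: "2 * rr k \<le> dist x y \<Longrightarrow> inner_cut k y = 1"
  unfolding inner_cut_def using rr_pos[of k] by (intro clip_eq_1) (simp add: field_simps)

lemma inner_cut_continuous: "continuous_on UNIV (inner_cut k)"
  unfolding inner_cut_def using rr_pos[of k] by (intro continuous_intros) auto

lemma inner_cut_lipschitz: "\<bar>inner_cut k a - inner_cut k b\<bar> \<le> 1 / rr k * dist a b"
proof -
  have "\<bar>inner_cut k a - inner_cut k b\<bar> \<le> \<bar>(dist x a / rr k - 1) - (dist x b / rr k - 1)\<bar>"
    unfolding inner_cut_def by (rule clip_lipschitz)
  also have "\<dots> = \<bar>dist x a - dist x b\<bar> / rr k" using rr_pos[of k] by (simp flip: diff_divide_distrib)
  also have "\<dots> \<le> dist a b / rr k"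
    using less_imp_le[OF rr_pos[of k]] dist_triangle[of x b a] dist_triangle[of x a b]
    by (intro divide_right_mono) (auto simp: dist_commute abs_le_iff)
  finally show ?thesis by simp
qed

text \<open>Bounds the transition zone of \<open>inner_cut\<close> from outside:
  \<open>outer_cut (k + 1)\<close> is 1 up to distance 3/2 * \<open>rr (k + 1)\<close>, hence near
  the zone where \<open>inner_cut (k + 2)\<close> varies, and 0 off B(x,
  \<open>rr k\<close>).\<close>

definition outer_cut :: "nat \<Rightarrow> 'a \<Rightarrow> real" where "outer_cut k y = clip (4 - 2 * dist x y / rr k)"

text \<open>Here k is the scale at which the block ends. The function is removed in B(x,
  \<open>rr (k + 2)\<close>) and left alone off B(x, \<open>rr (k + 1)\<close>); clipping 6 * w - 1
  discards averages up to 1/6, which makes the cutoff cheap.\<close>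

definition block_fun :: "nat \<Rightarrow> ('a \<Rightarrow> real) \<Rightarrow> 'a \<Rightarrow> real" where
  "block_fun k w y = inner_cut (k + 2) y * clip (6 * w y - 1)"

text \<open>The gradient bound of \<open>lip_pair_cutoff\<close> for neighbourhoods of radius
  \<open>rr (k + 3)\<close>. The cutoff vanishes up to distance \<open>rr (k + 2)\<close>, so the
  neighbourhood of its support stays at distance at least \<open>rr (k + 3)\<close> = 2 *
  \<open>rr (k + 4)\<close> from x, where \<open>inner_cut (k + 4)\<close> is 1.\<close>

definition block_grad :: "nat \<Rightarrow> ('a \<Rightarrow> real) \<Rightarrow> ('a \<Rightarrow> real) \<Rightarrow> 'a \<Rightarrow> real" where
  "block_grad k w h y = 6 * h y * inner_cut (k + 4) y +
     1 / rr (k + 2) * clip (6 * w y - 1) * (outer_cut (k + 1) y * inner_cut (k + 4) y)"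

lemma rr_shift: "rr (k + 1) = 2 * rr (k + 2)" "rr (k + 2) = 2 * rr (k + 3)" "rr (k + 3) = 2 * rr (k + 4)" "rr k = 2 * rr (k + 1)"
  by (simp_all add: rr_def numeral_eq_Suc)

lemma lip_pair_block:
  assumes "lip_pair w h"
  shows "lip_pair (block_fun k w) (block_grad k w h)"
  unfolding block_fun_def block_grad_def
proof (rule lip_pair_cutoff[where \<delta> = "rr (k + 3)"])
  show "lip_pair (\<lambda>y. clip (6 * w y - 1)) (\<lambda>y. 6 * h y)" by (intro lip_pair_clip assms) simp
  have oc: "continuous_on UNIV (outer_cut (k + 1))"
    unfolding outer_cut_def using rr_pos[of "k + 1"] by (intro continuous_intros) auto
  show "continuous_on UNIV (\<lambda>y. outer_cut (k + 1) y * inner_cut (k + 4) y)"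
    by (intro continuous_intros oc inner_cut_continuous)
  show "0 \<le> outer_cut (k + 1) y * inner_cut (k + 4) y" for y by (simp add: outer_cut_def)
  have in1: "inner_cut (k + 4) a = 1" if "dist a b < rr (k + 3)" "\<not> dist x b \<le> rr (k + 2)" for a b
    using that dist_triangle[of x b a] rr_shift[of k] by (intro inner_cut_1) (simp add: dist_commute)
  fix a b :: 'a assume ab: "dist a b < rr (k + 3)"
  show "1 \<le> inner_cut (k + 4) a" if "inner_cut (k + 2) b \<noteq> 0"
    using in1[OF ab] inner_cut_0[of b "k + 2"] that by (metis order.refl)
  show "1 \<le> outer_cut (k + 1) a * inner_cut (k + 4) a" if ne: "inner_cut (k + 2) a \<noteq> inner_cut (k + 2) b"
  proof -
    have "\<not> (dist x a \<le> rr (k + 2) \<and> dist x b \<le> rr (k + 2))" using ne inner_cut_0 by metis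
    moreover have "dist a a < rr (k + 3)" by simp
    ultimately have 1: "inner_cut (k + 4) a = 1" using in1[OF ab] in1[of a a] by blast
    have "dist x a < rr (k + 1) \<or> dist x b < rr (k + 1)"
      using ne inner_cut_1[of "k + 2" a] inner_cut_1[of "k + 2" b] rr_shift[of k] by fastforce
    then have "dist x a < rr (k + 1) + rr (k + 3)"
      using ab dist_triangle[of x a b] rr_pos[of "k + 3"] dist_commute[of a b] by linarith
    then have "2 * dist x a \<le> 3 * rr (k + 1)" using rr_shift[of k] rr_pos[of "k + 3"] by linarith
    then have "outer_cut (k + 1) a = 1"
      unfolding outer_cut_def using rr_pos[of "k + 1"] by (intro clip_eq_1) (simp add: field_simps)
    then show ?thesis using 1 by simp
  qed
qed (use inner_cut_lipschitz[of "k + 2"] in \<open>auto simp: inner_cut_continuous\<close>)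

lemma block_fun_bounds: "0 \<le> block_fun k w y" "block_fun k w y \<le> 1"
  by (auto simp: block_fun_def intro: mult_le_one)

lemma block_fun_mono: "w y \<le> w' y \<Longrightarrow> block_fun k w y \<le> block_fun k w' y"
  unfolding block_fun_def by (intro mult_left_mono clip_mono) auto

lemma block_grad_mono:
  "w y \<le> w' y \<Longrightarrow> h y \<le> h' y \<Longrightarrow> block_grad k w h y \<le> block_grad k w' h' y"
  unfolding block_grad_def
  by (intro add_mono mult_left_mono mult_right_mono clip_mono) (auto simp: outer_cut_def less_imp_le)

lemma block_fun_outside:
  "(y \<notin> ball x (2 * rr j) \<Longrightarrow> w y = 0) \<Longrightarrow> y \<notin> ball x (2 * rr j) \<Longrightarrow> block_fun k w y = 0"
  by (simp add: block_fun_def clip_eq_0)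

lemma block_fun_inside: "y \<in> ball x (rr (k + 2)) \<Longrightarrow> block_fun k w y = 0"
  by (simp add: block_fun_def inner_cut_0)

lemma block_grad_inside: "y \<in> ball x (rr (k + 4)) \<Longrightarrow> block_grad k w h y = 0"
  by (simp add: block_grad_def inner_cut_0)

lemma block_fun_eq_1: "rr k \<le> dist x y \<Longrightarrow> 1/3 \<le> w y \<Longrightarrow> block_fun k w y = 1"
proof -
  assume y: "rr k \<le> dist x y" "1/3 \<le> w y"
  have "2 * rr (k + 2) \<le> dist x y" using rr_shift(1,4)[of k] rr_pos[of "k + 1"] y(1) by linarith
  then show "block_fun k w y = 1" using y(2) by (simp add: block_fun_def inner_cut_1 clip_eq_1)
qed

text \<open>The cutoff adds 1 / \<open>rr (k + 2)\<close> times the integral over B(x,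
  \<open>rr k\<close>), which \<open>block_average\<close> bounds by 6 * CP * E *
  \<open>rr k\<close>; the radii cancel up to a factor 4. The second estimate holds at all scales:
  before the block the support lies in the ball of radius 4 * \<open>rr j\<close>, inside the block
  the average bound applies directly, one scale past its end the scale k is used, and beyond that
  the function vanishes.\<close>

lemma block_estimates:
  assumes w: "lip_pair w h" "\<And>y. 0 \<le> w y" "\<And>y. w y \<le> 1" and hC: "\<exists>C. \<forall>y. h y \<le> C"
    and E: "(\<integral>\<^sup>+y. ennreal (h y) \<partial>M) \<le> ennreal E" "0 \<le> E"
    and w0: "\<And>y. y \<notin> ball x (2 * rr j) \<Longrightarrow> w y = 0" and j: "8 * rr j < dist x z"
    and c: "0 < c" "c \<le> 1/4" "\<And>i. j \<le> i \<Longrightarrow> i \<le> k \<Longrightarrow> c * qq j \<le> qq i" and jk: "j \<le> k"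
    and small: "12 * (drift_K * E) < c * qq j"
  shows "(\<integral>\<^sup>+y. ennreal (block_grad k w h y) \<partial>M) \<le> ennreal ((6 + 24 * CP) * E)" (is ?A)
    and "(\<integral>\<^sup>+y\<in>ball x (rr l). ennreal (block_fun k w y) \<partial>M) \<le> ennreal (24 * CP * E * rr l)" (is ?B)
proof -
  have le_E: "(\<integral>\<^sup>+y\<in>S. ennreal (h y) \<partial>M) \<le> ennreal E" for S
    by (rule order_trans[OF _ E(1)]) (auto intro!: nn_integral_mono simp: indicator_def)
  note blk = block_average[OF w hC E w0 j c(1,2) _ small, of "k - j"]
  have c': "i \<le> k - j \<Longrightarrow> c * qq j \<le> qq (j + i)" for i using c(3)[of "j + i"] jk by simp
  have CP6: "ennreal (6 * CP * s) * ennreal E = ennreal (6 * CP * E * s)" if "0 \<le> s" for s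
    using CP E that by (simp add: ennreal_mult[symmetric] ac_simps)
  have I: "(\<integral>\<^sup>+y\<in>ball x (rr i). ennreal (clip (6 * w y - 1)) \<partial>M) \<le> ennreal (6 * CP * E * rr i)" if "j \<le> i" "i \<le> k" for i
  proof -
    have "(\<integral>\<^sup>+y\<in>ball x (rr i). ennreal (clip (6 * w y - 1)) \<partial>M) \<le>
        ennreal (6 * CP * rr i) * (\<integral>\<^sup>+y\<in>ball x (lam * rr i). ennreal (h y) \<partial>M)"
      using blk(1)[OF _ c', of "i - j"] that by simp
    also have "\<dots> \<le> ennreal (6 * CP * rr i) * ennreal E" by (intro mult_left_mono le_E) simp
    finally show ?thesis by (simp add: CP6 less_imp_le)
  qed
  have I4: "(\<integral>\<^sup>+y\<in>ball x (4 * rr j). ennreal (clip (6 * w y - 1)) \<partial>M) \<le> ennreal (6 * CP * E * (4 * rr j))"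
    using blk(2)[OF _ c'] CP6[of "4 * rr j"] by (simp add: less_imp_le)
  have bc: "block_fun k w y \<le> clip (6 * w y - 1)" for y
    unfolding block_fun_def by (intro mult_left_le_one_le) auto
  have up: "ennreal (6 * CP * E * s) \<le> ennreal (24 * CP * E * rr l)" if "s \<le> 4 * rr l" for s
  proof (rule ennreal_leI)
    have "6 * CP * E * s \<le> 6 * CP * E * (4 * rr l)" using CP E that by (intro mult_left_mono) auto
    then show "6 * CP * E * s \<le> 24 * CP * E * rr l" by simp
  qed
  have sub: "(\<integral>\<^sup>+y\<in>ball x (rr l). ennreal (block_fun k w y) \<partial>M) \<le> (\<integral>\<^sup>+y\<in>S. ennreal (clip (6 * w y - 1)) \<partial>M)"
    if "\<And>y. y \<in> ball x (rr l) \<Longrightarrow> y \<notin> S \<Longrightarrow> block_fun k w y = 0" for S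
    using that bc by (intro nn_integral_mono) (auto simp: indicator_def intro!: ennreal_leI)
  show ?B
  proof -
    consider "l < j" | "j \<le> l" "l \<le> k" | "l = k + 1" | "k + 2 \<le> l" by linarith
    then show ?thesis
    proof cases
      case 1
      have "(\<integral>\<^sup>+y\<in>ball x (rr l). ennreal (block_fun k w y) \<partial>M) \<le> (\<integral>\<^sup>+y\<in>ball x (4 * rr j). ennreal (clip (6 * w y - 1)) \<partial>M)"
      proof (rule sub)
        fix y assume "y \<notin> ball x (4 * rr j)"
        then have "y \<notin> ball x (2 * rr j)" using rr_pos[of j] unfolding mem_ball by linarith
        then show "block_fun k w y = 0" using w0 by (intro block_fun_outside) auto
      qed
      also note I4
      also have "ennreal (6 * CP * E * (4 * rr j)) \<le> ennreal (24 * CP * E * rr l)"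
        using 1 rr_antimono[of l j] by (intro up) simp
      finally show ?thesis .
    next
      case 2
      have "(\<integral>\<^sup>+y\<in>ball x (rr l). ennreal (block_fun k w y) \<partial>M) \<le> (\<integral>\<^sup>+y\<in>ball x (rr l). ennreal (clip (6 * w y - 1)) \<partial>M)"
        by (rule sub) simp
      also note I[OF 2]
      also have "ennreal (6 * CP * E * rr l) \<le> ennreal (24 * CP * E * rr l)" by (intro up) (simp add: less_imp_le)
      finally show ?thesis .
    next
      case 3
      have "(\<integral>\<^sup>+y\<in>ball x (rr l). ennreal (block_fun k w y) \<partial>M) \<le> (\<integral>\<^sup>+y\<in>ball x (rr k). ennreal (clip (6 * w y - 1)) \<partial>M)"
        using 3 rr_antimono[of k l] by (intro sub) auto
      also note I[OF jk order_refl]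
      also have "ennreal (6 * CP * E * rr k) \<le> ennreal (24 * CP * E * rr l)"
        using 3 rr_shift(4)[of k] rr_pos[of "k + 1"] by (intro up) simp
      finally show ?thesis .
    next
      case 4
      have "(\<integral>\<^sup>+y\<in>ball x (rr l). ennreal (block_fun k w y) \<partial>M) \<le> (\<integral>\<^sup>+y\<in>{}. ennreal (clip (6 * w y - 1)) \<partial>M)"
        using 4 rr_antimono[of "k + 2" l] by (intro sub block_fun_inside) auto
      then show ?thesis by simp
    qed
  qed
  have wc: "continuous_on UNIV w" and hc: "continuous_on UNIV h"
    using lip_pair_continuous[OF w(1)] lip_pair_grad_continuous[OF w(1)] by auto
  have cc: "continuous_on UNIV (\<lambda>y. clip (6 * w y - 1))" by (intro continuous_intros wc)
  note [measurable] = continuous_measurable_M[OF hc] continuous_measurable_M[OF cc]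
  have "(\<integral>\<^sup>+y. ennreal (block_grad k w h y) \<partial>M) \<le> (\<integral>\<^sup>+y. ennreal 6 * ennreal (h y) +
      ennreal (1 / rr (k + 2)) * (ennreal (clip (6 * w y - 1)) * indicator (ball x (rr k)) y) \<partial>M)"
  proof (rule nn_integral_mono)
    fix y
    have h0: "0 \<le> h y" by (rule lip_pair_grad_nonneg[OF w(1)])
    have oc: "outer_cut (k + 1) y * inner_cut (k + 4) y \<le> indicator (ball x (rr k)) y"
    proof (cases "y \<in> ball x (rr k)")
      case True
      then show ?thesis by (simp add: outer_cut_def mult_le_one)
    next
      case False
      then have "outer_cut (k + 1) y = 0"
        unfolding outer_cut_def using rr_shift(4)[of k] rr_pos[of "k + 1"] by (intro clip_eq_0) (simp add: field_simps)
      then show ?thesis by simp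
    qed
    have "block_grad k w h y \<le> 6 * h y * 1 + 1 / rr (k + 2) * clip (6 * w y - 1) * indicator (ball x (rr k)) y"
      unfolding block_grad_def using h0 oc by (intro add_mono mult_left_mono) (auto simp: less_imp_le)
    then have "ennreal (block_grad k w h y) \<le> ennreal (6 * h y + 1 / rr (k + 2) * (clip (6 * w y - 1) * indicator (ball x (rr k)) y))"
      by (intro ennreal_leI) (simp add: mult.assoc)
    also have "\<dots> = ennreal (6 * h y) + ennreal (1 / rr (k + 2) * (clip (6 * w y - 1) * indicator (ball x (rr k)) y))"
      using h0 by (intro ennreal_plus) (auto simp: less_imp_le)
    also have "\<dots> = ennreal 6 * ennreal (h y) + ennreal (1 / rr (k + 2)) * ennreal (clip (6 * w y - 1) * indicator (ball x (rr k)) y)"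
      using h0 by (intro arg_cong2[where f = plus] ennreal_mult) (auto simp: less_imp_le)
    also have "ennreal (clip (6 * w y - 1) * indicator (ball x (rr k)) y) = ennreal (clip (6 * w y - 1)) * indicator (ball x (rr k)) y"
      by (auto simp: indicator_def)
    finally show "ennreal (block_grad k w h y) \<le> ennreal 6 * ennreal (h y) +
      ennreal (1 / rr (k + 2)) * (ennreal (clip (6 * w y - 1)) * indicator (ball x (rr k)) y)" .
  qed
  also have "\<dots> = ennreal 6 * (\<integral>\<^sup>+y. ennreal (h y) \<partial>M) +
      ennreal (1 / rr (k + 2)) * (\<integral>\<^sup>+y\<in>ball x (rr k). ennreal (clip (6 * w y - 1)) \<partial>M)"
    by (subst nn_integral_add) (simp_all add: nn_integral_cmult)
  also have "\<dots> \<le> ennreal 6 * ennreal E + ennreal (1 / rr (k + 2)) * ennreal (6 * CP * E * rr k)"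
    by (intro add_mono mult_left_mono E I jk) auto
  also have "\<dots> = ennreal (6 * E) + ennreal (1 / rr (k + 2) * (6 * CP * E * rr k))"
    using CP E by (intro arg_cong2[where f = plus] ennreal_mult[symmetric]) (auto simp: less_imp_le)
  also have "1 / rr (k + 2) * (6 * CP * E * rr k) = 24 * CP * E"
    using rr_shift[of k] rr_pos[of "k + 2"] by simp
  also have "ennreal (6 * E) + ennreal (24 * CP * E) = ennreal ((6 + 24 * CP) * E)"
    using CP E by (subst ennreal_plus[symmetric]) (auto simp: distrib_right)
  finally show ?A .
qed

end

section \<open>Finite sums and increasing limits of block functions\<close>

lemma lip_pair_sum:
  fixes w h :: "'i \<Rightarrow> 'a::metric_space \<Rightarrow> real"
  assumes "finite I" "\<And>i. i \<in> I \<Longrightarrow> lip_pair (w i) (h i)"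
  shows "lip_pair (\<lambda>y. \<Sum>i\<in>I. w i y) (\<lambda>y. \<Sum>i\<in>I. h i y)"
  using assms
proof (induction I rule: finite_induct)
  case empty
  show ?case by (simp, rule lip_pairI[where d = 1]) auto
next
  case (insert i I)
  obtain d1 where d1: "d1 > 0" "\<And>a b. dist a b < d1 \<Longrightarrow> \<bar>w i a - w i b\<bar> \<le> h i a * dist a b"
    using lip_pairE[OF insert.prems[of i]] by blast
  have IH: "lip_pair (\<lambda>y. \<Sum>i\<in>I. w i y) (\<lambda>y. \<Sum>i\<in>I. h i y)" using insert by simp
  obtain d2 where d2: "d2 > 0"
    "\<And>a b. dist a b < d2 \<Longrightarrow> \<bar>(\<Sum>i\<in>I. w i a) - (\<Sum>i\<in>I. w i b)\<bar> \<le> (\<Sum>i\<in>I. h i a) * dist a b"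
    using lip_pairE[OF IH] by blast
  have "lip_pair (\<lambda>y. w i y + (\<Sum>i\<in>I. w i y)) (\<lambda>y. h i y + (\<Sum>i\<in>I. h i y))"
  proof (rule lip_pairI[where d = "min d1 d2"])
    show "continuous_on UNIV (\<lambda>y. h i y + (\<Sum>i\<in>I. h i y))"
      using insert.prems by (intro continuous_intros lip_pair_grad_continuous[OF IH] lip_pair_grad_continuous) auto
    show "0 \<le> h i y + (\<Sum>i\<in>I. h i y)" for y
      using lip_pair_grad_nonneg[OF IH, of y] lip_pair_grad_nonneg[OF insert.prems[of i], of y] by simp
    fix a b :: 'a assume "dist a b < min d1 d2"
    then have "\<bar>w i a - w i b\<bar> \<le> h i a * dist a b"
      "\<bar>(\<Sum>i\<in>I. w i a) - (\<Sum>i\<in>I. w i b)\<bar> \<le> (\<Sum>i\<in>I. h i a) * dist a b" using d1 d2 by auto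
    then show "\<bar>(w i a + (\<Sum>i\<in>I. w i a)) - (w i b + (\<Sum>i\<in>I. w i b))\<bar> \<le> (h i a + (\<Sum>i\<in>I. h i a)) * dist a b"
      unfolding distrib_right by linarith
  qed (use d1 d2 in auto)
  then show ?case using insert by simp
qed

lemma geometric_sum_le:
  fixes a :: "nat \<Rightarrow> real"
  assumes "0 \<le> B" "\<And>m. m < m0 \<Longrightarrow> a m = 0" "\<And>m. m0 \<le> m \<Longrightarrow> a m \<le> B * (1/2) ^ (m - m0)"
  shows "(\<Sum>m\<le>n. a m) \<le> 2 * B"
proof -
  \<comment> \<open>The exact partial sum of the geometric series; an induction with the bound 2 * B
    alone would not close.\<close>
  have "(\<Sum>m\<le>n. a m) \<le> (if n < m0 then 0 else B * (2 - (1/2) ^ (n - m0)))"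
  proof (induction n)
    case 0
    then show ?case using assms(2)[of 0] assms(3)[of 0] by (cases "m0 = 0") auto
  next
    case (Suc n)
    consider "Suc n < m0" | "Suc n = m0" | "m0 \<le> n" by linarith
    then show ?case
    proof cases
      case 3
      then have "a (Suc n) \<le> B * (1/2) ^ (n - m0) * (1/2)" using assms(3)[of "Suc n"] by (simp add: Suc_diff_le)
      then show ?thesis using Suc 3 by (simp add: Suc_diff_le algebra_simps)
    qed (use Suc assms(2)[of "Suc n"] assms(3)[of "Suc n"] in auto)
  qed
  also have "\<dots> \<le> 2 * B" using assms(1) by (auto simp: right_diff_distrib)
  finally show ?thesis .
qed

context pi_space
begin

lemma sup_integral_le:
  assumes "\<And>n. continuous_on UNIV (f n)" "\<And>n y. f n y \<le> f (Suc n) y" "S \<in> sets M"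
    "\<And>n. (\<integral>\<^sup>+y\<in>S. ennreal (f n y) \<partial>M) \<le> X"
  shows "(\<integral>\<^sup>+y\<in>S. (SUP n. ennreal (f n y)) \<partial>M) \<le> X"
proof -
  have [measurable]: "f n \<in> borel_measurable M" "S \<in> sets M" for n
    by (intro continuous_measurable_M assms)+
  have "(\<integral>\<^sup>+y\<in>S. (SUP n. ennreal (f n y)) \<partial>M) = (SUP n. \<integral>\<^sup>+y\<in>S. ennreal (f n y) \<partial>M)"
    unfolding SUP_mult_right_ennreal
    by (intro nn_integral_monotone_convergence_SUP)
       (auto simp: incseq_Suc_iff le_fun_def intro!: mult_right_mono ennreal_leI assms)
  also have "\<dots> \<le> X" by (intro SUP_least assms)
  finally show ?thesis .
qed

lemma set_integral_mono_ball: "s \<le> t \<Longrightarrow> (\<integral>\<^sup>+y\<in>ball x s. g y \<partial>M) \<le> (\<integral>\<^sup>+y\<in>ball x t. g y \<partial>M)"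
  by (intro nn_integral_mono) (auto simp: indicator_def)

end

section \<open>Approximants at the dyadic scales; one infinite block, or infinitely many
  blocks\<close>

context pointed_pi_space
begin

text \<open>Of all levels below 1 only 1/2 is kept; it lies above 1/3, from where on
  \<open>clip (6 * w - 1)\<close> is 1.\<close>

definition approximants :: "'a set \<Rightarrow> nat \<Rightarrow> real \<Rightarrow> (nat \<Rightarrow> 'a \<Rightarrow> real) \<Rightarrow> (nat \<Rightarrow> 'a \<Rightarrow> real) \<Rightarrow> bool" where
  "approximants A l E w h \<longleftrightarrow> (\<forall>k. lip_pair (w k) (h k)) \<and> (\<forall>k. \<exists>C. \<forall>y. h k y \<le> C) \<and>
     (\<forall>k y. h k y \<le> h (Suc k) y) \<and> (\<forall>k y. 0 \<le> w k y) \<and> (\<forall>k y. w k y \<le> 1) \<and> (\<forall>k y. w k y \<le> w (Suc k) y) \<and>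
     (\<forall>k y. y \<notin> ball x (2 * rr l) \<longrightarrow> w k y = 0) \<and>
     (\<forall>y\<in>A \<inter> ball x (rr l). \<exists>k. 1/2 < w k y) \<and> (\<integral>\<^sup>+y. (SUP k. ennreal (h k y)) \<partial>M) \<le> ennreal E"

lemma approximants_energy:
  assumes "approximants A l E w h"
  shows "(\<integral>\<^sup>+y. ennreal (h k y) \<partial>M) \<le> ennreal E"
proof -
  have "(\<integral>\<^sup>+y. ennreal (h k y) \<partial>M) \<le> (\<integral>\<^sup>+y. (SUP k. ennreal (h k y)) \<partial>M)"
    by (intro nn_integral_mono SUP_upper) simp
  then show ?thesis using assms unfolding approximants_def by (auto intro: order_trans)
qed

lemma thin_approximants:
  assumes "thin1 M A x"
  obtains \<epsilon> :: "nat \<Rightarrow> real" and l1 where "\<And>l. 0 < \<epsilon> l" "\<epsilon> \<longlonglongrightarrow> 0"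
    "\<And>l. l1 \<le> l \<Longrightarrow> \<exists>w h. approximants A l (\<epsilon> l * qq l) w h"
proof -
  define cp where "cp = (\<lambda>l. cap1 M (A \<inter> ball x (rr l)) (ball x (2 * rr l)))"
  define t where "t = (\<lambda>l. ennreal (rr l) * cp l / emeasure M (ball x (rr l)))"
  have "filterlim rr (at_right 0) sequentially"
    by (intro filterlim_at_withinI rr_tendsto) auto
  then have t0: "t \<longlonglongrightarrow> 0"
    using filterlim_compose[OF assms[unfolded thin1_def], of rr] by (simp add: t_def cp_def)
  \<comment> \<open>t is the capacity divided by \<open>qq l\<close>. The power of 1/2 makes the
    bound on the capacity strict even if the capacity is 0, as the choice of a test function
    requires.\<close>
  define \<epsilon> where "\<epsilon> = (\<lambda>l. enn2real (t l) + (1/2) ^ l)"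
  have "(\<lambda>l. enn2real (t l)) \<longlonglongrightarrow> 0" using t0 by (intro tendsto_enn2real) auto
  moreover have "(\<lambda>l. (1/2::real) ^ l) \<longlonglongrightarrow> 0" by (intro LIMSEQ_power_zero) simp
  ultimately have "\<epsilon> \<longlonglongrightarrow> 0 + 0" unfolding \<epsilon>_def by (rule tendsto_add)
  have "\<forall>\<^sub>F l in sequentially. t l < 1" using t0 by (intro order_tendstoD) auto
  then obtain l1 where l1: "\<And>l. l1 \<le> l \<Longrightarrow> t l < 1" by (auto simp: eventually_sequentially)
  have cap: "cp l < ennreal (\<epsilon> l * qq l)" if "l1 \<le> l" for l
  proof -
    have e: "emeasure M (ball x (rr l)) = ennreal (mm l)" by (simp add: mm_def emeasure_ball_eq)
    have "cp l \<noteq> top"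
    proof
      assume "cp l = top"
      then have "t l = top" by (simp add: t_def e ennreal_mult_top ennreal_top_divide)
      then show False using l1[OF that] by simp
    qed
    then obtain c where c: "cp l = ennreal c" "0 \<le> c" by (cases "cp l") auto
    have "t l = ennreal (rr l * c / mm l)"
      using c by (simp add: t_def e ennreal_mult[symmetric] divide_ennreal)
    then have "enn2real (t l) * qq l = c" using c by (simp add: qq_def less_imp_le) (metis less_irrefl mm_pos)
    then have "c < \<epsilon> l * qq l" by (simp add: \<epsilon>_def distrib_right)
    then show ?thesis using c by (simp add: ennreal_lessI)
  qed
  show ?thesis
  proof (rule that[of \<epsilon> l1])
    show "0 < \<epsilon> l" for l by (simp add: \<epsilon>_def add_nonneg_pos)
    show "\<epsilon> \<longlonglongrightarrow> 0" using \<open>\<epsilon> \<longlonglongrightarrow> 0 + 0\<close> by simp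
    fix l assume "l1 \<le> l"
    obtain w h where wh: "\<And>k. lip_pair (w k) (h k)" "\<And>k. \<exists>C. \<forall>y. h k y \<le> C"
      "\<And>k y. h k y \<le> h (Suc k) y" "\<And>k y. 0 \<le> w k y" "\<And>k y. w k y \<le> 1" "\<And>k y. w k y \<le> w (Suc k) y"
      "\<And>k y. y \<notin> ball x (2 * rr l) \<Longrightarrow> w k y = 0"
      "\<And>y t. y \<in> A \<inter> ball x (rr l) \<Longrightarrow> t < 1 \<Longrightarrow> \<exists>k. t < w k y"
      "(\<integral>\<^sup>+y. (SUP k. ennreal (h k y)) \<partial>M) \<le> ennreal (\<epsilon> l * qq l)"
      using capacity_approximants[OF rr_pos cap[OF \<open>l1 \<le> l\<close>, unfolded cp_def]] by blast
    then have "approximants A l (\<epsilon> l * qq l) w h"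
      unfolding approximants_def by (intro conjI allI ballI impI wh(1-7,9) wh(8)) auto
    then show "\<exists>w h. approximants A l (\<epsilon> l * qq l) w h" by blast
  qed
qed

lemma small_half: "0 < 1 / (4 * Cd)" "1 / (4 * Cd) \<le> 1/4"
  using Cd by (auto simp: field_simps)

text \<open>As the density stays above \<open>qq j / 2\<close>, bounds by small constants become
  bounds by small multiples of \<open>qq l\<close>. The average bound reduces the integrals of f to
  the energy in the ball enlarged by \<open>lam\<close>, so both smallness conditions come from
  integrals of one function over shrinking balls.\<close>

lemma thin_neighbourhood_single_block:
  assumes ap: "approximants A j E w h" and E: "0 \<le> E" and j: "8 * rr j < dist x z"
    and small: "12 * (drift_K * E) < 1 / (4 * Cd) * qq j"
    and large: "\<And>l. j \<le> l \<Longrightarrow> qq j / 2 \<le> qq l"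
  shows "has_thin_neighbourhood x A"
proof -
  note ap' = ap[unfolded approximants_def]
  have lp: "lip_pair (w n) (h n)" for n using ap' by blast
  define f where "f = (\<lambda>n y. clip (6 * w n y - 1))"
  define H where "H = (\<lambda>n y. 6 * h n y)"
  define hs where "hs = (\<lambda>y. SUP n. ennreal (h n y))"
  have lpf: "lip_pair (f n) (H n)" for n unfolding f_def H_def by (intro lip_pair_clip lp) simp
  have hsM [measurable]: "hs \<in> borel_measurable M"
    unfolding hs_def by (intro borel_measurable_SUP measurable_compose[OF _ measurable_ennreal]
      continuous_measurable_M lip_pair_grad_continuous[OF lp]) simp
  have hsE: "(\<integral>\<^sup>+y. hs y \<partial>M) \<le> ennreal E" using ap' by (simp add: hs_def)
  then have hsfin: "(\<integral>\<^sup>+y. hs y \<partial>M) < \<infinity>" by (rule le_less_trans) simp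
  have Hs: "(SUP n. ennreal (H n y)) = ennreal 6 * hs y" for y
    unfolding H_def hs_def SUP_mult_left_ennreal by (simp add: ennreal_mult')
  have pos: "qq j > 0" by simp
  have avg: "(\<integral>\<^sup>+y\<in>ball x (rr l). (SUP n. ennreal (f n y)) \<partial>M) \<le>
      ennreal (6 * CP * rr l) * (\<integral>\<^sup>+y\<in>ball x (lam * rr l). hs y \<partial>M)" if "j \<le> l" for l
  proof (rule sup_integral_le)
    show "continuous_on UNIV (f n)" for n by (rule lip_pair_continuous[OF lpf])
    show "f n y \<le> f (Suc n) y" for n y unfolding f_def using ap' by (intro clip_mono) auto
    fix n
    obtain i where i: "l = j + i" using \<open>j \<le> l\<close> le_Suc_ex by blast
    have "(\<integral>\<^sup>+y\<in>ball x (rr (j + i)). ennreal (clip (6 * w n y - 1)) \<partial>M) \<le>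
      ennreal (6 * CP * rr (j + i)) * (\<integral>\<^sup>+y\<in>ball x (lam * rr (j + i)). ennreal (h n y) \<partial>M)"
    proof (rule block_average(1)[OF lp])
      show "1 / (4 * Cd) * qq j \<le> qq (j + i')" for i'
      proof -
        have "1 / (4 * Cd) * qq j \<le> 1/4 * qq j" using small_half pos by (intro mult_right_mono) auto
        then show ?thesis using large[of "j + i'"] pos by linarith
      qed
      show "12 * (drift_K * E) < 1 / (4 * Cd) * qq j" by (rule small)
    qed (use ap' approximants_energy[OF ap] E j small_half in auto)
    also have "\<dots> \<le> ennreal (6 * CP * rr (j + i)) * (\<integral>\<^sup>+y\<in>ball x (lam * rr (j + i)). hs y \<partial>M)"
      unfolding hs_def by (intro mult_left_mono nn_integral_mono mult_right_mono SUP_upper) auto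
    finally show "(\<integral>\<^sup>+y\<in>ball x (rr l). ennreal (f n y) \<partial>M) \<le>
      ennreal (6 * CP * rr l) * (\<integral>\<^sup>+y\<in>ball x (lam * rr l). hs y \<partial>M)" by (simp add: i f_def)
  qed simp
  show ?thesis
  proof (rule thin_neighbourhood_from_family[where f = f and H = H and \<rho> = "2 * rr j" and R = "rr j"])
    show "lip_pair (f n) (H n)" for n by (rule lpf)
    show "0 \<le> f n y" "f n y \<le> 1" for n y by (simp_all add: f_def)
    show "f n y \<le> f (Suc n) y" for n y unfolding f_def using ap' by (intro clip_mono) auto
    show "f n y = 0" if "y \<notin> ball x (2 * rr j)" for n y unfolding f_def using ap' that by (intro clip_eq_0) auto
    show "\<exists>n. 2/3 < f n y" if "y \<in> A \<inter> ball x (rr j)" for y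
    proof -
      obtain n where "1/2 < w n y" using ap' \<open>y \<in> A \<inter> ball x (rr j)\<close> by blast
      then have "f n y = 1" unfolding f_def by (intro clip_eq_1) simp
      then show ?thesis by (intro exI[of _ n]) simp
    qed
    show "(\<integral>\<^sup>+y. (SUP n. ennreal (H n y)) \<partial>M) < \<infinity>"
      using hsfin unfolding Hs by (simp add: nn_integral_cmult ennreal_mult_less_top)
  next
    fix \<delta> :: real assume \<delta>: "\<delta> > 0"
    \<comment> \<open>6 * \<delta>' is \<delta> / Cd times \<open>qq j / 2\<close>, the lower bound
      for the density; the factor Cd is lost in passing from dyadic to arbitrary radii.\<close>
    define \<delta>' where "\<delta>' = \<delta> / Cd * qq j / 12"
    have "\<delta>' > 0" using \<delta> Cd pos by (simp add: \<delta>'_def)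
    then obtain l0 where l0: "\<And>l. l0 \<le> l \<Longrightarrow> (\<integral>\<^sup>+y\<in>ball x (1 * rr l). hs y \<partial>M) \<le> ennreal \<delta>'"
      using integral_shrinking_balls[OF hsM hsfin, of 1 \<delta>'] by (metis zero_less_one)
    have "\<forall>\<^sub>F r in at_right 0. (\<integral>\<^sup>+y\<in>ball x r. (SUP n. ennreal (H n y)) \<partial>M) \<le> ennreal (Cd * (\<delta> / Cd) * (measure M (ball x r) / r))"
    proof (rule eventually_small_from_dyadic_ratio[where ?l0.0 = "max j l0"])
      show "(\<integral>\<^sup>+y\<in>ball x s. (SUP n. ennreal (H n y)) \<partial>M) \<le> (\<integral>\<^sup>+y\<in>ball x t. (SUP n. ennreal (H n y)) \<partial>M)"
        if "s \<le> t" for s t by (rule set_integral_mono_ball[OF that])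
      fix l assume l: "max j l0 \<le> l"
      have "(\<integral>\<^sup>+y\<in>ball x (rr l). (SUP n. ennreal (H n y)) \<partial>M) = ennreal 6 * (\<integral>\<^sup>+y\<in>ball x (rr l). hs y \<partial>M)"
        unfolding Hs mult.assoc by (rule nn_integral_cmult) measurable
      also have "\<dots> \<le> ennreal 6 * ennreal \<delta>'" using l0[of l] l by (intro mult_left_mono) auto
      also have "\<dots> = ennreal (6 * \<delta>')" using \<open>\<delta>' > 0\<close> by (intro ennreal_mult[symmetric]) auto
      also have "\<dots> \<le> ennreal (\<delta> / Cd * qq l)"
      proof (rule ennreal_leI)
        have "6 * \<delta>' = \<delta> / Cd * (qq j / 2)" by (simp add: \<delta>'_def)
        also have "\<dots> \<le> \<delta> / Cd * qq l" using large[of l] l \<delta> Cd by (intro mult_left_mono) auto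
        finally show "6 * \<delta>' \<le> \<delta> / Cd * qq l" .
      qed
      finally show "(\<integral>\<^sup>+y\<in>ball x (rr l). (SUP n. ennreal (H n y)) \<partial>M) \<le> ennreal (\<delta> / Cd * qq l)" .
    qed (use \<delta> Cd in auto)
    then show "\<forall>\<^sub>F r in at_right 0. (\<integral>\<^sup>+y\<in>ball x r. (SUP n. ennreal (H n y)) \<partial>M) \<le> ennreal (\<delta> * (measure M (ball x r) / r))"
      using Cd by simp
  next
    fix \<delta> :: real assume \<delta>: "\<delta> > 0"
    define \<delta>' where "\<delta>' = \<delta> / Cd * (qq j / 2) / (6 * CP)"
    have "\<delta>' > 0" using \<delta> Cd CP pos by (simp add: \<delta>'_def)
    then obtain l0 where l0: "\<And>l. l0 \<le> l \<Longrightarrow> (\<integral>\<^sup>+y\<in>ball x (lam * rr l). hs y \<partial>M) \<le> ennreal \<delta>'"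
      using integral_shrinking_balls[OF hsM hsfin, of lam \<delta>'] lam by (metis less_le_trans zero_less_one)
    have "\<forall>\<^sub>F r in at_right 0. (\<integral>\<^sup>+y\<in>ball x r. (SUP n. ennreal (f n y)) \<partial>M) \<le> ennreal (Cd * (\<delta> / Cd) * measure M (ball x r))"
    proof (rule eventually_small_from_dyadic[where ?l0.0 = "max j l0"])
      show "(\<integral>\<^sup>+y\<in>ball x s. (SUP n. ennreal (f n y)) \<partial>M) \<le> (\<integral>\<^sup>+y\<in>ball x t. (SUP n. ennreal (f n y)) \<partial>M)"
        if "s \<le> t" for s t by (rule set_integral_mono_ball[OF that])
      fix l assume l: "max j l0 \<le> l"
      have "(\<integral>\<^sup>+y\<in>ball x (rr l). (SUP n. ennreal (f n y)) \<partial>M) \<le> ennreal (6 * CP * rr l) * (\<integral>\<^sup>+y\<in>ball x (lam * rr l). hs y \<partial>M)"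
        using l by (intro avg) simp
      also have "\<dots> \<le> ennreal (6 * CP * rr l) * ennreal \<delta>'" using l0[of l] l by (intro mult_left_mono) auto
      also have "\<dots> = ennreal (6 * CP * rr l * \<delta>')" using \<open>\<delta>' > 0\<close> CP by (intro ennreal_mult[symmetric]) auto
      also have "\<dots> \<le> ennreal (\<delta> / Cd * mm l)"
      proof (rule ennreal_leI)
        have "6 * CP * rr l * \<delta>' = \<delta> / Cd * (qq j / 2 * rr l)" using CP by (simp add: \<delta>'_def ac_simps)
        also have "\<dots> \<le> \<delta> / Cd * (qq l * rr l)" using large[of l] l \<delta> Cd by (intro mult_left_mono mult_right_mono) auto
        finally show "6 * CP * rr l * \<delta>' \<le> \<delta> / Cd * mm l" by (simp add: mm_eq)
      qed
      finally show "(\<integral>\<^sup>+y\<in>ball x (rr l). (SUP n. ennreal (f n y)) \<partial>M) \<le> ennreal (\<delta> / Cd * mm l)" .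
    qed (use \<delta> Cd in auto)
    then show "\<forall>\<^sub>F r in at_right 0. (\<integral>\<^sup>+y\<in>ball x r. (SUP n. ennreal (f n y)) \<partial>M) \<le> ennreal (\<delta> * measure M (ball x r))"
      using Cd by simp
  qed simp
qed

text \<open>Along the block starts \<open>J m\<close> the densities decay geometrically, while inside a block they are
  comparable to the density at its start; the overlap of 4 scales comes from the cutoffs.\<close>

lemma tail_sum:
  assumes J: "\<And>m. J m < J (Suc m)" "\<And>m. qq (J (Suc m)) \<le> qq (J m) / 2"
      "\<And>m i. J m \<le> i \<Longrightarrow> i < J (Suc m) \<Longrightarrow> qq (J m) / 2 \<le> qq i"
    and \<epsilon>: "\<And>m. N \<le> m \<Longrightarrow> \<epsilon> (J m) \<le> \<delta>" "0 \<le> \<delta>" and l: "J (Suc N) + 4 \<le> l"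
  shows "(\<Sum>m\<le>n. if l < J (Suc m) + 4 then \<epsilon> (J m) * qq (J m) else 0) \<le> 4 * Cd ^ 4 * \<delta> * qq l"
proof -
  have Jm: "strict_mono J" using J(1) by (simp add: strict_mono_Suc_iff)
  \<comment> \<open>The first block that still reaches into B(x, \<open>rr l\<close>): the gradient
    of block m vanishes from scale J (Suc m) + 4 on.\<close>
  define m0 where "m0 = (LEAST m. l < J (Suc m) + 4)"
  have "l < J (Suc l) + 4" using strict_mono_imp_increasing[OF Jm, of "Suc l"] by simp
  then have m0: "l < J (Suc m0) + 4" unfolding m0_def by (rule LeastI)
  have small: "\<not> l < J (Suc m) + 4" if "m < m0" for m using not_less_Least[OF that[unfolded m0_def]] .
  have "N < m0"
  proof (rule ccontr)
    assume "\<not> N < m0"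
    then have "J (Suc m0) \<le> J (Suc N)" using Jm by (simp add: strict_mono_less_eq)
    then show False using m0 l by simp
  qed
  then obtain m1 where m1: "m0 = Suc m1" by (cases m0) auto
  then have low: "J m0 + 4 \<le> l" using small[of m1] by simp
  have geo: "qq (J m) \<le> qq (J m0) * (1/2) ^ (m - m0)" if "m0 \<le> m" for m
    using that
  proof (induction m rule: dec_induct)
    case (step m)
    have "qq (J (Suc m)) \<le> qq (J m) / 2" by (rule J(2))
    also have "\<dots> \<le> qq (J m0) * (1/2) ^ (m - m0) / 2" using step by simp
    finally show ?case using step by (simp add: Suc_diff_le)
  qed simp
  have "(\<Sum>m\<le>n. if l < J (Suc m) + 4 then \<epsilon> (J m) * qq (J m) else 0) \<le> 2 * (\<delta> * qq (J m0))"
  proof (rule geometric_sum_le[where ?m0.0 = m0])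
    show "0 \<le> \<delta> * qq (J m0)" using \<epsilon>(2) by simp
    show "(if l < J (Suc m) + 4 then \<epsilon> (J m) * qq (J m) else 0) = 0" if "m < m0" for m using small[OF that] by simp
    show "(if l < J (Suc m) + 4 then \<epsilon> (J m) * qq (J m) else 0) \<le> \<delta> * qq (J m0) * (1/2) ^ (m - m0)" if "m0 \<le> m" for m
    proof -
      have "\<epsilon> (J m) * qq (J m) \<le> \<delta> * (qq (J m0) * (1/2) ^ (m - m0))"
        using \<epsilon> geo[OF that] \<open>N < m0\<close> that by (intro mult_mono) auto
      moreover have "0 \<le> \<delta> * (qq (J m0) * (1/2) ^ (m - m0))" using \<epsilon>(2) by simp
      ultimately show ?thesis by (simp add: mult.assoc)
    qed
  qed
  also have "qq (J m0) \<le> 2 * Cd ^ 4 * qq l"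
  proof (cases "l < J (Suc m0)")
    case True
    then have "qq (J m0) \<le> 2 * (1 * qq l)" using J(3)[of m0 l] low by simp
    also have "\<dots> \<le> 2 * (Cd ^ 4 * qq l)" using Cd by (intro mult_left_mono mult_right_mono) auto
    finally show ?thesis by simp
  next
    case False
    \<comment> \<open>The last scale before the density has halved. From there l is at most 4 steps
      away, as l < J (Suc m0) + 4, so doubling costs Cd ^ 4.\<close>
    define i where "i = J (Suc m0) - 1"
    have i: "J m0 \<le> i" "i < J (Suc m0)" "i \<le> l" "l - i \<le> 4" using J(1)[of m0] False m0 by (auto simp: i_def)
    have "qq (J m0) \<le> 2 * qq i" using J(3)[OF i(1,2)] by simp
    also have "qq i \<le> Cd ^ (l - i) * qq l" using qq_le_add[of i "l - i"] i(3) by simp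
    also have "\<dots> \<le> Cd ^ 4 * qq l" using Cd i(4) by (intro mult_right_mono power_increasing) auto
    finally show ?thesis by simp
  qed
  then have "2 * (\<delta> * qq (J m0)) \<le> 2 * (\<delta> * (2 * Cd ^ 4 * qq l))" using \<epsilon>(2) by (intro mult_left_mono) auto
  finally show ?thesis by (simp add: ac_simps)
qed

lemma set_integral_sum_le:
  assumes "finite I" "\<And>i. i \<in> I \<Longrightarrow> continuous_on UNIV (a i)" "\<And>i y. i \<in> I \<Longrightarrow> 0 \<le> a i y" "S \<in> sets M"
    "\<And>i. i \<in> I \<Longrightarrow> (\<integral>\<^sup>+y\<in>S. ennreal (a i y) \<partial>M) \<le> ennreal (b i)" "\<And>i. i \<in> I \<Longrightarrow> 0 \<le> b i"
  shows "(\<integral>\<^sup>+y\<in>S. ennreal (\<Sum>i\<in>I. a i y) \<partial>M) \<le> ennreal (\<Sum>i\<in>I. b i)"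
proof -
  have "(\<integral>\<^sup>+y\<in>S. ennreal (\<Sum>i\<in>I. a i y) \<partial>M) = (\<integral>\<^sup>+y. (\<Sum>i\<in>I. ennreal (a i y) * indicator S y) \<partial>M)"
    using assms(3) by (simp add: sum_distrib_right[symmetric])
  also have "\<dots> = (\<Sum>i\<in>I. \<integral>\<^sup>+y\<in>S. ennreal (a i y) \<partial>M)"
  proof (rule nn_integral_sum)
    fix i assume "i \<in> I"
    have [measurable]: "a i \<in> borel_measurable M" "S \<in> sets M"
      by (intro continuous_measurable_M assms \<open>i \<in> I\<close>)+
    show "(\<lambda>y. ennreal (a i y) * indicator S y) \<in> borel_measurable M" by measurable
  qed
  also have "\<dots> \<le> (\<Sum>i\<in>I. ennreal (b i))" by (intro sum_mono assms)
  also have "\<dots> = ennreal (\<Sum>i\<in>I. b i)" using assms(6) by simp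
  finally show ?thesis .
qed

text \<open>Block m covers the part of A between the radii \<open>rr (J (Suc m))\<close> and
  \<open>rr (J m)\<close>; since x is not in A, every point of A near x lies in such a shell. On
  B(x, \<open>rr l\<close>) only blocks that end after scale l - 4 contribute, and their energies
  form a geometric tail dominated by the density at l.\<close>

lemma thin_neighbourhood_many_blocks:
  assumes xA: "x \<notin> A" and ap: "\<And>l. j0 \<le> l \<Longrightarrow> approximants A l (\<epsilon> l * qq l) (w l) (h l)"
    and \<epsilon>: "\<And>l. 0 < \<epsilon> l" "\<epsilon> \<longlonglongrightarrow> 0"
    and j0: "\<And>l. j0 \<le> l \<Longrightarrow> 8 * rr l < dist x z" "\<And>l. j0 \<le> l \<Longrightarrow> 12 * (drift_K * \<epsilon> l) < 1 / (4 * Cd)"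
    and decay: "\<And>j. j0 \<le> j \<Longrightarrow> \<exists>k>j. qq k \<le> qq j / 2"
  shows "has_thin_neighbourhood x A"
proof -
  define nxt where "nxt = (\<lambda>j. LEAST k. j < k \<and> qq k \<le> qq j / 2)"
  define J where "J = (\<lambda>m. (nxt ^^ m) j0)"
  have nxt: "j < nxt j" "qq (nxt j) \<le> qq j / 2" "\<And>i. j \<le> i \<Longrightarrow> i < nxt j \<Longrightarrow> qq j / 2 \<le> qq i" if "j0 \<le> j" for j
  proof -
    have "j < nxt j \<and> qq (nxt j) \<le> qq j / 2" unfolding nxt_def by (rule LeastI_ex) (rule decay[OF that])
    then show "j < nxt j" "qq (nxt j) \<le> qq j / 2" by auto
    fix i assume "j \<le> i" "i < nxt j"
    have "\<not> (j < i \<and> qq i \<le> qq j / 2)"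
      by (rule not_less_Least) (use \<open>i < nxt j\<close> in \<open>simp only: nxt_def\<close>)
    then show "qq j / 2 \<le> qq i"
      using \<open>j \<le> i\<close> qq_pos[of j] by (cases "i = j") auto
  qed
  have JS: "J (Suc m) = nxt (J m)" for m by (simp add: J_def)
  have Jge: "j0 \<le> J m" for m
  proof (induction m)
    case (Suc m)
    then show ?case using nxt(1)[of "J m"] by (simp add: JS)
  qed (simp add: J_def)
  have J: "J m < J (Suc m)" "qq (J (Suc m)) \<le> qq (J m) / 2" "J m \<le> i \<Longrightarrow> i < J (Suc m) \<Longrightarrow> qq (J m) / 2 \<le> qq i" for m i
    using nxt[OF Jge[of m]] by (auto simp: JS)
  have Jmono: "strict_mono J" using J(1) by (simp add: strict_mono_Suc_iff)
  have Jm: "m \<le> J m" for m using strict_mono_imp_increasing[OF Jmono] .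
  have apm: "approximants A (J m) (\<epsilon> (J m) * qq (J m)) (w (J m)) (h (J m))" for m by (rule ap[OF Jge])
  note ap' = apm[unfolded approximants_def]
  have lp: "lip_pair (w (J m) n) (h (J m) n)" and w01: "0 \<le> w (J m) n y" "w (J m) n y \<le> 1"
    and winc: "w (J m) n y \<le> w (J m) (Suc n) y" and hinc: "h (J m) n y \<le> h (J m) (Suc n) y"
    and hC: "\<exists>C. \<forall>y. h (J m) n y \<le> C" and w0: "y \<notin> ball x (2 * rr (J m)) \<Longrightarrow> w (J m) n y = 0" for m n y
    using ap' by blast+
  define E where "E = (\<lambda>m. \<epsilon> (J m) * qq (J m))"
  have E0: "0 \<le> E m" for m using \<epsilon>(1)[of "J m"] by (simp add: E_def)
  define fb where "fb = (\<lambda>m n. block_fun (J (Suc m)) (w (J m) n))"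
  define Hb where "Hb = (\<lambda>m n. block_grad (J (Suc m)) (w (J m) n) (h (J m) n))"
  have lpb: "lip_pair (fb m n) (Hb m n)" for m n unfolding fb_def Hb_def by (intro lip_pair_block lp)
  define c where "c = 1 / (4 * Cd)"
  have est: "(\<integral>\<^sup>+y. ennreal (Hb m n y) \<partial>M) \<le> ennreal ((6 + 24 * CP) * E m)"
    "(\<integral>\<^sup>+y\<in>ball x (rr l). ennreal (fb m n y) \<partial>M) \<le> ennreal (24 * CP * E m * rr l)" for m n l
  proof -
    have EE: "(\<integral>\<^sup>+y. ennreal (h (J m) n y) \<partial>M) \<le> ennreal (E m)" unfolding E_def by (rule approximants_energy[OF apm])
    \<comment> \<open>The average bound is used up to and including the end scale J (Suc m), where
      the density may have dropped by a further factor Cd; hence a constant of order 1 / Cd. The 4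
      ensures c \<le> 1/4.\<close>
    have c1: "c * qq (J m) \<le> qq i" if i: "J m \<le> i" "i \<le> J (Suc m)" for i
    proof (cases "i < J (Suc m)")
      case True
      have "c * qq (J m) \<le> 1/4 * qq (J m)" unfolding c_def using small_half by (intro mult_right_mono) auto
      then show ?thesis using J(3)[OF i(1) True] qq_pos[of "J m"] by linarith
    next
      case False
      define i' where "i' = J (Suc m) - 1"
      have i': "J m \<le> i'" "i' < J (Suc m)" "Suc i' = i" using J(1)[of m] False i by (auto simp: i'_def)
      have "qq (J m) / 2 \<le> Cd * qq i" using J(3)[OF i'(1,2)] qq_le_Suc[of i'] i'(3) by simp
      then have "qq (J m) / (2 * Cd) \<le> qq i" using Cd by (simp add: field_simps)
      moreover have "c * qq (J m) \<le> qq (J m) / (2 * Cd)" using Cd by (simp add: c_def field_simps)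
      ultimately show ?thesis by simp
    qed
    have small: "12 * (drift_K * E m) < c * qq (J m)"
      using mult_strict_right_mono[OF j0(2)[OF Jge[of m]], of "qq (J m)"] by (simp add: E_def c_def)
    have c0: "0 < c" "c \<le> 1/4" unfolding c_def by (rule small_half)+
    show "(\<integral>\<^sup>+y. ennreal (Hb m n y) \<partial>M) \<le> ennreal ((6 + 24 * CP) * E m)"
      "(\<integral>\<^sup>+y\<in>ball x (rr l). ennreal (fb m n y) \<partial>M) \<le> ennreal (24 * CP * E m * rr l)"
      unfolding Hb_def fb_def
      by (rule block_estimates[OF lp w01 hC EE E0 w0 j0(1)[OF Jge] c0 c1 less_imp_le[OF J(1)] small]; assumption)+
  qed
  \<comment> \<open>The factor 1 and the subtraction of 0 match \<open>lip_pair_clip\<close>;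
    clipping restores the bound 1, which overlapping blocks may violate.\<close>
  define f where "f = (\<lambda>n y. clip (1 * (\<Sum>m\<le>n. fb m n y) - 0))"
  define H where "H = (\<lambda>n y. 1 * (\<Sum>m\<le>n. Hb m n y))"
  have lpf: "lip_pair (f n) (H n)" for n unfolding f_def H_def by (intro lip_pair_clip lip_pair_sum lpb) auto
  have fb0: "0 \<le> fb m n y" for m n y unfolding fb_def by (rule block_fun_bounds)
  have Hb0: "0 \<le> Hb m n y" for m n y by (rule lip_pair_grad_nonneg[OF lpb])
  have finc: "f n y \<le> f (Suc n) y" for n y
  proof -
    have "(\<Sum>m\<le>n. fb m n y) \<le> (\<Sum>m\<le>n. fb m (Suc n) y)"
      unfolding fb_def by (intro sum_mono block_fun_mono winc)
    also have "\<dots> \<le> (\<Sum>m\<le>Suc n. fb m (Suc n) y)" using fb0 by simp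
    finally show ?thesis unfolding f_def by (intro clip_mono) simp
  qed
  have Hinc: "H n y \<le> H (Suc n) y" for n y
  proof -
    have "(\<Sum>m\<le>n. Hb m n y) \<le> (\<Sum>m\<le>n. Hb m (Suc n) y)"
      unfolding Hb_def by (intro sum_mono block_grad_mono winc hinc)
    also have "\<dots> \<le> (\<Sum>m\<le>Suc n. Hb m (Suc n) y)" using Hb0 by simp
    finally show ?thesis unfolding H_def by simp
  qed
  \<comment> \<open>What block m can contribute in B(x, \<open>rr l\<close>), up to constants:
    nothing once l has passed the inner radius of its gradient.\<close>
  define b where "b = (\<lambda>l m. if l < J (Suc m) + 4 then \<epsilon> (J m) * qq (J m) else 0)"
  have b0: "0 \<le> b l m" for l m using \<epsilon>(1)[of "J m"] by (simp add: b_def)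
  have CPK: "0 \<le> 6 + 24 * CP" using CP by simp
  have HL: "(\<integral>\<^sup>+y\<in>ball x (rr l). (SUP n. ennreal (H n y)) \<partial>M) \<le> ennreal X"
    if X: "\<And>n. (6 + 24 * CP) * (\<Sum>m\<le>n. b l m) \<le> X" for l X
  proof (rule sup_integral_le[where f = H, OF lip_pair_grad_continuous[OF lpf] Hinc])
    fix n
    have "(\<integral>\<^sup>+y\<in>ball x (rr l). ennreal (\<Sum>m\<in>{..n}. Hb m n y) \<partial>M) \<le> ennreal (\<Sum>m\<in>{..n}. (6 + 24 * CP) * b l m)"
    proof (rule set_integral_sum_le)
      fix m
      show "(\<integral>\<^sup>+y\<in>ball x (rr l). ennreal (Hb m n y) \<partial>M) \<le> ennreal ((6 + 24 * CP) * b l m)"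
      proof (cases "l < J (Suc m) + 4")
        case True
        have "(\<integral>\<^sup>+y\<in>ball x (rr l). ennreal (Hb m n y) \<partial>M) \<le> (\<integral>\<^sup>+y. ennreal (Hb m n y) \<partial>M)"
          by (intro nn_integral_mono) (auto simp: indicator_def)
        also note est(1)
        finally show ?thesis using True by (simp add: b_def E_def)
      next
        case False
        have z: "ennreal (Hb m n y) * indicator (ball x (rr l)) y = 0" for y
        proof (cases "y \<in> ball x (rr l)")
          case True
          then have "y \<in> ball x (rr (J (Suc m) + 4))" using rr_antimono[of "J (Suc m) + 4" l] False by auto
          then show ?thesis unfolding Hb_def by (simp only: block_grad_inside ennreal_0 mult_zero_left)
        qed simp
        show ?thesis unfolding z by simp
      qed
    qed (use b0 CPK Hb0 lip_pair_grad_continuous[OF lpb] in auto)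
    also have "\<dots> \<le> ennreal X" using X[of n] by (intro ennreal_leI) (simp add: sum_distrib_left)
    finally show "(\<integral>\<^sup>+y\<in>ball x (rr l). ennreal (H n y) \<partial>M) \<le> ennreal X" by (simp add: H_def)
  qed simp
  have FL: "(\<integral>\<^sup>+y\<in>ball x (rr l). (SUP n. ennreal (f n y)) \<partial>M) \<le> ennreal X"
    if X: "\<And>n. 24 * CP * rr l * (\<Sum>m\<le>n. b l m) \<le> X" for l X
  proof (rule sup_integral_le[where f = f, OF lip_pair_continuous[OF lpf] finc])
    fix n
    have "(\<integral>\<^sup>+y\<in>ball x (rr l). ennreal (f n y) \<partial>M) \<le> (\<integral>\<^sup>+y\<in>ball x (rr l). ennreal (\<Sum>m\<in>{..n}. fb m n y) \<partial>M)"
      using fb0 by (intro nn_integral_mono mult_right_mono ennreal_leI) (auto simp: f_def clip_def sum_nonneg)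
    also have "\<dots> \<le> ennreal (\<Sum>m\<in>{..n}. 24 * CP * rr l * b l m)"
    proof (rule set_integral_sum_le)
      fix m
      show "(\<integral>\<^sup>+y\<in>ball x (rr l). ennreal (fb m n y) \<partial>M) \<le> ennreal (24 * CP * rr l * b l m)"
      proof (cases "l < J (Suc m) + 4")
        case True
        then show ?thesis using est(2)[where m = m and n = n and l = l] by (simp add: b_def E_def ac_simps)
      next
        case False
        have z: "ennreal (fb m n y) * indicator (ball x (rr l)) y = 0" for y
        proof (cases "y \<in> ball x (rr l)")
          case True
          then have "y \<in> ball x (rr (J (Suc m) + 2))" using rr_antimono[of "J (Suc m) + 2" l] False by auto
          then show ?thesis unfolding fb_def by (simp only: block_fun_inside ennreal_0 mult_zero_left)
        qed simp
        show ?thesis unfolding z by simp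
      qed
    qed (use b0 CP fb0 lip_pair_continuous[OF lpb] in auto)
    also have "\<dots> \<le> ennreal X" using X[of n] by (intro ennreal_leI) (simp add: sum_distrib_left)
    finally show "(\<integral>\<^sup>+y\<in>ball x (rr l). ennreal (f n y) \<partial>M) \<le> ennreal X" .
  qed simp
  have tail: "\<exists>l0. \<forall>l\<ge>l0. \<forall>n. (\<Sum>m\<le>n. b l m) \<le> \<delta> * qq l" if "\<delta> > 0" for \<delta>
  proof -
    define \<delta>' where "\<delta>' = \<delta> / (4 * Cd ^ 4)"
    have \<delta>': "0 < \<delta>'" "4 * Cd ^ 4 * \<delta>' = \<delta>" using that Cd by (auto simp: \<delta>'_def)
    obtain N where N: "\<And>l. N \<le> l \<Longrightarrow> \<epsilon> l < \<delta>'"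
      using order_tendstoD(2)[OF \<epsilon>(2) \<delta>'(1)] by (auto simp: eventually_sequentially)
    have "\<epsilon> (J m) \<le> \<delta>'" if "N \<le> m" for m using N[of "J m"] Jm[of m] that by simp
    then have "(\<Sum>m\<le>n. b l m) \<le> \<delta> * qq l" if "J (Suc N) + 4 \<le> l" for l n
      unfolding b_def \<delta>'(2)[symmetric] using \<delta>'(1) that by (intro tail_sum[where N = N] J) auto
    then show ?thesis by blast
  qed
  show ?thesis
  proof (rule thin_neighbourhood_from_family[where f = f and H = H and \<rho> = "2 * rr j0" and R = "rr j0"])
    show "lip_pair (f n) (H n)" for n by (rule lpf)
    show "0 \<le> f n y" "f n y \<le> 1" for n y by (simp_all add: f_def)
    show "f n y \<le> f (Suc n) y" for n y by (rule finc)
    show "f n y = 0" if y: "y \<notin> ball x (2 * rr j0)" for n y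
    proof -
      have "fb m n y = 0" for m
      proof -
        have "y \<notin> ball x (2 * rr (J m))" using y rr_antimono[OF Jge[of m]] by auto
        then show ?thesis unfolding fb_def using w0 by (intro block_fun_outside) auto
      qed
      then show ?thesis by (simp add: f_def clip_def)
    qed
    show "\<exists>n. 2/3 < f n y" if y: "y \<in> A \<inter> ball x (rr j0)" for y
    proof -
      have "0 < dist x y" using xA y by auto
      then obtain N where N: "rr N < dist x y"
        using order_tendstoD(2)[OF rr_tendsto] unfolding eventually_sequentially by blast
      \<comment> \<open>The shell containing y is that of the first block whose inner radius does
        not exceed the distance from x.\<close>
      define m where "m = (LEAST m. rr (J (Suc m)) \<le> dist x y)"
      have "rr (J (Suc N)) \<le> dist x y" using N rr_antimono[of N "J (Suc N)"] Jm[of "Suc N"] by simp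
      then have m: "rr (J (Suc m)) \<le> dist x y" unfolding m_def by (rule LeastI)
      have "dist x y < rr (J m)"
      proof (cases m)
        case 0
        then show ?thesis using y by (simp add: J_def)
      next
        case (Suc m')
        then show ?thesis using not_less_Least[of m' "\<lambda>m. rr (J (Suc m)) \<le> dist x y"] unfolding m_def[symmetric] by simp
      qed
      then have "y \<in> A \<inter> ball x (rr (J m))" using y by simp
      then obtain n1 where n1: "1/2 < w (J m) n1 y" using ap'[of m] by blast
      \<comment> \<open>n has two roles: it is the last block of the sum and the index of the
        approximants.\<close>
      define n where "n = max m n1"
      have "w (J m) n1 y \<le> w (J m) n y"
        using lift_Suc_mono_le[of "\<lambda>n. w (J m) n y", OF winc] by (simp add: n_def)
      then have "fb m n y = 1" unfolding fb_def using n1 m by (intro block_fun_eq_1) auto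
      moreover have "fb m n y \<le> (\<Sum>m\<le>n. fb m n y)" using fb0 by (intro member_le_sum) (auto simp: n_def)
      ultimately have "f n y = 1" unfolding f_def by (intro clip_eq_1) simp
      then show ?thesis by (intro exI[of _ n]) simp
    qed
    show "(\<integral>\<^sup>+y. (SUP n. ennreal (H n y)) \<partial>M) < \<infinity>"
    proof -
      \<comment> \<open>The bound for \<epsilon> read off from the smallness condition beyond j0;
        the total energy is then controlled by the geometric decay of the densities.\<close>
      define \<delta>1 where "\<delta>1 = 1 / (48 * Cd * drift_K)"
      have \<delta>1_nonneg: "0 \<le> \<delta>1" using Cd drift_K_pos by (simp add: \<delta>1_def)
      have \<delta>1: "\<epsilon> l \<le> \<delta>1" if "j0 \<le> l" for l
        using j0(2)[OF that] Cd drift_K_pos by (auto simp: \<delta>1_def field_simps)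
      have geo: "qq (J m) \<le> qq j0 * (1/2) ^ m" for m
      proof (induction m)
        case (Suc m)
        then show ?case using J(2)[of m] by simp
      qed (simp add: J_def)
      have sumE: "(\<Sum>m\<le>n. E m) \<le> 2 * (\<delta>1 * qq j0)" for n
      proof (rule geometric_sum_le[where ?m0.0 = 0])
        show "E m \<le> \<delta>1 * qq j0 * (1/2) ^ (m - 0)" for m
          unfolding E_def mult.assoc diff_zero using \<delta>1 \<delta>1_nonneg Jge geo by (intro mult_mono) auto
      qed (use \<delta>1_nonneg in auto)
      have "(\<integral>\<^sup>+y\<in>UNIV. (SUP n. ennreal (H n y)) \<partial>M) \<le> ennreal ((6 + 24 * CP) * (2 * (\<delta>1 * qq j0)))"
      proof (rule sup_integral_le[where f = H, OF lip_pair_grad_continuous[OF lpf] Hinc])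
        fix n
        have "(\<integral>\<^sup>+y\<in>UNIV. ennreal (\<Sum>m\<in>{..n}. Hb m n y) \<partial>M) \<le> ennreal (\<Sum>m\<in>{..n}. (6 + 24 * CP) * E m)"
          using est(1) E0 CPK Hb0 lip_pair_grad_continuous[OF lpb] by (intro set_integral_sum_le) auto
        also have "\<dots> \<le> ennreal ((6 + 24 * CP) * (2 * (\<delta>1 * qq j0)))"
          unfolding sum_distrib_left[symmetric] using sumE CPK by (intro ennreal_leI mult_left_mono) auto
        finally show "(\<integral>\<^sup>+y\<in>UNIV. ennreal (H n y) \<partial>M) \<le> ennreal ((6 + 24 * CP) * (2 * (\<delta>1 * qq j0)))" by (simp add: H_def)
      qed simp
      then show ?thesis by (simp add: le_less_trans)
    qed
  next
    fix \<delta> :: real assume \<delta>: "\<delta> > 0"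
    have "\<delta> / Cd / (6 + 24 * CP) > 0" using \<delta> Cd CP by simp
    then obtain l0 where l0: "\<And>l n. l0 \<le> l \<Longrightarrow> (\<Sum>m\<le>n. b l m) \<le> \<delta> / Cd / (6 + 24 * CP) * qq l" using tail by blast
    have "\<forall>\<^sub>F r in at_right 0. (\<integral>\<^sup>+y\<in>ball x r. (SUP n. ennreal (H n y)) \<partial>M) \<le> ennreal (Cd * (\<delta> / Cd) * (measure M (ball x r) / r))"
    proof (rule eventually_small_from_dyadic_ratio[where ?l0.0 = l0])
      show "(\<integral>\<^sup>+y\<in>ball x s. (SUP n. ennreal (H n y)) \<partial>M) \<le> (\<integral>\<^sup>+y\<in>ball x t. (SUP n. ennreal (H n y)) \<partial>M)"
        if "s \<le> t" for s t by (rule set_integral_mono_ball[OF that])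
      fix l assume "l0 \<le> l"
      show "(\<integral>\<^sup>+y\<in>ball x (rr l). (SUP n. ennreal (H n y)) \<partial>M) \<le> ennreal (\<delta> / Cd * qq l)"
      proof (rule HL)
        fix n
        show "(6 + 24 * CP) * (\<Sum>m\<le>n. b l m) \<le> \<delta> / Cd * qq l"
          using mult_left_mono[OF l0[OF \<open>l0 \<le> l\<close>, of n] CPK] CP by simp
      qed
    qed (use \<delta> Cd in auto)
    then show "\<forall>\<^sub>F r in at_right 0. (\<integral>\<^sup>+y\<in>ball x r. (SUP n. ennreal (H n y)) \<partial>M) \<le> ennreal (\<delta> * (measure M (ball x r) / r))"
      using Cd by simp
  next
    fix \<delta> :: real assume \<delta>: "\<delta> > 0"
    have "\<delta> / Cd / (24 * CP) > 0" using \<delta> Cd CP by simp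
    then obtain l0 where l0: "\<And>l n. l0 \<le> l \<Longrightarrow> (\<Sum>m\<le>n. b l m) \<le> \<delta> / Cd / (24 * CP) * qq l" using tail by blast
    have "\<forall>\<^sub>F r in at_right 0. (\<integral>\<^sup>+y\<in>ball x r. (SUP n. ennreal (f n y)) \<partial>M) \<le> ennreal (Cd * (\<delta> / Cd) * measure M (ball x r))"
    proof (rule eventually_small_from_dyadic[where ?l0.0 = l0])
      show "(\<integral>\<^sup>+y\<in>ball x s. (SUP n. ennreal (f n y)) \<partial>M) \<le> (\<integral>\<^sup>+y\<in>ball x t. (SUP n. ennreal (f n y)) \<partial>M)"
        if "s \<le> t" for s t by (rule set_integral_mono_ball[OF that])
      fix l assume "l0 \<le> l"
      show "(\<integral>\<^sup>+y\<in>ball x (rr l). (SUP n. ennreal (f n y)) \<partial>M) \<le> ennreal (\<delta> / Cd * mm l)"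
      proof (rule FL)
        fix n
        have "24 * CP * rr l * (\<Sum>m\<le>n. b l m) \<le> 24 * CP * rr l * (\<delta> / Cd / (24 * CP) * qq l)"
          using CP by (intro mult_left_mono l0 \<open>l0 \<le> l\<close>) auto
        also have "\<dots> = \<delta> / Cd * mm l" using CP by (simp add: mm_eq)
        finally show "24 * CP * rr l * (\<Sum>m\<le>n. b l m) \<le> \<delta> / Cd * mm l" .
      qed
    qed (use \<delta> Cd in auto)
    then show "\<forall>\<^sub>F r in at_right 0. (\<integral>\<^sup>+y\<in>ball x r. (SUP n. ennreal (f n y)) \<partial>M) \<le> ennreal (\<delta> * measure M (ball x r))"
      using Cd by simp
  qed simp
qed

section \<open>The alternative between one infinite block and infinitely many blocks\<close>

lemma thin_neighbourhood:
  assumes "x \<notin> A" "thin1 M A x"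
  shows "has_thin_neighbourhood x A"
proof -
  obtain \<epsilon> :: "nat \<Rightarrow> real" and l1 where \<epsilon>: "\<And>l. 0 < \<epsilon> l" "\<epsilon> \<longlonglongrightarrow> 0"
    and ex: "\<And>l. l1 \<le> l \<Longrightarrow> \<exists>w h. approximants A l (\<epsilon> l * qq l) w h"
    using thin_approximants[OF assms(2)] by blast
  obtain w h where wh: "\<And>l. l1 \<le> l \<Longrightarrow> approximants A l (\<epsilon> l * qq l) (w l) (h l)"
    using ex by metis
  have "0 < dist x z / 8" using x_neq_z by simp
  then obtain l2 where l2: "\<And>l. l2 \<le> l \<Longrightarrow> rr l < dist x z / 8"
    using order_tendstoD(2)[OF rr_tendsto] unfolding eventually_sequentially by blast
  have "0 < 1 / (4 * Cd) / (12 * drift_K)" using Cd drift_K_pos by simp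
  then obtain l3 where l3: "\<And>l. l3 \<le> l \<Longrightarrow> \<epsilon> l < 1 / (4 * Cd) / (12 * drift_K)"
    using order_tendstoD(2)[OF \<epsilon>(2)] unfolding eventually_sequentially by blast
  \<comment> \<open>Beyond j0 approximants exist, annuli carry mass, and the energies satisfy the
    smallness condition of \<open>block_average\<close>.\<close>
  define j0 where "j0 = max l1 (max l2 l3)"
  have j0: "8 * rr l < dist x z" "12 * (drift_K * \<epsilon> l) < 1 / (4 * Cd)" "l1 \<le> l" if "j0 \<le> l" for l
  proof -
    show "8 * rr l < dist x z" using l2[of l] that by (simp add: j0_def)
    have "\<epsilon> l < 1 / (4 * Cd) / (12 * drift_K)" using l3 that by (simp add: j0_def)
    moreover have "0 < 12 * drift_K" using drift_K_pos by simp
    ultimately have "\<epsilon> l * (12 * drift_K) < 1 / (4 * Cd)" using pos_less_divide_eq by blast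
    then show "12 * (drift_K * \<epsilon> l) < 1 / (4 * Cd)" by (simp add: ac_simps)
    show "l1 \<le> l" using that by (simp add: j0_def)
  qed
  show ?thesis
  proof (cases "\<forall>j\<ge>j0. \<exists>k>j. qq k \<le> qq j / 2")
    case True
    then show ?thesis
      using thin_neighbourhood_many_blocks[OF assms(1) wh \<epsilon>, of j0] j0 by blast
  next
    case False
    then obtain j where j: "j0 \<le> j" "\<And>k. j < k \<Longrightarrow> qq j / 2 < qq k" by (auto simp: not_le)
    have "qq j / 2 \<le> qq l" if "j \<le> l" for l
      using j(2)[of l] that qq_pos[of j] by (cases "l = j") auto
    moreover have "12 * (drift_K * (\<epsilon> j * qq j)) < 1 / (4 * Cd) * qq j"
      using mult_strict_right_mono[OF j0(2)[OF j(1)], of "qq j"] by simp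
    ultimately show ?thesis
      using thin_neighbourhood_single_block[OF wh[OF j0(3)[OF j(1)]]] j0(1)[OF j(1)] \<epsilon>(1)[of j] by (simp add: less_imp_le)
  qed
qed

end

theorem theorem3p6:
  fixes M :: "'a::complete_space measure" and A :: "'a set" and x :: 'a
  assumes "PI_space M"
    and "x \<notin> A"
    and "thin1 M A x"
  shows "\<exists>R>0. \<exists>G V \<eta>. open G \<and> open V \<and> G \<subseteq> V \<and> \<eta> \<in> N011 M V \<and>
           A \<inter> ball x R \<subseteq> G \<and> thin1 M V x \<and>
           (\<forall>y. 0 \<le> \<eta> y \<and> \<eta> y \<le> 1) \<and> (\<forall>y\<in>G. \<eta> y = 1) \<and>
           ((\<lambda>r. ennreal r / emeasure M (ball x r) * N11_norm M (ball x r) \<eta>) \<longlongrightarrow> 0) (at_right 0)"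
proof -
  have two: "\<exists>a b::'a. a \<noteq> b" and reg: "borel_regular M" and "doubling M" and "poincare_11 M"
    using assms(1) by (auto simp: PI_space_def)
  obtain Cd' :: real where Cd': "\<And>y r. r > 0 \<Longrightarrow> 0 < emeasure M (ball y r)"
    "\<And>y r. r > 0 \<Longrightarrow> emeasure M (ball y (2 * r)) \<le> ennreal Cd' * emeasure M (ball y r)"
    "\<And>y r. r > 0 \<Longrightarrow> emeasure M (ball y (2 * r)) < \<infinity>"
    using \<open>doubling M\<close> unfolding doubling_def by blast
  obtain CP lam :: real where P: "CP > 0" "lam \<ge> 1" "\<And>y r u g. r > 0 \<Longrightarrow> L1_loc M u \<Longrightarrow> upper_gradient UNIV u g \<Longrightarrow>
      (\<integral>\<^sup>+ z\<in>ball y r. ennreal \<bar>u z - (LINT z:ball y r|M. u z) / measure M (ball y r)\<bar> \<partial>M) / emeasure M (ball y r)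
          \<le> ennreal (CP * r) * ((\<integral>\<^sup>+ z\<in>ball y (lam * r). g z \<partial>M) / emeasure M (ball y (lam * r)))"
    using \<open>poincare_11 M\<close> unfolding poincare_11_def Let_def by blast
  obtain z where z: "x \<noteq> z" using two by metis
  \<comment> \<open>A doubling constant may be enlarged; this secures Cd \<ge> 1.\<close>
  interpret pointed_pi_space M "max 1 Cd'" CP lam x z
  proof
    show "emeasure M (ball y (2 * r)) \<le> ennreal (max 1 Cd') * emeasure M (ball y r)" if "0 < r" for y r
      using Cd'(2)[OF that, of y] by (rule order_trans) (auto intro!: mult_right_mono ennreal_leI)
  qed (use two reg Cd' P z in auto)
  show ?thesis using thin_neighbourhood[OF assms(2,3)] unfolding has_thin_neighbourhood_def .
qed

end
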